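(* Let $(X,d)$ be a proper metric space, $1\le p<\infty$, and $f:X\to X$ continuous. Assume: \begin{itemize} \item $f_*$ is a $w_p$-continuous self-map of $\mathcal P_p(X)$ having a global attractor $\mathcal K$; \item $f_*$ is uniformly continuous on a $w_p$-neighborhood of $\mathcal K$; \item $P_n$ are MW-maps of order $p$ relative to $f$ with noise levels $\epsilon_n\to0$. \end{itemize} Then there exists $n_0$ such that for every $n\ge n_0$ there is a positively $P_n$-invariant isolating neighborhood $N_n$ for which $K_n=A_{P_n}(N_n)$ has the following properties: \begin{itemize} \item $K_n$ is non-empty and weakly compact; \item $K_n$ is a weak attractor of $P_n$; \item $K_n$ contains all bounded full $P_n$-orbits in $\mathcal P_p(X)$, i.e. $A_{P_n}(\mathcal P_p(X))=K_n$; \item $K_n$ contains at least one stationary measure of $P_n$, i.e. some $\nu\in K_n$ with $P_n\nu=\nu$. \end{itemize}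
   Context: $\mathcal P_p(X)$ is the set of Borel probability measures with finite $p$-th moment, with the Wasserstein distance $w_p$. The weak topology on $\mathcal P_p(X)$ is narrow convergence, i.e. the subspace topology from $\mathcal P_p(X)\subset\mathcal P(X)$. $f_*\mu=\mu\circ f^{-1}$. A global attractor of a map $F$ on a metric space is a compact $F$-invariant set $\mathcal K$ such that $\sup_{y\in F^n(\mathcal B)}\operatorname{dist}(y,\mathcal K)\to0$ for every bounded set $\mathcal B$. An MW-map of order $p$ relative to $f$ with noise level $M$ is a map $P(\mu)(dy)=\int p(dy|x)\,d\mu(x)$ with the following properties: \begin{itemize} \item $x\mapsto p(dy|x)\in\mathcal P_p(X)$ is a kernel; \item $P$ is $w_p$-continuous and convex linear on $\mathcal P_p(X)$; \item $\sup_x w_p(p(dy|x),\delta_{f(x)})\le M$. \end{itemize} For a map $F$ and a set $N$, $A_F(N)$ is the maximal invariant set in $N$: the set of points through which there is a full orbit $\{\sigma(k)\}_{k\in\mathbb Z}\subset N$ with $F(\sigma(k))=\sigma(k+1)$. For unbounded $N$, only bounded full orbits are counted. An isolating neighborhood of an invariant set $K$ is a closed neighborhood $N$ with $A_F(N)=K$; it is positively invariant if $F(N)\subset N$. A weak attractor of $F$ is an isolated invariant set $K$ with a positively invariant isolating neighborhood $N$ such that every weak limit of $F^{m_k}(\mu_k)$, with $\mu_k\in N$ and $m_k\to\infty$, lies in $K$. *)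

theory Defs
  imports "HOL-Analysis.Analysis" "HOL-Probability.Probability"
begin

definition proper_space :: "'a::metric_space itself \<Rightarrow> bool" where
  "proper_space _ \<longleftrightarrow> (\<forall>x::'a. \<forall>r. compact (cball x r))"

definition Prob :: "'a::topological_space measure set" where
  "Prob = {\<mu>. prob_space \<mu> \<and> sets \<mu> = sets borel}"

definition Pp :: "real \<Rightarrow> 'a::metric_space measure set" where
  "Pp p = {\<mu>\<in>Prob. \<exists>x0. (\<integral>\<^sup>+ x. ennreal (dist x0 x powr p) \<partial>\<mu>) < \<infinity>}"

definition couplings :: "'a::metric_space measure \<Rightarrow> 'a measure \<Rightarrow> ('a \<times> 'a) measure set" where
  "couplings \<mu> \<nu> = {\<pi>. prob_space \<pi> \<and> sets \<pi> = sets (borel \<Otimes>\<^sub>M borel)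
       \<and> distr \<pi> borel fst = \<mu> \<and> distr \<pi> borel snd = \<nu>}"

definition wass :: "real \<Rightarrow> 'a::metric_space measure \<Rightarrow> 'a measure \<Rightarrow> real" where
  "wass p \<mu> \<nu> = enn2real (INF \<pi>\<in>couplings \<mu> \<nu>.
       \<integral>\<^sup>+ z. ennreal (dist (fst z) (snd z) powr p) \<partial>\<pi>) powr (1 / p)"

definition wp_top :: "real \<Rightarrow> 'a::metric_space measure topology" where
  "wp_top p = Metric_space.mtopology (Pp p) (wass p)"

definition wp_bounded :: "real \<Rightarrow> 'a::metric_space measure set \<Rightarrow> bool" where
  "wp_bounded p S = Metric_space.mbounded (Pp p) (wass p) S"

definition narrow_top :: "'a::metric_space measure topology" where
  "narrow_top = topology_generated_by
     {{\<mu>\<in>Prob. (\<integral>x. g x \<partial>\<mu>) \<in> U} | (g :: 'a \<Rightarrow> real) U.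
        continuous_on UNIV g \<and> bounded (range g) \<and> open U}"

definition weak_top :: "real \<Rightarrow> 'a::metric_space measure topology" where
  "weak_top p = subtopology narrow_top (Pp p)"

definition global_attractor ::
  "real \<Rightarrow> ('a::metric_space measure \<Rightarrow> 'a measure) \<Rightarrow> 'a measure set \<Rightarrow> bool" where
  "global_attractor p F K \<longleftrightarrow>
     K \<subseteq> Pp p \<and> compactin (wp_top p) K \<and> F ` K = K \<and>
     (\<forall>B. B \<subseteq> Pp p \<and> wp_bounded p B \<longrightarrow>
        (\<forall>\<epsilon>>0. \<exists>N. \<forall>n\<ge>N. \<forall>y\<in>(F ^^ n) ` B. \<exists>k\<in>K. wass p y k < \<epsilon>))"

definition max_inv ::
  "real \<Rightarrow> ('a::metric_space measure \<Rightarrow> 'a measure) \<Rightarrow> 'a measure set \<Rightarrow> 'a measure set" where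
  "max_inv p F N = {x. \<exists>\<sigma> :: int \<Rightarrow> 'a measure. x \<in> range \<sigma> \<and> range \<sigma> \<subseteq> N \<and>
       (\<forall>k. F (\<sigma> k) = \<sigma> (k + 1)) \<and> wp_bounded p (range \<sigma>)}"

definition isolating_nbhd ::
  "real \<Rightarrow> ('a::metric_space measure \<Rightarrow> 'a measure) \<Rightarrow> 'a measure set \<Rightarrow> 'a measure set \<Rightarrow> bool" where
  "isolating_nbhd p F N K \<longleftrightarrow>
     N \<subseteq> Pp p \<and> closedin (wp_top p) N \<and>
     (\<exists>V. openin (wp_top p) V \<and> K \<subseteq> V \<and> V \<subseteq> N) \<and> max_inv p F N = K"

definition pos_invariant :: "('b \<Rightarrow> 'b) \<Rightarrow> 'b set \<Rightarrow> bool" where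
  "pos_invariant F N \<longleftrightarrow> F ` N \<subseteq> N"

definition weak_attractor ::
  "real \<Rightarrow> ('a::metric_space measure \<Rightarrow> 'a measure) \<Rightarrow> 'a measure set \<Rightarrow> bool" where
  "weak_attractor p F K \<longleftrightarrow>
     F ` K = K \<and>
     (\<exists>N. isolating_nbhd p F N K \<and> pos_invariant F N \<and>
        (\<forall>\<mu>s m \<nu>. (\<forall>k. \<mu>s k \<in> N) \<and> filterlim m at_top sequentially \<and>
           limitin (weak_top p) (\<lambda>k. (F ^^ m k) (\<mu>s k)) \<nu> sequentially \<longrightarrow> \<nu> \<in> K))"

definition mix :: "real \<Rightarrow> 'a::topological_space measure \<Rightarrow> 'a measure \<Rightarrow> 'a measure" where
  "mix t \<mu> \<nu> = measure_of UNIV (sets borel)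
     (\<lambda>A. ennreal t * emeasure \<mu> A + ennreal (1 - t) * emeasure \<nu> A)"

definition MW_map ::
  "real \<Rightarrow> ('a::metric_space \<Rightarrow> 'a) \<Rightarrow> real \<Rightarrow> ('a measure \<Rightarrow> 'a measure) \<Rightarrow> bool" where
  "MW_map p f M P \<longleftrightarrow>
     (\<exists>k :: 'a \<Rightarrow> 'a measure.
        k \<in> borel \<rightarrow>\<^sub>M prob_algebra borel \<and> (\<forall>x. k x \<in> Pp p) \<and>
        (\<forall>\<mu>\<in>Pp p. P \<mu> = bind \<mu> k) \<and>
        (\<forall>x. wass p (k x) (return borel (f x)) \<le> M)) \<and>
     P ` Pp p \<subseteq> Pp p \<and> continuous_map (wp_top p) (wp_top p) P \<and>
     (\<forall>\<mu>\<in>Pp p. \<forall>\<nu>\<in>Pp p. \<forall>t\<in>{0..1}. P (mix t \<mu> \<nu>) = mix t (P \<mu>) (P \<nu>))"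

end

theory Submission
  imports Defs
begin

text \<open>
  Write \<open>|x|\<close> for the distance of \<open>x\<close> to a base point. Mixing a far away Dirac mass with a small weight into a
  fixed measure turns the two hypotheses on \<open>f\<^sub>*\<close> near \<open>K\<close> into statements about \<open>f\<close> at infinity: attraction by
  the uniformly \<open>p\<close>-integrable set \<open>K\<close> gives \<open>|f\<^sup>j(y)| \<le> D + \<eta> |y|\<close> for large \<open>j\<close>, and uniform continuity gives
  \<open>d(f(y), f(z)) \<le> \<epsilon> |z| + C d(y, z) + L\<close>. Consequently a chain that follows \<open>f\<close> up to an \<open>L\<^sup>p\<close> error of size 1
  satisfies \<open>\<parallel>X\<^sub>J\<parallel>\<^sub>p \<le> D + \<parallel>X\<^sub>0\<parallel>\<^sub>p / 2\<close> for some \<open>J\<close> and \<open>D\<close> that do not depend on the chain. All bounded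
  full orbits of \<open>P\<^sub>n\<close> therefore lie in one moment ball, which is narrowly compact by Prokhorov's theorem. As \<open>P\<^sub>n\<close>
  is narrowly continuous (its kernel has the Feller property), the attractor is the intersection of the forward images
  of a positively invariant, narrowly compact neighbourhood, and averaging along an orbit yields a stationary measure.
\<close>

section \<open>Bounds on norms of order p\<close>

text \<open>A \<open>wass\<close>-bounded set need not be precompact in \<open>wp_top\<close>, so
  compactness has to come from the narrow topology, while the maps \<open>P n\<close> are only
  assumed continuous for \<open>wass\<close>. The two topologies meet at Dirac masses:
  \<open>P n\<close> applied to \<open>return borel x\<close> is the kernel, and its dependence on
  \<open>x\<close> gives the Feller property. The order in which constants are chosen shapes the
  growth estimates. One application of \<open>f\<close> may multiply an error by a large constant
  \<open>C\<close>, and \<open>C\<close> depends on the slope that is tolerated. Therefore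
  \<open>J\<close> is fixed first, from \<open>f\<close> alone and with contraction factor 1/4; only
  then is the tracking error over these \<open>J\<close> steps made at most
  \<open>1/4 * dist x a + L\<close>. The two quarters add up to the factor 1/2. The map sending
  \<open>c\<close> to \<open>D + c/2\<close> has the fixed point \<open>2 * D\<close>, which bounds
  every bounded full orbit; the radius \<open>2 * D + 1\<close> leaves an open margin around it. A
  moment ball itself need not be positively invariant, since only the \<open>J\<close>-th iterate
  contracts. The neighbourhood consists instead of all measures whose whole forward orbit stays in a
  suitable ball.\<close>

text \<open>The bound on the norm of order \<open>p\<close> is kept as an extended nonnegative
  integral, so that neither integrability nor finiteness has to be carried along.
  \<open>0 \<le> B\<close> is required because \<open>powr\<close> is not monotone on negative
  reals.\<close>

definition Lp_le :: "real \<Rightarrow> 'b measure \<Rightarrow> ('b \<Rightarrow> real) \<Rightarrow> real \<Rightarrow> bool" where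
  "Lp_le p M h B \<longleftrightarrow> 0 \<le> B \<and> (\<integral>\<^sup>+ x. ennreal (h x powr p) \<partial>M) \<le> ennreal (B powr p)"

lemma Lp_le_nonneg: "Lp_le p M h B \<Longrightarrow> 0 \<le> B"
  by (simp add: Lp_le_def)

lemma Lp_le_mono_AE:
  assumes "1 \<le> p" "Lp_le p M h B" "AE x in M. 0 \<le> g x \<and> g x \<le> h x" "B \<le> C"
  shows "Lp_le p M g C"
proof -
  have "(\<integral>\<^sup>+ x. ennreal (g x powr p) \<partial>M) \<le> (\<integral>\<^sup>+ x. ennreal (h x powr p) \<partial>M)"
    by (intro nn_integral_mono_AE eventually_mono[OF assms(3)])
       (use assms(1) in \<open>auto intro!: ennreal_leI powr_mono2\<close>)
  also have "\<dots> \<le> ennreal (B powr p)" using assms(2) by (simp add: Lp_le_def)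
  also have "\<dots> \<le> ennreal (C powr p)"
    using assms by (intro ennreal_leI powr_mono2) (auto simp: Lp_le_def)
  finally show ?thesis using assms by (auto simp: Lp_le_def)
qed

lemma Lp_le_mono:
  assumes "1 \<le> p" "Lp_le p M h B" "\<And>x. 0 \<le> g x" "\<And>x. g x \<le> h x" "B \<le> C"
  shows "Lp_le p M g C"
  by (rule Lp_le_mono_AE[OF assms(1,2)]) (use assms in auto)

text \<open>Continuity of the \<open>p\<close>-th power from the right at \<open>B\<close>. It
  removes the slack that comes from couplings which are only nearly optimal.\<close>

lemma Lp_le_limit:
  assumes p: "1 \<le> p" and "0 \<le> B" and *: "\<And>\<delta>. 0 < \<delta> \<Longrightarrow> Lp_le p M h (B + \<delta>)"
  shows "Lp_le p M h B"
proof -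
  have "((\<lambda>\<delta>. ennreal ((B + \<delta>) powr p)) \<longlongrightarrow> ennreal ((B + 0) powr p)) (at_right 0)"
    by (intro tendsto_ennrealI tendsto_powr' tendsto_add tendsto_const tendsto_ident_at)
       (use p \<open>0 \<le> B\<close> in \<open>auto simp: eventually_at_filter\<close>)
  moreover have "eventually (\<lambda>\<delta>. (\<integral>\<^sup>+ x. ennreal (h x powr p) \<partial>M) \<le> ennreal ((B + \<delta>) powr p)) (at_right (0::real))"
    using * by (auto simp: eventually_at_filter Lp_le_def)
  ultimately have "(\<integral>\<^sup>+ x. ennreal (h x powr p) \<partial>M) \<le> ennreal ((B + 0) powr p)"
    by (rule tendsto_lowerbound) simp
  then show ?thesis using assms by (simp add: Lp_le_def)
qed

text \<open>Convexity of the \<open>p\<close>-th power at the mean of \<open>g / B\<close> and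
  \<open>h / C\<close> with weights \<open>B / (B + C)\<close> and \<open>C / (B + C)\<close>.
  Integrating this pointwise bound gives Minkowski's inequality.\<close>

lemma powr_add_le_convex:
  fixes g h B C p :: real
  assumes p: "1 \<le> p" and gh: "0 \<le> g" "0 \<le> h" and BC: "0 < B" "0 < C"
  shows "(g + h) powr p \<le> (B + C) powr p * (B / (B + C) * (g / B) powr p + C / (B + C) * (h / C) powr p)"
proof -
  \<comment> \<open>If one of the arguments is 0, convexity reduces to
    \<open>u powr p \<le> u\<close> for a weight \<open>u\<close> in the unit interval.\<close>
  have conv: "(u * a + v * b) powr p \<le> u * a powr p + v * b powr p"
    if "0 \<le> u" "0 \<le> v" "u + v = 1" "0 \<le> a" "0 \<le> b" for u v a b :: real
  proof (cases "a = 0 \<or> b = 0")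
    case False
    then show ?thesis
      using convex_onD[OF powr_convex[OF p], of v a b] that
      by (auto simp: eq_diff_eq[symmetric])
  next
    case True
    have small: "c powr p \<le> c" if "0 \<le> c" "c \<le> 1" for c :: real
      using that p powr_mono'[of 1 p c] by (cases "c = 0") auto
    show ?thesis
      using True that small[of u] small[of v]
      by (auto simp: powr_mult intro!: mult_right_mono)
  qed
  have "g + h = (B + C) * (B / (B + C) * (g / B) + C / (B + C) * (h / C))"
    using BC by (simp add: distrib_left add_pos_pos less_imp_neq[THEN not_sym])
  then have "(g + h) powr p = (B + C) powr p * (B / (B + C) * (g / B) + C / (B + C) * (h / C)) powr p"
    using BC gh by (metis add_nonneg_nonneg divide_nonneg_nonneg less_imp_le mult_nonneg_nonneg powr_mult)
  also have "\<dots> \<le> (B + C) powr p * (B / (B + C) * (g / B) powr p + C / (B + C) * (h / C) powr p)"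
    using BC gh by (intro mult_left_mono conv) (auto simp flip: add_divide_distrib)
  finally show ?thesis .
qed

text \<open>Minkowski's inequality. The normalisation divides by \<open>B\<close> and
  \<open>C\<close>, so positive bounds come first; the general case adds \<open>\<delta>/2\<close>
  to each and passes to the limit.\<close>

lemma Lp_le_add:
  assumes p: "1 \<le> p" and g: "Lp_le p M g B" and h: "Lp_le p M h C"
    and meas [measurable]: "g \<in> borel_measurable M" "h \<in> borel_measurable M"
    and nn: "\<And>x. 0 \<le> g x" "\<And>x. 0 \<le> h x"
  shows "Lp_le p M (\<lambda>x. g x + h x) (B + C)"
proof -
  have *: "Lp_le p M (\<lambda>x. g x + h x) (B + C)"
    if g: "Lp_le p M g B" and h: "Lp_le p M h C" and BC: "0 < B" "0 < C" for B C
  proof -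
    define c1 c2 where "c1 = (B + C) powr p * (B / (B + C)) / B powr p"
      and "c2 = (B + C) powr p * (C / (B + C)) / C powr p"
    have c: "0 \<le> c1" "0 \<le> c2" using BC by (auto simp: c1_def c2_def)
    have "(g x + h x) powr p \<le> c1 * g x powr p + c2 * h x powr p" for x
      using powr_add_le_convex[OF p nn(1)[of x] nn(2)[of x] BC] nn[of x] BC
      by (simp add: c1_def c2_def powr_divide algebra_simps)
    then have "(\<integral>\<^sup>+ x. ennreal ((g x + h x) powr p) \<partial>M)
        \<le> (\<integral>\<^sup>+ x. ennreal c1 * ennreal (g x powr p) + ennreal c2 * ennreal (h x powr p) \<partial>M)"
      using c by (intro nn_integral_mono) (simp flip: ennreal_mult ennreal_plus add: ennreal_leI)
    also have "\<dots> = ennreal c1 * (\<integral>\<^sup>+ x. ennreal (g x powr p) \<partial>M) + ennreal c2 * (\<integral>\<^sup>+ x. ennreal (h x powr p) \<partial>M)"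
      by (simp add: nn_integral_add nn_integral_cmult)
    also have "\<dots> \<le> ennreal c1 * ennreal (B powr p) + ennreal c2 * ennreal (C powr p)"
      using g h by (intro add_mono mult_left_mono) (auto simp: Lp_le_def)
    also have "\<dots> = ennreal (c1 * B powr p + c2 * C powr p)"
      using c by (simp flip: ennreal_mult ennreal_plus)
    also have "c1 * B powr p + c2 * C powr p = (B + C) powr p * (B / (B + C) + C / (B + C))"
      using BC by (simp add: c1_def c2_def distrib_left)
    also have "B / (B + C) + C / (B + C) = 1" using BC by (simp flip: add_divide_distrib)
    finally show ?thesis using BC by (simp add: Lp_le_def)
  qed
  show ?thesis
  proof (rule Lp_le_limit[OF p])
    show "0 \<le> B + C" using g h by (simp add: Lp_le_def)
    fix \<delta> :: real assume "0 < \<delta>"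
    then have "Lp_le p M (\<lambda>x. g x + h x) ((B + \<delta>/2) + (C + \<delta>/2))"
      using g h by (intro * Lp_le_mono[OF p g] Lp_le_mono[OF p h]) (auto simp: Lp_le_def nn)
    then show "Lp_le p M (\<lambda>x. g x + h x) (B + C + \<delta>)" by (simp add: algebra_simps)
  qed
qed

lemma Lp_le_const:
  assumes "prob_space M" "0 \<le> c"
  shows "Lp_le p M (\<lambda>_. c) c"
  using assms by (simp add: Lp_le_def prob_space.emeasure_space_1)

lemma Lp_le_scale:
  assumes "1 \<le> p" "Lp_le p M h B" "h \<in> borel_measurable M" "0 \<le> c" "\<And>x. 0 \<le> h x"
  shows "Lp_le p M (\<lambda>x. c * h x) (c * B)"
proof -
  have [measurable]: "h \<in> borel_measurable M" by fact
  have "(\<integral>\<^sup>+ x. ennreal ((c * h x) powr p) \<partial>M) = ennreal (c powr p) * (\<integral>\<^sup>+ x. ennreal (h x powr p) \<partial>M)"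
    using assms by (simp add: powr_mult ennreal_mult nn_integral_cmult)
  also have "\<dots> \<le> ennreal (c powr p) * ennreal (B powr p)"
    using assms by (intro mult_left_mono) (auto simp: Lp_le_def)
  finally show ?thesis using assms by (simp add: Lp_le_def powr_mult ennreal_mult)
qed

lemma Lp_le_distr:
  assumes "g \<in> measurable M N" "h \<in> borel_measurable N"
  shows "Lp_le p (distr M N g) h B \<longleftrightarrow> Lp_le p M (\<lambda>x. h (g x)) B"
  using assms by (simp add: Lp_le_def nn_integral_distr)

lemma Lp_le_return:
  assumes "1 \<le> p" "h \<in> borel_measurable borel" "0 \<le> h x"
  shows "Lp_le p (return borel x) h B \<longleftrightarrow> h x \<le> B"
proof -
  have "(h x powr p \<le> B powr p) = (h x \<le> B)" if "0 \<le> B"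
    using assms that powr_less_mono2[of p B "h x"] powr_mono2[of p "h x" B] by force
  then show ?thesis using assms by (auto simp: Lp_le_def nn_integral_return)
qed

text \<open>Fubini for kernels: the norm under \<open>bind M k\<close> is the norm under
  \<open>M\<close> of the fibrewise norms.\<close>

lemma Lp_le_bind:
  assumes "k \<in> measurable M (subprob_algebra N)" "h \<in> borel_measurable N"
    and "\<And>x. x \<in> space M \<Longrightarrow> Lp_le p (k x) h (B x)" "Lp_le p M B C"
  shows "Lp_le p (bind M k) h C"
proof -
  have [measurable]: "h \<in> borel_measurable N" by fact
  have "(\<integral>\<^sup>+ x. ennreal (h x powr p) \<partial>bind M k) = (\<integral>\<^sup>+ x. (\<integral>\<^sup>+ y. ennreal (h y powr p) \<partial>k x) \<partial>M)"
    by (intro nn_integral_bind[OF _ assms(1)]) simp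
  also have "\<dots> \<le> (\<integral>\<^sup>+ x. ennreal (B x powr p) \<partial>M)"
    using assms(3) by (intro nn_integral_mono) (simp add: Lp_le_def)
  finally show ?thesis using assms(4) by (auto simp: Lp_le_def)
qed

lemma borel_measurable_Lipschitz:
  fixes h :: "'a::metric_space \<Rightarrow> real"
  assumes "\<And>x y. \<bar>h x - h y\<bar> \<le> L * dist x y"
  shows "h \<in> borel_measurable borel"
proof -
  have "L \<le> \<bar>L\<bar> + 1" by simp
  then have "\<bar>h x - h y\<bar> \<le> (\<bar>L\<bar> + 1) * dist x y" for x y
    using assms[of x y] by (meson mult_right_mono order_trans zero_le_dist)
  then have "(\<bar>L\<bar> + 1)-lipschitz_on UNIV h"
    by (intro lipschitz_onI) (auto simp: dist_real_def)
  then show ?thesis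
    by (intro borel_measurable_continuous_onI lipschitz_on_continuous_on)
qed

lemma borel_measurable_dist_left [measurable]: "dist (a::'a::metric_space) \<in> borel_measurable borel"
  by (intro borel_measurable_continuous_onI continuous_intros)

lemma borel_measurable_dist_right [measurable]: "(\<lambda>x. dist x (a::'a::metric_space)) \<in> borel_measurable borel"
  by (intro borel_measurable_continuous_onI continuous_intros)

lemma ProbD: "\<mu> \<in> Prob \<Longrightarrow> prob_space \<mu>" "\<mu> \<in> Prob \<Longrightarrow> sets \<mu> = sets borel" "\<mu> \<in> Prob \<Longrightarrow> space \<mu> = UNIV"
  by (auto simp: Prob_def dest: sets_eq_imp_space_eq)

lemma return_in_Prob: "return borel x \<in> Prob"
  by (simp add: Prob_def prob_space_return)

text \<open>By Minkowski, finiteness of the moment does not depend on the base point, so one fixed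
  \<open>a\<close> can replace the existential one in \<open>Pp\<close>.\<close>

lemma in_Pp_iff:
  fixes a :: "'a::metric_space"
  assumes p: "1 \<le> p"
  shows "\<mu> \<in> Pp p \<longleftrightarrow> \<mu> \<in> Prob \<and> (\<exists>B. Lp_le p \<mu> (\<lambda>x. dist x a) B)"
proof (intro iffI conjI; (elim conjE exE)?)
  assume "\<mu> \<in> Pp p"
  then obtain x0 where \<mu>: "\<mu> \<in> Prob" and fin: "(\<integral>\<^sup>+ x. ennreal (dist x0 x powr p) \<partial>\<mu>) < \<infinity>"
    by (auto simp: Pp_def)
  then obtain r where r: "0 \<le> r" "(\<integral>\<^sup>+ x. ennreal (dist x0 x powr p) \<partial>\<mu>) = ennreal r"
    by (cases "\<integral>\<^sup>+ x. ennreal (dist x0 x powr p) \<partial>\<mu>") auto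
  have "Lp_le p \<mu> (\<lambda>x. dist x0 x) (r powr (1/p))"
    using r p by (simp add: Lp_le_def powr_powr)
  then have "Lp_le p \<mu> (\<lambda>x. dist x0 x + dist x0 a) (r powr (1/p) + dist x0 a)"
    by (intro Lp_le_add[OF p] Lp_le_const ProbD[OF \<mu>]) (auto simp: measurable_cong_sets[OF ProbD(2)[OF \<mu>]])
  then have "Lp_le p \<mu> (\<lambda>x. dist x a) (r powr (1/p) + dist x0 a)"
    by (rule Lp_le_mono[OF p]) (auto, metis dist_commute dist_triangle)
  then show "\<exists>B. Lp_le p \<mu> (\<lambda>x. dist x a) B" ..
  show "\<mu> \<in> Prob" by fact
next
  fix B assume "\<mu> \<in> Prob" "Lp_le p \<mu> (\<lambda>x. dist x a) B"
  then show "\<mu> \<in> Pp p"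
    by (auto simp: Pp_def Lp_le_def dist_commute intro!: exI[of _ a] elim!: order_le_less_trans)
qed

lemma Pp_Prob: "\<mu> \<in> Pp p \<Longrightarrow> \<mu> \<in> Prob"
  by (simp add: Pp_def)

lemma return_in_Pp:
  assumes "1 \<le> p" shows "return borel (x::'a::metric_space) \<in> Pp p"
  using assms by (auto simp: in_Pp_iff[of p _ x] return_in_Prob Lp_le_return)

section \<open>The Wasserstein metric\<close>

lemma couplingsD:
  assumes "\<pi> \<in> couplings \<mu> \<nu>"
  shows "prob_space \<pi>" "sets \<pi> = sets (borel \<Otimes>\<^sub>M borel)" "distr \<pi> borel fst = \<mu>" "distr \<pi> borel snd = \<nu>"
    "fst \<in> measurable \<pi> borel" "snd \<in> measurable \<pi> borel"
  using assms by (auto simp: couplings_def cong: measurable_cong_sets)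

lemma pair_measure_in_couplings:
  assumes "\<mu> \<in> Prob" "\<nu> \<in> Prob"
  shows "\<mu> \<Otimes>\<^sub>M \<nu> \<in> couplings \<mu> \<nu>"
proof -
  interpret pair_prob_space \<mu> \<nu>
    using assms by (simp add: pair_prob_space_def pair_sigma_finite_def ProbD prob_space_imp_sigma_finite)
  note s = ProbD(2)[OF assms(1)] ProbD(2)[OF assms(2)]
  have "distr (\<mu> \<Otimes>\<^sub>M \<nu>) borel fst = distr (\<mu> \<Otimes>\<^sub>M \<nu>) \<mu> fst"
    by (intro distr_cong) (auto simp: s)
  also have "\<dots> = \<mu>" by (rule M2.distr_pair_fst)
  finally have 1: "distr (\<mu> \<Otimes>\<^sub>M \<nu>) borel fst = \<mu>" .
  have "distr (\<mu> \<Otimes>\<^sub>M \<nu>) borel snd = \<nu>"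
  proof (rule measure_eqI)
    fix A assume "A \<in> sets (distr (\<mu> \<Otimes>\<^sub>M \<nu>) borel snd)"
    then have A: "A \<in> sets \<nu>" by (simp add: s)
    have snd: "snd \<in> measurable (\<mu> \<Otimes>\<^sub>M \<nu>) borel"
      using measurable_snd[of \<mu> \<nu>] by (simp add: s cong: measurable_cong_sets)
    have "emeasure (distr (\<mu> \<Otimes>\<^sub>M \<nu>) borel snd) A = emeasure (\<mu> \<Otimes>\<^sub>M \<nu>) (space \<mu> \<times> A)"
      using A s sets.sets_into_space[OF A]
      by (subst emeasure_distr[OF snd]) (auto simp: space_pair_measure intro!: arg_cong2[where f=emeasure])
    also have "\<dots> = emeasure \<nu> A"
      using A by (simp add: M2.emeasure_pair_measure_Times M1.emeasure_space_1)
    finally show "emeasure (distr (\<mu> \<Otimes>\<^sub>M \<nu>) borel snd) A = emeasure \<nu> A" .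
  qed (simp add: s)
  moreover have "sets (\<mu> \<Otimes>\<^sub>M \<nu>) = sets (borel \<Otimes>\<^sub>M borel)"
    by (intro sets_pair_measure_cong s)
  ultimately show ?thesis using 1 by (simp add: couplings_def prob_space_axioms)
qed

lemma wass_le:
  assumes "1 \<le> p" "\<pi> \<in> couplings \<mu> \<nu>" "Lp_le p \<pi> (\<lambda>z. dist (fst z) (snd z)) w"
  shows "wass p \<mu> \<nu> \<le> w"
proof -
  let ?I = "INF \<pi>\<in>couplings \<mu> \<nu>. \<integral>\<^sup>+ z. ennreal (dist (fst z) (snd z) powr p) \<partial>\<pi>"
  have "?I \<le> (\<integral>\<^sup>+ z. ennreal (dist (fst z) (snd z) powr p) \<partial>\<pi>)"
    by (rule INF_lower[OF assms(2)])
  also have "\<dots> \<le> ennreal (w powr p)" using assms(3) by (simp add: Lp_le_def)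
  finally have "enn2real ?I \<le> w powr p" by (intro enn2real_leI) auto
  then have "wass p \<mu> \<nu> \<le> (w powr p) powr (1 / p)"
    unfolding wass_def using assms(1) by (intro powr_mono2) auto
  also have "\<dots> = w" using assms by (simp add: powr_powr Lp_le_def)
  finally show ?thesis .
qed

lemma wass_nonneg: "0 \<le> wass p \<mu> \<nu>"
  by (simp add: wass_def)

lemma couplings_swap:
  assumes \<pi>: "\<pi> \<in> couplings \<mu> \<nu>"
  shows "distr \<pi> (borel \<Otimes>\<^sub>M borel) (\<lambda>z. (snd z, fst z)) \<in> couplings \<nu> \<mu>"
proof -
  note c = couplingsD[OF \<pi>]
  have [measurable]: "fst \<in> measurable \<pi> borel" "snd \<in> measurable \<pi> borel" by fact+
  have m: "(\<lambda>z. (snd z, fst z)) \<in> measurable \<pi> (borel \<Otimes>\<^sub>M borel)" by measurable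
  show ?thesis
    using c(3,4) by (auto simp: couplings_def prob_space.prob_space_distr[OF c(1) m] distr_distr[OF _ m] o_def)
qed

text \<open>Separability in explicit form. It makes the distance measurable for the product of the
  Borel algebras, which is where couplings live, and it supplies countable partitions and
  bases.\<close>

locale dense_seq =
  fixes e :: "nat \<Rightarrow> 'a::metric_space"
  assumes dense: "0 < r \<Longrightarrow> \<exists>i. dist x (e i) < r"
begin

text \<open>\<open>dist a b < c\<close> holds iff some \<open>e i\<close> satisfies
  \<open>dist a (e i) + dist (e i) b < c\<close>, which is a countable union of measurable
  conditions on the separate coordinates.\<close>

lemma borel_measurable_dist_pair [measurable]:
  "(\<lambda>z. dist (fst z) (snd z :: 'a)) \<in> borel_measurable (borel \<Otimes>\<^sub>M borel)"
proof -
  have "{z \<in> space (borel \<Otimes>\<^sub>M borel). dist (fst z) (snd z :: 'a) < c} =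
     (\<Union>i. {z \<in> space (borel \<Otimes>\<^sub>M borel). dist (fst z) (e i) + dist (e i) (snd z) < c})" for c
  proof (safe, goal_cases)
    case (1 a b)
    then have "0 < (c - dist a b) / 2" by simp
    from dense[OF this, of a] obtain i where "dist a (e i) < (c - dist a b) / 2" by blast
    moreover have "dist (e i) b \<le> dist a (e i) + dist a b" by (metis dist_commute dist_triangle)
    ultimately have "dist a (e i) + dist (e i) b < c" by simp
    then show ?case using 1 by auto
  next
    case (2 a b i)
    then show ?case using dist_triangle[of a b "e i"] by simp
  qed
  moreover have "{z \<in> space (borel \<Otimes>\<^sub>M borel). dist (fst z) (e i) + dist (e i) (snd z) < c} \<in> sets (borel \<Otimes>\<^sub>M borel)" for i c
    by measurable
  ultimately show ?thesis
    by (subst borel_measurable_iff_less) (auto intro!: sets.countable_UN)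
qed

lemma wass_less_coupling:
  assumes p: "1 \<le> p" and \<mu>: "\<mu> \<in> Pp p" and \<nu>: "\<nu> \<in> Pp p" and w: "wass p \<mu> (\<nu>::'a measure) < w"
  obtains \<pi> where "\<pi> \<in> couplings \<mu> \<nu>" "Lp_le p \<pi> (\<lambda>z. dist (fst z) (snd z)) w"
proof -
  let ?I = "INF \<pi>\<in>couplings \<mu> \<nu>. \<integral>\<^sup>+ z. ennreal (dist (fst z) (snd z) powr p) \<partial>\<pi>"
  define a where "a = e 0"
  obtain B C where BC: "Lp_le p \<mu> (\<lambda>x. dist x a) B" "Lp_le p \<nu> (\<lambda>x. dist x a) C"
    using \<mu> \<nu> unfolding in_Pp_iff[OF p, of _ a] by blast
  have pi: "\<mu> \<Otimes>\<^sub>M \<nu> \<in> couplings \<mu> \<nu>"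
    by (rule pair_measure_in_couplings[OF Pp_Prob[OF \<mu>] Pp_Prob[OF \<nu>]])
  note c = couplingsD[OF pi]
  have [measurable]: "fst \<in> measurable (\<mu> \<Otimes>\<^sub>M \<nu>) borel" "snd \<in> measurable (\<mu> \<Otimes>\<^sub>M \<nu>) borel" by fact+
  have "Lp_le p (\<mu> \<Otimes>\<^sub>M \<nu>) (\<lambda>z. dist (fst z) a) B" "Lp_le p (\<mu> \<Otimes>\<^sub>M \<nu>) (\<lambda>z. dist (snd z) a) C"
    using BC Lp_le_distr[of fst "\<mu> \<Otimes>\<^sub>M \<nu>" borel "\<lambda>x. dist x a" p B] Lp_le_distr[of snd "\<mu> \<Otimes>\<^sub>M \<nu>" borel "\<lambda>x. dist x a" p C]
    by (simp_all add: c(3,4))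
  then have "Lp_le p (\<mu> \<Otimes>\<^sub>M \<nu>) (\<lambda>z. dist (fst z) a + dist (snd z) a) (B + C)"
    by (intro Lp_le_add[OF p]) auto
  then have "Lp_le p (\<mu> \<Otimes>\<^sub>M \<nu>) (\<lambda>z. dist (fst z) (snd z)) (B + C)"
    by (rule Lp_le_mono[OF p]) (auto intro: dist_triangle2)
  then have "?I \<le> ennreal ((B + C) powr p)"
    using pi by (auto simp: Lp_le_def intro: INF_lower2)
  \<comment> \<open>Finiteness is essential: \<open>enn2real\<close> sends infinity to 0, so an
    infinite infimum would show up as distance 0. The product coupling excludes this for measures in
    \<open>Pp p\<close>.\<close>
  then have fin: "?I < \<infinity>" by (auto elim: order_le_less_trans)
  have w0: "0 < w" using w wass_nonneg[of p \<mu> \<nu>] by simp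
  have "enn2real ?I < w powr p"
  proof (rule ccontr)
    assume "\<not> ?thesis"
    then have "(w powr p) powr (1/p) \<le> wass p \<mu> \<nu>" unfolding wass_def using p by (intro powr_mono2) auto
    then show False using w w0 p by (simp add: powr_powr)
  qed
  then have "?I < ennreal (w powr p)"
    using fin by (cases ?I) (auto simp: ennreal_less_iff)
  then obtain \<pi> where "\<pi> \<in> couplings \<mu> \<nu>" "(\<integral>\<^sup>+ z. ennreal (dist (fst z) (snd z) powr p) \<partial>\<pi>) < ennreal (w powr p)"
    unfolding INF_less_iff by blast
  then show ?thesis using w0 by (intro that) (auto simp: Lp_le_def)
qed

lemma wass_commute: "wass p \<mu> \<nu> = wass p \<nu> (\<mu>::'a measure)"
proof -
  let ?cost = "\<lambda>\<pi>. \<integral>\<^sup>+ z. ennreal (dist (fst z) (snd z :: 'a) powr p) \<partial>\<pi>"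
  have "(INF \<pi>\<in>couplings \<nu> \<mu>. ?cost \<pi>) \<le> (INF \<pi>\<in>couplings \<mu> \<nu>. ?cost \<pi>)" for \<mu> \<nu> :: "'a measure"
  proof (rule INF_greatest)
    fix \<pi> assume \<pi>: "\<pi> \<in> couplings \<mu> \<nu>"
    have [measurable]: "fst \<in> measurable \<pi> borel" "snd \<in> measurable \<pi> borel"
      by (rule couplingsD[OF \<pi>])+
    have "?cost (distr \<pi> (borel \<Otimes>\<^sub>M borel) (\<lambda>z. (snd z, fst z))) = ?cost \<pi>"
      by (subst nn_integral_distr) (auto simp: dist_commute)
    then show "(INF \<pi>\<in>couplings \<nu> \<mu>. ?cost \<pi>) \<le> ?cost \<pi>"
      using INF_lower[OF couplings_swap[OF \<pi>], of ?cost] by simp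
  qed
  from antisym[OF this this] show ?thesis unfolding wass_def by simp
qed

text \<open>On a nearly optimal coupling, \<open>h (fst z)\<close> is at most
  \<open>h (snd z) + L * dist (fst z) (snd z)\<close>; then Minkowski applies. This is how closeness
  in \<open>wass\<close> enters all later estimates.\<close>

lemma Lp_le_wass_Lipschitz:
  assumes p: "1 \<le> p" and \<mu>: "\<mu> \<in> Pp p" and \<nu>: "\<nu> \<in> Pp p"
    and h: "\<And>x y. \<bar>h x - h y\<bar> \<le> L * dist x (y::'a)" "\<And>x. 0 \<le> h x" and L: "0 \<le> L"
    and B: "Lp_le p \<nu> h B" and w: "wass p \<mu> \<nu> < w"
  shows "Lp_le p \<mu> h (B + L * w)"
proof -
  have [measurable]: "h \<in> borel_measurable borel" by (rule borel_measurable_Lipschitz[OF h(1)])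
  obtain \<pi> where \<pi>: "\<pi> \<in> couplings \<mu> \<nu>" "Lp_le p \<pi> (\<lambda>z. dist (fst z) (snd z)) w"
    using wass_less_coupling[OF p \<mu> \<nu> w] by metis
  note c = couplingsD[OF \<pi>(1)]
  have [measurable]: "fst \<in> measurable \<pi> borel" "snd \<in> measurable \<pi> borel" by fact+
  have [measurable]: "(\<lambda>z. dist (fst z) (snd z)) \<in> borel_measurable \<pi>"
    using borel_measurable_dist_pair by (simp add: c(2) cong: measurable_cong_sets)
  have "Lp_le p \<pi> (\<lambda>z. h (snd z)) B"
    using B by (simp flip: c(4) add: Lp_le_distr)
  then have "Lp_le p \<pi> (\<lambda>z. h (snd z) + L * dist (fst z) (snd z)) (B + L * w)"
    using L by (intro Lp_le_add[OF p] Lp_le_scale[OF p] \<pi>(2)) (auto simp: h)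
  then have "Lp_le p \<pi> (\<lambda>z. h (fst z)) (B + L * w)"
    by (rule Lp_le_mono[OF p]) (use h in \<open>auto simp: abs_le_iff algebra_simps\<close>)
  then have "Lp_le p (distr \<pi> borel fst) h (B + L * w)" by (simp add: Lp_le_distr)
  then show ?thesis by (simp add: c(3))
qed

lemma Lp_le_wass:
  assumes p: "1 \<le> p" and \<mu>: "\<mu> \<in> Pp p" and \<nu>: "\<nu> \<in> Pp p"
    and h: "\<And>x y. \<bar>h x - h y\<bar> \<le> dist x (y::'a)" "\<And>x. 0 \<le> h x"
    and B: "Lp_le p \<nu> h B" and w: "wass p \<mu> \<nu> \<le> w"
  shows "Lp_le p \<mu> h (B + w)"
proof (rule Lp_le_limit[OF p])
  show "0 \<le> B + w" using Lp_le_nonneg[OF B] w wass_nonneg[of p \<mu> \<nu>] by linarith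
  fix \<delta> :: real assume "0 < \<delta>"
  then show "Lp_le p \<mu> h (B + w + \<delta>)"
    using Lp_le_wass_Lipschitz[OF p \<mu> \<nu> _ h(2) zero_le_one B, of "w + \<delta>"] h(1) w by (simp add: add.assoc)
qed

section \<open>Approximate gluing of couplings and the metric axioms\<close>

definition cell :: "real \<Rightarrow> 'a \<Rightarrow> nat" where
  "cell r x = (LEAST i. dist x (e i) < r)"

lemma dist_cell: "0 < r \<Longrightarrow> dist x (e (cell r x)) < r"
  unfolding cell_def by (rule LeastI_ex) (rule dense)

lemma measurable_cell [measurable]: "cell r \<in> measurable borel (count_space UNIV)"
  unfolding cell_def by measurable

text \<open>Without disintegration, two couplings are glued only approximately: the middle points are
  required to lie in the same cell of a countable partition and are conditionally independent
  given that cell.\<close>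

lemma glue_couplings:
  assumes p: "1 \<le> p" and \<delta>: "0 < \<delta>"
    and \<pi>: "\<pi> \<in> couplings \<mu> \<nu>" "Lp_le p \<pi> (\<lambda>z. dist (fst z) (snd z :: 'a)) v"
    and \<rho>: "\<rho> \<in> couplings \<nu> \<kappa>" "Lp_le p \<rho> (\<lambda>z. dist (fst z) (snd z)) w"
  obtains \<gamma> where "\<gamma> \<in> couplings \<mu> \<kappa>" "Lp_le p \<gamma> (\<lambda>z. dist (fst z) (snd z)) (v + \<delta> + w)"
proof -
  note c = couplingsD[OF \<pi>(1)] and d = couplingsD[OF \<rho>(1)]
  interpret P: prob_space \<pi> by fact
  interpret R: prob_space \<rho> by fact
  interpret PR: pair_prob_space \<pi> \<rho> ..
  have [measurable]: "fst \<in> measurable \<pi> borel" "snd \<in> measurable \<pi> borel"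
    "fst \<in> measurable \<rho> borel" "snd \<in> measurable \<rho> borel" by fact+
  have [measurable]: "(\<lambda>z. dist (fst z) (snd z)) \<in> borel_measurable \<pi>" "(\<lambda>z. dist (fst z) (snd z)) \<in> borel_measurable \<rho>"
    using borel_measurable_dist_pair by (simp_all add: c(2) d(2) cong: measurable_cong_sets)
  let ?c = "cell (\<delta> / 2)"
  define m where "m i = emeasure \<nu> {y. ?c y = i}" for i
  have sets_c: "{y. ?c y = i} \<in> sets borel" for i
    using measurable_sets[OF measurable_cell, of "{i}" "\<delta>/2"] by (simp add: vimage_def)
  have m1: "m i = emeasure \<pi> {z \<in> space \<pi>. ?c (snd z) = i}" for i
    using sets_c unfolding m_def c(4)[symmetric]
    by (subst emeasure_distr) (auto intro!: arg_cong2[where f=emeasure])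
  have m2: "m i = emeasure \<rho> {z \<in> space \<rho>. ?c (fst z) = i}" for i
    using sets_c unfolding m_def d(3)[symmetric]
    by (subst emeasure_distr) (auto intro!: arg_cong2[where f=emeasure])
  have mfin: "m i \<noteq> \<infinity>" for i unfolding m1 by simp
  \<comment> \<open>\<open>D\<close> is the density of the glued law with respect to
    \<open>\<pi> \<Otimes>\<^sub>M \<rho>\<close>. Integrating out one variable gives
    \<open>inverse (m i) * m i\<close>, which is 1 on cells of positive mass, so the marginals
    remain \<open>\<pi>\<close> and \<open>\<rho>\<close>.\<close>
  define D :: "('a \<times> 'a) \<times> ('a \<times> 'a) \<Rightarrow> ennreal"
    where "D = (\<lambda>(u, v). if ?c (snd u) = ?c (fst v) then inverse (m (?c (snd u))) else 0)"
  have [measurable]: "(\<lambda>z. ?c (snd (fst z))) \<in> measurable (\<pi> \<Otimes>\<^sub>M \<rho>) (count_space UNIV)"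
    "(\<lambda>z. ?c (fst (snd z))) \<in> measurable (\<pi> \<Otimes>\<^sub>M \<rho>) (count_space UNIV)"
    by (intro measurable_compose[OF _ measurable_cell] measurable_compose[OF measurable_fst]
      measurable_compose[OF measurable_snd]; fact)+
  have if_eq: "(\<lambda>z. if a z = b z then g (a z) else (0::ennreal)) \<in> borel_measurable M"
    if "a \<in> measurable M (count_space UNIV)" "b \<in> measurable M (count_space UNIV)"
    for M :: "(('a \<times> 'a) \<times> ('a \<times> 'a)) measure" and a b :: "_ \<Rightarrow> nat" and g
  proof -
    have "(\<lambda>z. (a z, b z)) \<in> measurable M (count_space UNIV \<Otimes>\<^sub>M count_space UNIV)"
      using that by measurable
    then have "(\<lambda>z. (a z, b z)) \<in> measurable M (count_space UNIV)"
      by (simp add: pair_measure_countable)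
    from measurable_compose[OF this, of "\<lambda>(i, j). if i = j then g i else 0" borel] show ?thesis by simp
  qed
  have "(\<lambda>z. if ?c (snd (fst z)) = ?c (fst (snd z)) then inverse (m (?c (snd (fst z)))) else 0)
      \<in> borel_measurable (\<pi> \<Otimes>\<^sub>M \<rho>)"
    by (rule if_eq) fact+
  then have D [measurable]: "D \<in> borel_measurable (\<pi> \<Otimes>\<^sub>M \<rho>)" by (simp add: D_def case_prod_beta')
  have cell_sets: "{z \<in> space M. ?c (s z) = i} \<in> sets M" if "s \<in> measurable M borel" for M :: "('a \<times> 'a) measure" and s i
    using measurable_sets[OF that sets_c[of i]] by (simp add: vimage_def Int_def conj_commute)
  have cell_int: "(\<integral>\<^sup>+ v. (if i = ?c (s v) then w else 0) \<partial>M) = w * emeasure M {z \<in> space M. ?c (s z) = i}"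
    if "s \<in> measurable M borel" for M :: "('a \<times> 'a) measure" and s i w
    by (subst nn_integral_cmult_indicator[OF cell_sets[OF that], symmetric])
       (auto intro!: nn_integral_cong simp: indicator_def)
  have int1: "(\<integral>\<^sup>+ v. D (u, v) \<partial>\<rho>) = inverse (m (?c (snd u))) * m (?c (snd u))" for u
    unfolding D_def m2 using cell_int[of fst \<rho>] by simp
  have "(\<integral>\<^sup>+ u. D (u, v) \<partial>\<pi>) = (\<integral>\<^sup>+ u. (if ?c (fst v) = ?c (snd u) then inverse (m (?c (fst v))) else 0) \<partial>\<pi>)" for v
    by (intro nn_integral_cong) (auto simp: D_def)
  then have int2: "(\<integral>\<^sup>+ u. D (u, v) \<partial>\<pi>) = inverse (m (?c (fst v))) * m (?c (fst v))" for v
    using cell_int[of snd \<pi>] by (simp add: m1)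
  \<comment> \<open>On cells of mass 0 the inverse is infinite. There are countably many of them, so
    together they are null.\<close>
  have cell_AE: "AE u in M. m (?c (s u)) \<noteq> 0"
    if s: "s \<in> measurable M borel" and m: "\<And>i. m i = emeasure M {z \<in> space M. ?c (s z) = i}" for M :: "('a \<times> 'a) measure" and s
  proof -
    have "AE u in M. m i = 0 \<longrightarrow> ?c (s u) \<noteq> i" for i
    proof (cases "m i = 0")
      case True
      then have "{z \<in> space M. ?c (s z) = i} \<in> null_sets M" using cell_sets[OF s] by (intro null_setsI) (auto simp: m)
      then show ?thesis by (rule AE_I') auto
    qed simp
    then have "AE u in M. \<forall>i. m i = 0 \<longrightarrow> ?c (s u) \<noteq> i" unfolding AE_all_countable by blast
    then show ?thesis by eventually_elim auto
  qed
  note AE1 = cell_AE[OF c(6) m1] and AE2 = cell_AE[OF d(5) m2]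
  have inv: "inverse (m i) * m i = 1" if "m i \<noteq> 0" for i
    using that mfin[of i] ennreal_divide_self[of "m i"]
    by (simp add: divide_ennreal_def mult.commute less_top)
  define G where "G = density (\<pi> \<Otimes>\<^sub>M \<rho>) D"
  have F1: "(\<integral>\<^sup>+ z. F (fst z) \<partial>G) = (\<integral>\<^sup>+ u. F u \<partial>\<pi>)" if [measurable]: "F \<in> borel_measurable \<pi>" for F :: "_ \<Rightarrow> ennreal"
  proof -
    have "(\<integral>\<^sup>+ z. F (fst z) \<partial>G) = (\<integral>\<^sup>+ z. D z * F (fst z) \<partial>(\<pi> \<Otimes>\<^sub>M \<rho>))"
      unfolding G_def by (intro nn_integral_density) measurable
    also have "\<dots> = (\<integral>\<^sup>+ u. \<integral>\<^sup>+ v. D (u, v) * F u \<partial>\<rho> \<partial>\<pi>)"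
      by (subst R.nn_integral_fst[symmetric]) auto
    also have "\<dots> = (\<integral>\<^sup>+ u. inverse (m (?c (snd u))) * m (?c (snd u)) * F u \<partial>\<pi>)"
      by (intro nn_integral_cong, subst nn_integral_multc) (auto simp: int1)
    also have "\<dots> = (\<integral>\<^sup>+ u. F u \<partial>\<pi>)"
      by (intro nn_integral_cong_AE eventually_mono[OF AE1]) (auto simp: inv)
    finally show ?thesis .
  qed
  have F2: "(\<integral>\<^sup>+ z. F (snd z) \<partial>G) = (\<integral>\<^sup>+ u. F u \<partial>\<rho>)" if [measurable]: "F \<in> borel_measurable \<rho>" for F :: "_ \<Rightarrow> ennreal"
  proof -
    have "(\<integral>\<^sup>+ z. F (snd z) \<partial>G) = (\<integral>\<^sup>+ z. D z * F (snd z) \<partial>(\<pi> \<Otimes>\<^sub>M \<rho>))"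
      unfolding G_def by (intro nn_integral_density) measurable
    also have "\<dots> = (\<integral>\<^sup>+ v. \<integral>\<^sup>+ u. D (u, v) * F v \<partial>\<pi> \<partial>\<rho>)"
      by (subst PR.nn_integral_snd[symmetric]) (auto simp: case_prod_beta)
    also have "\<dots> = (\<integral>\<^sup>+ u. inverse (m (?c (fst u))) * m (?c (fst u)) * F u \<partial>\<rho>)"
      by (intro nn_integral_cong, subst nn_integral_multc) (auto simp: int2)
    also have "\<dots> = (\<integral>\<^sup>+ u. F u \<partial>\<rho>)"
      by (intro nn_integral_cong_AE eventually_mono[OF AE2]) (auto simp: inv)
    finally show ?thesis .
  qed
  have [measurable]: "fst \<in> measurable G \<pi>" "snd \<in> measurable G \<rho>" by (simp_all add: G_def)
  have marginal: "distr G M s = M"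
    if [measurable]: "s \<in> measurable G M" and F: "\<And>F. F \<in> borel_measurable M \<Longrightarrow> (\<integral>\<^sup>+ z. F (s z) \<partial>G) = (\<integral>\<^sup>+ u. F u \<partial>M)"
    for M :: "('a \<times> 'a) measure" and s
  proof (rule measure_eqI)
    fix A assume "A \<in> sets (distr G M s)"
    then have A [measurable]: "A \<in> sets M" by simp
    have "emeasure (distr G M s) A = (\<integral>\<^sup>+ z. indicator A z \<partial>distr G M s)" by simp
    also have "\<dots> = (\<integral>\<^sup>+ z. indicator A (s z) \<partial>G)" by (intro nn_integral_distr) auto
    also have "\<dots> = emeasure M A" by (subst F) auto
    finally show "emeasure (distr G M s) A = emeasure M A" .
  qed simp
  have dG1: "distr G \<pi> fst = \<pi>" and dG2: "distr G \<rho> snd = \<rho>"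
    by (rule marginal; simp add: F1 F2)+
  have "emeasure G (space G) = 1"
    using F1[of "\<lambda>_. 1"] by (simp add: P.emeasure_space_1)
  then interpret G: prob_space G by (rule prob_spaceI)
  have L1: "Lp_le p G (\<lambda>z. dist (fst (fst z)) (snd (fst z))) v"
    using \<pi>(2) F1[of "\<lambda>z. ennreal (dist (fst z) (snd z) powr p)"] by (simp add: Lp_le_def)
  have L2: "Lp_le p G (\<lambda>z. dist (fst (snd z)) (snd (snd z))) w"
    using \<rho>(2) F2[of "\<lambda>z. ennreal (dist (fst z) (snd z) powr p)"] by (simp add: Lp_le_def)
  have "Lp_le p G (\<lambda>z. dist (fst (fst z)) (snd (fst z)) + \<delta> + dist (fst (snd z)) (snd (snd z))) (v + \<delta> + w)"
    by (intro Lp_le_add[OF p] L1 L2 Lp_le_const G.prob_space_axioms) (use \<delta> in auto)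
  \<comment> \<open>The density vanishes off matching cells. Two points in one cell of radius
    \<open>\<delta> / 2\<close> are at distance at most \<open>\<delta>\<close>, which is the price
    of the approximation.\<close>
  moreover have "AE z in G. ?c (snd (fst z)) = ?c (fst (snd z))"
    unfolding G_def by (subst AE_density[OF D]) (auto simp: D_def split: if_splits)
  then have "AE z in G. 0 \<le> dist (fst (fst z)) (snd (snd z)) \<and> dist (fst (fst z)) (snd (snd z))
      \<le> dist (fst (fst z)) (snd (fst z)) + \<delta> + dist (fst (snd z)) (snd (snd z))"
  proof eventually_elim
    case (elim z)
    have "dist (snd (fst z)) (fst (snd z)) \<le> \<delta>"
      using dist_cell[of "\<delta>/2" "snd (fst z)"] dist_cell[of "\<delta>/2" "fst (snd z)"] \<delta> elim
        dist_triangle2[of "snd (fst z)" "fst (snd z)" "e (?c (fst (snd z)))"] by simp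
    then show ?case
      using dist_triangle[of "fst (fst z)" "snd (snd z)" "snd (fst z)"]
        dist_triangle[of "snd (fst z)" "snd (snd z)" "fst (snd z)"] by simp
  qed
  ultimately have L: "Lp_le p G (\<lambda>z. dist (fst (fst z)) (snd (snd z))) (v + \<delta> + w)"
    by (rule Lp_le_mono_AE[OF p]) simp
  have mm [measurable]: "(\<lambda>z. (fst (fst z), snd (snd z))) \<in> measurable G (borel \<Otimes>\<^sub>M borel)" by measurable
  show ?thesis
  proof (rule that)
    have "distr G borel (\<lambda>z. fst (fst z)) = distr (distr G \<pi> fst) borel fst"
      by (subst distr_distr) (auto simp: o_def)
    moreover have "distr G borel (\<lambda>z. snd (snd z)) = distr (distr G \<rho> snd) borel snd"
      by (subst distr_distr) (auto simp: o_def)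
    ultimately show "distr G (borel \<Otimes>\<^sub>M borel) (\<lambda>z. (fst (fst z), snd (snd z))) \<in> couplings \<mu> \<kappa>"
      by (auto simp: couplings_def G.prob_space_distr[OF mm] distr_distr[OF _ mm] o_def dG1 dG2 c d)
    show "Lp_le p (distr G (borel \<Otimes>\<^sub>M borel) (\<lambda>z. (fst (fst z), snd (snd z)))) (\<lambda>z. dist (fst z) (snd z)) (v + \<delta> + w)"
      using L by (simp add: Lp_le_distr)
  qed
qed

lemma wass_triangle:
  assumes p: "1 \<le> p" and P: "\<mu> \<in> Pp p" "\<nu> \<in> Pp p" "\<kappa> \<in> Pp p"
  shows "wass p \<mu> \<kappa> \<le> wass p \<mu> \<nu> + wass p \<nu> (\<kappa>::'a measure)"
proof (rule field_le_epsilon)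
  fix \<epsilon> :: real assume \<epsilon>: "0 < \<epsilon>"
  obtain \<pi> where \<pi>: "\<pi> \<in> couplings \<mu> \<nu>" "Lp_le p \<pi> (\<lambda>z. dist (fst z) (snd z)) (wass p \<mu> \<nu> + \<epsilon>/3)"
    using wass_less_coupling[OF p P(1,2), of "wass p \<mu> \<nu> + \<epsilon>/3"] \<epsilon> by auto
  obtain \<rho> where \<rho>: "\<rho> \<in> couplings \<nu> \<kappa>" "Lp_le p \<rho> (\<lambda>z. dist (fst z) (snd z)) (wass p \<nu> \<kappa> + \<epsilon>/3)"
    using wass_less_coupling[OF p P(2,3), of "wass p \<nu> \<kappa> + \<epsilon>/3"] \<epsilon> by auto
  obtain \<gamma> where \<gamma>: "\<gamma> \<in> couplings \<mu> \<kappa>"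
    "Lp_le p \<gamma> (\<lambda>z. dist (fst z) (snd z)) (wass p \<mu> \<nu> + \<epsilon>/3 + \<epsilon>/3 + (wass p \<nu> \<kappa> + \<epsilon>/3))"
    using glue_couplings[OF p _ \<pi> \<rho>, of "\<epsilon>/3"] \<epsilon> by auto
  show "wass p \<mu> \<kappa> \<le> wass p \<mu> \<nu> + wass p \<nu> \<kappa> + \<epsilon>"
    using wass_le[OF p \<gamma>] by simp
qed

lemma wass_self:
  assumes p: "1 \<le> p" and \<mu>: "\<mu> \<in> Prob"
  shows "wass p \<mu> (\<mu>::'a measure) = 0"
proof -
  have s: "sets \<mu> = sets borel" by (rule ProbD[OF \<mu>])
  have m: "(\<lambda>x. (x, x)) \<in> measurable \<mu> (borel \<Otimes>\<^sub>M borel)"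
    by (simp add: s cong: measurable_cong_sets)
  have "distr \<mu> borel (\<lambda>x. x) = \<mu>" by (rule distr_id2) (simp add: s)
  then have "distr \<mu> (borel \<Otimes>\<^sub>M borel) (\<lambda>x. (x, x)) \<in> couplings \<mu> \<mu>"
    by (auto simp: couplings_def prob_space.prob_space_distr[OF ProbD(1)[OF \<mu>] m] distr_distr[OF _ m] o_def)
  moreover have "Lp_le p (distr \<mu> (borel \<Otimes>\<^sub>M borel) (\<lambda>x. (x, x))) (\<lambda>z. dist (fst z) (snd z)) 0"
    using p by (subst Lp_le_distr[OF m]) (auto simp: Lp_le_def)
  ultimately have "wass p \<mu> \<mu> \<le> 0" by (rule wass_le[OF p])
  then show ?thesis using wass_nonneg[of p \<mu> \<mu>] by simp
qed

end

text \<open>Lipschitz functions increasing to the indicator of an open set \<open>A\<close>. For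
  \<open>A = UNIV\<close> the function is identically 0, since \<open>infdist x {} = 0\<close>; this
  is why \<open>UNIV\<close> is treated separately below.\<close>

definition bump :: "'a::metric_space set \<Rightarrow> nat \<Rightarrow> 'a \<Rightarrow> real" where
  "bump A n x = min 1 (real n * infdist x (- A))"

lemma bump_bounds: "0 \<le> bump A n x" "bump A n x \<le> 1"
  by (auto simp: bump_def infdist_nonneg)

lemma bump_Lipschitz: "\<bar>bump A n x - bump A n y\<bar> \<le> real n * dist x y"
proof -
  have "\<bar>bump A n x - bump A n y\<bar> \<le> \<bar>real n * infdist x (- A) - real n * infdist y (- A)\<bar>"
    by (auto simp: bump_def min_def)
  also have "\<dots> = real n * \<bar>infdist x (- A) - infdist y (- A)\<bar>"
    by (simp flip: right_diff_distrib add: abs_mult)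
  also have "\<dots> \<le> real n * dist x y"
    by (intro mult_left_mono infdist_triangle_abs) auto
  finally show ?thesis .
qed

lemma continuous_on_bump: "continuous_on UNIV (bump A n)"
  unfolding bump_def by (intro continuous_intros)

lemma bump_tendsto:
  assumes "open A" "A \<noteq> UNIV"
  shows "(\<lambda>n. bump A n x) \<longlonglongrightarrow> indicator A x"
proof (cases "x \<in> A")
  case True
  have "0 < infdist x (- A)"
    using True assms by (intro infdist_pos_not_in_closed) auto
  then obtain m :: nat where m: "1 < real m * infdist x (- A)"
    using reals_Archimedean3 by blast
  have "bump A n x = 1" if "m \<le> n" for n
  proof -
    have "real m * infdist x (- A) \<le> real n * infdist x (- A)"
      using that by (intro mult_right_mono infdist_nonneg) auto
    then show ?thesis using m by (simp add: bump_def)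
  qed
  then have "eventually (\<lambda>n. bump A n x = 1) sequentially"
    by (auto simp: eventually_sequentially)
  then show ?thesis using True by (simp add: tendsto_eventually)
next
  case False
  then show ?thesis by (simp add: bump_def)
qed

text \<open>The case \<open>\<phi> t = t\<^sup>p\<close> is needed because \<open>wass p\<close> controls \<open>L\<^sup>p\<close> norms, not integrals.\<close>

lemma measure_eqI_bump:
  fixes \<mu> \<nu> :: "'a::metric_space measure" and \<phi> :: "real \<Rightarrow> real"
  assumes \<mu>: "\<mu> \<in> Prob" and \<nu>: "\<nu> \<in> Prob"
    and E: "Int_stable E" "sets borel = sigma_sets UNIV E" "\<And>A. A \<in> E \<Longrightarrow> open A"
    and \<phi>: "continuous_on {0..1} \<phi>" "\<phi> 0 = 0" "\<phi> 1 = 1" "\<And>t. 0 \<le> t \<Longrightarrow> t \<le> 1 \<Longrightarrow> 0 \<le> \<phi> t \<and> \<phi> t \<le> 1"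
    and eq: "\<And>A n. A \<in> E \<Longrightarrow> A \<noteq> UNIV \<Longrightarrow> (\<integral>x. \<phi> (bump A n x) \<partial>\<mu>) = (\<integral>x. \<phi> (bump A n x) \<partial>\<nu>)"
  shows "\<mu> = \<nu>"
proof -
  have cont: "continuous_on UNIV (\<lambda>x. \<phi> (bump A n x))" for A :: "'a set" and n
    by (intro continuous_on_compose2[OF \<phi>(1)] continuous_on_bump) (auto simp: bump_bounds)
  have lim: "(\<lambda>n. \<integral>x. \<phi> (bump A n x) \<partial>\<kappa>) \<longlonglongrightarrow> measure \<kappa> A"
    if \<kappa>: "\<kappa> \<in> Prob" and A: "open A" "A \<noteq> UNIV" for A and \<kappa> :: "'a measure"
  proof -
    interpret prob_space \<kappa> by (rule ProbD[OF \<kappa>])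
    note s = ProbD(2)[OF \<kappa>]
    have m [measurable]: "(\<lambda>x. \<phi> (bump A n x)) \<in> borel_measurable \<kappa>" for n
      using borel_measurable_continuous_onI[OF cont] by (simp add: s cong: measurable_cong_sets)
    have [measurable]: "A \<in> sets \<kappa>" using A by (simp add: s)
    have "(\<lambda>n. \<integral>x. \<phi> (bump A n x) \<partial>\<kappa>) \<longlonglongrightarrow> (\<integral>x. indicator A x \<partial>\<kappa>)"
    proof (rule integral_dominated_convergence[where w="\<lambda>_. 1"])
      have "(\<lambda>n. \<phi> (bump A n x)) \<longlonglongrightarrow> \<phi> (indicator A x)" for x
        by (intro continuous_on_tendsto_compose[OF \<phi>(1) bump_tendsto[OF A]])
           (auto simp: bump_bounds indicator_def)
      moreover have "\<phi> (indicator A x) = indicator A x" for x using \<phi> by (auto simp: indicator_def)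
      ultimately show "AE x in \<kappa>. (\<lambda>n. \<phi> (bump A n x)) \<longlonglongrightarrow> indicator A x" by simp
    qed (use \<phi>(4) in \<open>auto simp: bump_bounds\<close>)
    then show ?thesis using A by simp
  qed
  interpret M: prob_space \<mu> by (rule ProbD[OF \<mu>])
  interpret N: prob_space \<nu> by (rule ProbD[OF \<nu>])
  have "measure \<mu> A = measure \<nu> A" if "A \<in> E" for A
  proof (cases "A = UNIV")
    case True
    then show ?thesis using M.prob_space N.prob_space by (simp add: ProbD \<mu> \<nu>)
  next
    case False
    show ?thesis
      using lim[OF \<mu> E(3)[OF that] False] lim[OF \<nu> E(3)[OF that] False] eq[OF that False]
      by (simp add: LIMSEQ_unique)
  qed
  then have *: "emeasure \<mu> A = emeasure \<nu> A" if "A \<in> E" for A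
    using that by (simp add: M.emeasure_eq_measure N.emeasure_eq_measure)
  \<comment> \<open>Adding \<open>UNIV\<close> provides the exhausting sequence for the uniqueness
    theorem; on \<open>UNIV\<close> both measures equal 1.\<close>
  define E' where "E' = insert UNIV E"
  have s: "sigma_sets UNIV E' = sigma_sets UNIV E"
    unfolding E'_def by (intro sigma_sets_eqI) (auto intro: sigma_sets_top sigma_sets.Basic)
  show ?thesis
  proof (rule measure_eqI_generator_eq[where E=E' and \<Omega>=UNIV and A="\<lambda>_. UNIV"])
    show "Int_stable E'" using E(1) by (auto simp: Int_stable_def E'_def)
    show "emeasure \<mu> X = emeasure \<nu> X" if "X \<in> E'" for X
      using that * M.emeasure_space_1 N.emeasure_space_1 by (auto simp: E'_def ProbD \<mu> \<nu>)
  qed (simp_all add: s ProbD(2)[OF \<mu>] ProbD(2)[OF \<nu>] E(2), simp add: E'_def)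
qed

text \<open>At distance 0 the norm of a bump under one measure exceeds that under the other by at
  most \<open>real n * w\<close> for every positive \<open>w\<close>, hence the norms agree. The
  bumps of all open sets determine a measure.\<close>

lemma (in dense_seq) wass_eq_0_imp_eq:
  assumes p: "1 \<le> p" and \<mu>: "\<mu> \<in> Pp p" and \<nu>: "\<nu> \<in> Pp p" and 0: "wass p \<mu> (\<nu>::'a measure) = 0"
  shows "\<mu> = \<nu>"
proof (rule measure_eqI_bump[where E="Collect open" and \<phi>="\<lambda>t. t powr p"])
  show P: "\<mu> \<in> Prob" "\<nu> \<in> Prob" using \<mu> \<nu> by (auto simp: Pp_Prob)
  show "sets borel = sigma_sets UNIV (Collect (open :: 'a set \<Rightarrow> bool))"
    by (simp add: borel_def)
  show "continuous_on {0..1} (\<lambda>t. t powr p)"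
    using p by (intro continuous_on_powr' continuous_intros) auto
  show "0 \<le> t powr p \<and> t powr p \<le> 1" if "0 \<le> t" "t \<le> 1" for t
    using that p powr_le1[of p t] by simp
  fix A :: "'a set" and n assume "A \<in> Collect open" "A \<noteq> UNIV"
  have [measurable]: "bump A n \<in> borel_measurable borel"
    by (intro borel_measurable_continuous_onI continuous_on_bump)
  have "(\<integral>\<^sup>+ x. ennreal (bump A n x powr p) \<partial>\<kappa>) = ennreal (\<integral> x. bump A n x powr p \<partial>\<kappa>)"
    if \<kappa>: "\<kappa> \<in> Prob" for \<kappa> :: "'a measure"
  proof (rule nn_integral_eq_integral)
    interpret prob_space \<kappa> by (rule ProbD[OF \<kappa>])
    show "integrable \<kappa> (\<lambda>x. bump A n x powr p)"
      by (rule integrable_const_bound[where B=1])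
         (use p in \<open>auto simp: bump_bounds measurable_cong_sets[OF ProbD(2)[OF \<kappa>]] intro!: powr_le1\<close>)
  qed simp
  note 1 = this
  have le: "(\<integral>x. bump A n x powr p \<partial>\<mu>) \<le> (\<integral>x. bump A n x powr p \<partial>\<nu>)"
    if \<mu>: "\<mu> \<in> Pp p" and \<nu>: "\<nu> \<in> Pp p" and 0: "wass p \<mu> (\<nu>::'a measure) = 0" for \<mu> \<nu>
  proof -
    define I where "I = (\<integral>x. bump A n x powr p \<partial>\<nu>)"
    have "0 \<le> I" unfolding I_def by simp
    then have "Lp_le p \<nu> (bump A n) (I powr (1/p))"
      using 1[OF Pp_Prob[OF \<nu>]] p by (simp add: Lp_le_def I_def powr_powr)
    then have *: "Lp_le p \<mu> (bump A n) (I powr (1/p) + real n * w)" if "0 < w" for w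
      using that 0 by (intro Lp_le_wass_Lipschitz[OF p \<mu> \<nu> bump_Lipschitz bump_bounds(1)]) auto
    have "Lp_le p \<mu> (bump A n) (I powr (1/p))"
    proof (rule Lp_le_limit[OF p])
      fix \<delta> :: real assume "0 < \<delta>"
      then show "Lp_le p \<mu> (bump A n) (I powr (1/p) + \<delta>)"
        by (intro Lp_le_mono[OF p *[of "\<delta> / (real n + 1)"]]) (auto simp: bump_bounds divide_simps algebra_simps)
    qed simp
    then show ?thesis
      using 1[OF Pp_Prob[OF \<mu>]] p \<open>0 \<le> I\<close> by (simp add: Lp_le_def I_def powr_powr)
  qed
  show "(\<integral>x. bump A n x powr p \<partial>\<mu>) = (\<integral>x. bump A n x powr p \<partial>\<nu>)"
    using le[OF \<mu> \<nu> 0] le[OF \<nu> \<mu>] 0 wass_commute[of p \<mu> \<nu>] by simp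
qed (auto simp: Int_stable_def open_Int)

lemma (in dense_seq) Metric_space_wass:
  assumes "1 \<le> p"
  shows "Metric_space (Pp p :: 'a measure set) (wass p)"
proof
  show "wass p x y = 0 \<longleftrightarrow> x = y" if "x \<in> Pp p" "y \<in> Pp p" for x y :: "'a measure"
    using that assms by (metis wass_eq_0_imp_eq wass_self Pp_Prob)
qed (rule wass_nonneg wass_commute wass_triangle[OF assms]; assumption)+

section \<open>The narrow topology\<close>

abbreviation bounded_continuous :: "('a::metric_space \<Rightarrow> real) \<Rightarrow> bool" where
  "bounded_continuous g \<equiv> continuous_on UNIV g \<and> bounded (range g)"

lemma bounded_continuousD:
  assumes "bounded_continuous g"
  obtains H where "0 < H" "\<And>x. \<bar>g x\<bar> \<le> H" "g \<in> borel_measurable borel"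
proof -
  obtain H where H: "\<forall>x. \<bar>g x\<bar> \<le> H" using assms by (auto simp: bounded_iff)
  have "\<bar>g x\<bar> \<le> \<bar>H\<bar> + 1" for x using H[rule_format, of x] by linarith
  then show ?thesis using assms
    by (intro that[of "\<bar>H\<bar> + 1"]) (auto intro: borel_measurable_continuous_onI)
qed

lemma measurable_Prob_cong: "\<mu> \<in> Prob \<Longrightarrow> measurable \<mu> N = measurable borel N"
  by (rule measurable_cong_sets) (auto simp: ProbD)

lemma integrable_bounded_continuous:
  assumes "bounded_continuous g" "\<mu> \<in> Prob"
  shows "integrable \<mu> g"
proof -
  interpret prob_space \<mu> by (rule ProbD[OF assms(2)])
  obtain H where H: "\<And>x. \<bar>g x\<bar> \<le> H" "g \<in> borel_measurable borel"
    using bounded_continuousD[OF assms(1)] by metis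
  show ?thesis
    using H by (intro integrable_const_bound[where B=H]) (auto simp: measurable_Prob_cong[OF assms(2)])
qed

lemma bounded_continuous_bump: "bounded_continuous (bump A n)"
  using bump_bounds[of A n]
  by (auto simp: continuous_on_bump bounded_iff intro!: exI[of _ 1])

lemma topspace_narrow: "topspace narrow_top = Prob"
proof -
  have "Prob \<subseteq> \<Union> {{\<mu>\<in>Prob. (\<integral>x. g x \<partial>\<mu>) \<in> U} | (g :: 'a \<Rightarrow> real) U. bounded_continuous g \<and> open U}"
    by (rule order_trans[OF _ Sup_upper[of "{\<mu>\<in>Prob. (\<integral>x. 0 \<partial>\<mu>) \<in> (UNIV::real set)}"]])
       (auto intro!: exI[of _ "\<lambda>_. 0"] exI[of _ UNIV])
  then show ?thesis
    unfolding narrow_top_def topology_generated_by_topspace by (auto simp: conj_assoc)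
qed

lemma topspace_weak: "topspace (weak_top p) = Pp p"
  by (auto simp: weak_top_def topspace_narrow Pp_def)

lemma openin_narrow_integral:
  assumes "bounded_continuous g" "open U"
  shows "openin narrow_top {\<mu>\<in>Prob. (\<integral>x. g x \<partial>\<mu>) \<in> U}"
  unfolding narrow_top_def using assms by (intro topology_generated_by_Basis) auto

lemma continuous_map_narrow_integral:
  assumes "bounded_continuous g"
  shows "continuous_map narrow_top euclideanreal (\<lambda>\<mu>. \<integral>x. g x \<partial>\<mu>)"
  using openin_narrow_integral[OF assms]
  by (auto simp: continuous_map_def topspace_narrow)

lemma continuous_map_into_narrow:
  assumes "\<And>x. x \<in> topspace X \<Longrightarrow> F x \<in> Prob"
    and "\<And>g. bounded_continuous g \<Longrightarrow> continuous_map X euclideanreal (\<lambda>x. \<integral>y. g y \<partial>F x)"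
  shows "continuous_map X narrow_top F"
  unfolding narrow_top_def
proof (rule continuous_on_generated_topo, goal_cases)
  case (1 U)
  then obtain g V where gV: "U = {\<mu>\<in>Prob. (\<integral>x. g x \<partial>\<mu>) \<in> V}" "bounded_continuous g" "open V" by auto
  have "F -` U \<inter> topspace X = {x \<in> topspace X. (\<integral>y. g y \<partial>F x) \<in> V}"
    using assms(1) by (auto simp: gV)
  then show ?case
    using assms(2)[OF gV(2)] gV(3) by (auto simp: continuous_map_def)
next
  case 2
  have "F ` topspace X \<subseteq> topspace narrow_top"
    using assms(1) by (auto simp: topspace_narrow)
  then show ?case unfolding narrow_top_def topology_generated_by_topspace .
qed

section \<open>Compactness and separation in the narrow topology\<close>

lemma tendsto_coordinatewise:
  fixes f :: "nat \<Rightarrow> nat \<Rightarrow> real"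
  assumes "\<And>i. (\<lambda>n. f n i) \<longlonglongrightarrow> l i"
  shows "f \<longlonglongrightarrow> l"
proof -
  have "limitin (product_topology (\<lambda>_. euclidean) UNIV) f l sequentially"
    unfolding limitin_componentwise using assms by auto
  then show ?thesis by (simp add: euclidean_product_topology)
qed

text \<open>Compactness of \<open>S\<close> is read off in the metrizable space of real sequences: after adding any
  further test function to a determining sequence, forgetting it again is a continuous bijection of compact sets.\<close>

lemma compactin_narrow_sequentially:
  fixes S :: "'a::metric_space measure set" and d :: "nat \<Rightarrow> 'a \<Rightarrow> real"
  assumes S: "S \<subseteq> Prob" and d: "\<And>i. bounded_continuous (d i)"
    and inj: "\<And>\<mu> \<nu>. \<mu> \<in> S \<Longrightarrow> \<nu> \<in> S \<Longrightarrow> (\<And>i. (\<integral>x. d i x \<partial>\<mu>) = (\<integral>x. d i x \<partial>\<nu>)) \<Longrightarrow> \<mu> = \<nu>"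
    and seq: "\<And>\<mu> :: nat \<Rightarrow> 'a measure. (\<And>n. \<mu> n \<in> S) \<Longrightarrow> \<exists>r \<nu>. strict_mono r \<and> \<nu> \<in> S \<and>
        (\<forall>g. bounded_continuous g \<longrightarrow> (\<lambda>n. \<integral>x. g x \<partial>\<mu> (r n)) \<longlonglongrightarrow> (\<integral>x. g x \<partial>\<nu>))"
  shows "compactin narrow_top S"
proof -
  define \<Phi> where "\<Phi> g \<mu> = (\<lambda>i::nat. \<integral>x. g i x \<partial>\<mu>)" for g :: "nat \<Rightarrow> 'a \<Rightarrow> real" and \<mu>
  have comp: "compact (\<Phi> g ` S)" if g: "\<And>i. bounded_continuous (g i)" for g
    unfolding compact_eq_seq_compact_metric seq_compact_def
  proof (intro allI impI)
    fix c :: "nat \<Rightarrow> nat \<Rightarrow> real" assume "\<forall>n. c n \<in> \<Phi> g ` S"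
    then have "\<forall>n. \<exists>\<mu>. \<mu> \<in> S \<and> c n = \<Phi> g \<mu>" by blast
    define \<mu> where "\<mu> n = (SOME \<mu>. \<mu> \<in> S \<and> c n = \<Phi> g \<mu>)" for n
    have \<mu>: "\<mu> n \<in> S" "c n = \<Phi> g (\<mu> n)" for n
      using someI_ex[OF \<open>\<forall>n. \<exists>\<mu>. \<mu> \<in> S \<and> c n = \<Phi> g \<mu>\<close>[rule_format, of n]] by (auto simp: \<mu>_def)
    obtain r \<nu> where r: "strict_mono r" "\<nu> \<in> S"
      "\<forall>g. bounded_continuous g \<longrightarrow> (\<lambda>n. \<integral>x. g x \<partial>\<mu> (r n)) \<longlonglongrightarrow> (\<integral>x. g x \<partial>\<nu>)"
      using seq[of \<mu>, OF \<mu>(1)] by (elim exE conjE)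
    have "(c \<circ> r) \<longlonglongrightarrow> \<Phi> g \<nu>"
      by (rule tendsto_coordinatewise) (simp add: \<mu>(2) \<Phi>_def r(3)[rule_format, OF g])
    then show "\<exists>l\<in>\<Phi> g ` S. \<exists>r. strict_mono r \<and> (c \<circ> r) \<longlonglongrightarrow> l" using r by blast
  qed
  define \<Psi> where "\<Psi> = the_inv_into S (\<Phi> d)"
  have "inj_on (\<Phi> d) S"
    by (rule inj_onI, rule inj) (auto simp: \<Phi>_def dest: fun_cong)
  then have \<Psi>: "\<Psi> (\<Phi> d \<mu>) = \<mu>" if "\<mu> \<in> S" for \<mu>
    unfolding \<Psi>_def using that by (rule the_inv_into_f_f)
  have "continuous_map (top_of_set (\<Phi> d ` S)) narrow_top \<Psi>"
  proof (rule continuous_map_into_narrow)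
    show "\<Psi> c \<in> Prob" if "c \<in> topspace (top_of_set (\<Phi> d ` S))" for c
      using that S by (auto simp: \<Psi>)
    fix g :: "'a \<Rightarrow> real" assume g: "bounded_continuous g"
    define d' where "d' = case_nat g d"
    have d': "bounded_continuous (d' i)" for i using d g by (auto simp: d'_def split: nat.split)
    let ?pr = "\<lambda>c :: nat \<Rightarrow> real. \<lambda>i. c (Suc i)"
    define e where "e c = \<Phi> d' (\<Psi> c)" for c
    have pr: "?pr (\<Phi> d' \<mu>) = \<Phi> d \<mu>" for \<mu> by (auto simp: \<Phi>_def d'_def)
    have "continuous_on (?pr ` (\<Phi> d' ` S)) e"
    proof (rule continuous_on_inv)
      show "continuous_on (\<Phi> d' ` S) ?pr"
        by (intro continuous_on_coordinatewise_then_product continuous_on_subset[OF continuous_on_product_coordinates]) auto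
      show "compact (\<Phi> d' ` S)" by (rule comp[OF d'])
      show "\<forall>c\<in>\<Phi> d' ` S. e (?pr c) = c" by (auto simp: pr e_def \<Psi>)
    qed
    then have "continuous_on (\<Phi> d ` S) e" by (simp add: image_image pr)
    then have "continuous_on (\<Phi> d ` S) (\<lambda>c. e c 0)"
      by (rule continuous_on_product_then_coordinatewise)
    then show "continuous_map (top_of_set (\<Phi> d ` S)) euclideanreal (\<lambda>c. \<integral>y. g y \<partial>\<Psi> c)"
      by (simp add: e_def \<Phi>_def d'_def)
  qed
  moreover have "compactin (top_of_set (\<Phi> d ` S)) (\<Phi> d ` S)"
    using comp[OF d] by (simp add: compactin_subtopology)
  ultimately have "compactin narrow_top (\<Psi> ` \<Phi> d ` S)" by (rule image_compactin[rotated])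
  then show ?thesis using \<Psi> by (simp add: image_image cong: image_cong)
qed

context dense_seq
begin

text \<open>A countable base yields a countable intersection-stable generator of the Borel sets; the
  bumps of its members form the sequence. It embeds sets of measures into the metrizable space of
  real sequences.\<close>

lemma determining_sequence:
  "\<exists>d :: nat \<Rightarrow> 'a \<Rightarrow> real. (\<forall>i. bounded_continuous (d i)) \<and>
    (\<forall>\<mu>\<in>Prob. \<forall>\<nu>\<in>Prob. (\<forall>i. (\<integral>x. d i x \<partial>\<mu>) = (\<integral>x. d i x \<partial>\<nu>)) \<longrightarrow> \<mu> = \<nu>)"
proof -
  define B where "B = range (\<lambda>(i, j). ball (e i) (1 / (real j + 1)))"
  define E where "E = Inter ` {F. finite F \<and> F \<subseteq> B}"
  have "countable B" unfolding B_def by simp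
  then have "countable E" unfolding E_def by (intro countable_image countable_Collect_finite_subset)
  have "topological_basis B"
  proof (rule topological_basisI)
    fix O' :: "'a set" and x assume "open O'" "x \<in> O'"
    then obtain \<epsilon> where \<epsilon>: "0 < \<epsilon>" "ball x \<epsilon> \<subseteq> O'" by (auto simp: open_contains_ball)
    obtain j :: nat where j: "1 / (real j + 1) < \<epsilon> / 2"
      using reals_Archimedean[of "\<epsilon>/2"] \<epsilon> by (auto simp: inverse_eq_divide add.commute)
    obtain i where i: "dist x (e i) < 1 / (real j + 1)" using dense[of "1 / (real j + 1)" x] by auto
    have "ball (e i) (1 / (real j + 1)) \<subseteq> ball x \<epsilon>"
    proof
      fix y assume "y \<in> ball (e i) (1 / (real j + 1))"
      then have "dist (e i) y < 1 / (real j + 1)" by simp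
      then show "y \<in> ball x \<epsilon>" using i j dist_triangle[of x y "e i"] by simp
    qed
    then show "\<exists>B'\<in>B. x \<in> B' \<and> B' \<subseteq> O'"
      using i \<epsilon> by (intro bexI[of _ "ball (e i) (1 / (real j + 1))"]) (auto simp: B_def dist_commute)
  qed (auto simp: B_def)
  then have borel: "sets borel = sigma_sets UNIV B"
    by (subst borel_eq_countable_basis[OF \<open>countable B\<close>]) (auto simp: sets_measure_of)
  have opn: "open A" if "A \<in> E" for A
    using that by (auto simp: E_def B_def intro!: open_Inter)
  have "B \<subseteq> E"
  proof
    fix b assume "b \<in> B"
    then show "b \<in> E" unfolding E_def by (intro image_eqI[of _ _ "{b}"]) auto
  qed
  have sE: "sets borel = sigma_sets UNIV E"
  proof (rule antisym)
    show "sets borel \<subseteq> sigma_sets UNIV E" unfolding borel by (rule sigma_sets_mono'[OF \<open>B \<subseteq> E\<close>])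
    show "sigma_sets UNIV E \<subseteq> sets borel"
      using opn sets.sigma_sets_subset[of E borel] by (simp add: subset_iff)
  qed
  have "Int_stable E"
  proof (rule Int_stableI)
    fix a b assume "a \<in> E" "b \<in> E"
    then obtain F F' where "finite F" "F \<subseteq> B" "a = \<Inter>F" "finite F'" "F' \<subseteq> B" "b = \<Inter>F'"
      by (auto simp: E_def)
    then show "a \<inter> b \<in> E" unfolding E_def by (intro image_eqI[of _ _ "F \<union> F'"]) auto
  qed
  have "UNIV \<in> E" unfolding E_def by (intro image_eqI[of _ _ "{}"]) auto
  then have E: "range (from_nat_into E) = E" using \<open>countable E\<close> by (intro range_from_nat_into) auto
  define d where "d k = bump (from_nat_into E (fst (prod_decode k))) (snd (prod_decode k))" for k
  show ?thesis
  proof (intro exI[of _ d] conjI ballI allI impI; (elim conjE)?)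
    show "continuous_on UNIV (d i)" "bounded (range (d i))" for i
      unfolding d_def using bounded_continuous_bump by auto
    fix \<mu> \<nu> :: "'a measure" assume *: "\<mu> \<in> Prob" "\<nu> \<in> Prob" "\<forall>i. (\<integral>x. d i x \<partial>\<mu>) = (\<integral>x. d i x \<partial>\<nu>)"
    show "\<mu> = \<nu>"
    proof (rule measure_eqI_bump[OF *(1,2) \<open>Int_stable E\<close> sE opn, where \<phi>="\<lambda>t. t"])
      fix A n assume "A \<in> E"
      then obtain i where "A = from_nat_into E i" using E by (metis imageE)
      then show "(\<integral>x. bump A n x \<partial>\<mu>) = (\<integral>x. bump A n x \<partial>\<nu>)"
        using *(3)[rule_format, of "prod_encode (i, n)"] by (simp add: d_def)
    qed (auto intro: continuous_intros)
  qed
qed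

lemma Prob_eqI:
  assumes "\<mu> \<in> Prob" "\<nu> \<in> Prob" "\<And>g. bounded_continuous g \<Longrightarrow> (\<integral>x. g x \<partial>\<mu>) = (\<integral>x. g x \<partial>\<nu>)"
  shows "\<mu> = (\<nu> :: 'a measure)"
proof -
  obtain d :: "nat \<Rightarrow> 'a \<Rightarrow> real" where d: "\<forall>i. bounded_continuous (d i)"
    "\<forall>\<mu>\<in>Prob. \<forall>\<nu>\<in>Prob. (\<forall>i. (\<integral>x. d i x \<partial>\<mu>) = (\<integral>x. d i x \<partial>\<nu>)) \<longrightarrow> \<mu> = \<nu>"
    using determining_sequence by (elim exE conjE)
  show ?thesis using assms(3) d(1) by (intro d(2)[rule_format] assms(1,2)) blast
qed

lemma Hausdorff_narrow: "Hausdorff_space (narrow_top :: 'a measure topology)"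
  unfolding Hausdorff_space_def topspace_narrow
proof (intro allI impI, elim conjE)
  fix \<mu> \<nu> :: "'a measure" assume *: "\<mu> \<in> Prob" "\<nu> \<in> Prob" "\<mu> \<noteq> \<nu>"
  then obtain g where g: "bounded_continuous g" "(\<integral>x. g x \<partial>\<mu>) \<noteq> (\<integral>x. g x \<partial>\<nu>)"
    using Prob_eqI by blast
  obtain U V where UV: "open U" "open V" "(\<integral>x. g x \<partial>\<mu>) \<in> U" "(\<integral>x. g x \<partial>\<nu>) \<in> V" "U \<inter> V = {}"
    using hausdorff[OF g(2)] by blast
  show "\<exists>U V. openin narrow_top U \<and> openin narrow_top V \<and> \<mu> \<in> U \<and> \<nu> \<in> V \<and> disjnt U V"
    using UV * by (intro exI[of _ "{\<mu>\<in>Prob. (\<integral>x. g x \<partial>\<mu>) \<in> U}"] exI[of _ "{\<mu>\<in>Prob. (\<integral>x. g x \<partial>\<mu>) \<in> V}"])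
      (auto simp: openin_narrow_integral[OF g(1)] disjnt_def)
qed

end

section \<open>Tight sequences of measures\<close>

text \<open>Ternary expansions with digits 0 and 2. The middle-third gaps leave room for continuous
  functions on the line that read off single bits.\<close>

definition cantor :: "(nat \<Rightarrow> bool) \<Rightarrow> real" where
  "cantor b = (\<Sum>k. 2 * of_bool (b k) / 3 ^ Suc k)"

lemma summable_cantor: "summable (\<lambda>k. 2 * of_bool (b k) / 3 ^ Suc k :: real)"
proof (rule summable_comparison_test'[of "\<lambda>k. 2 / 3 * (1 / 3 :: real) ^ k" 0])
  show "summable (\<lambda>k. 2 / 3 * (1 / 3 :: real) ^ k)" by (intro summable_mult summable_geometric) simp
qed (auto simp: power_divide)

lemma cantor_bounds: "0 \<le> cantor b" "cantor b \<le> 1"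
proof -
  show "0 \<le> cantor b" unfolding cantor_def by (intro suminf_nonneg summable_cantor) simp
  have s: "(\<lambda>k. 2 / 3 * (1 / 3 :: real) ^ k) sums (2 / 3 * (1 / (1 - 1 / 3)))"
    by (intro sums_mult geometric_sums) simp
  have "cantor b \<le> (\<Sum>k. 2 / 3 * (1 / 3 :: real) ^ k)"
    unfolding cantor_def using s by (intro suminf_le summable_cantor) (auto simp: power_divide sums_iff)
  also have "\<dots> = 1" using s by (simp add: sums_iff)
  finally show "cantor b \<le> 1" .
qed

lemma cantor_unfold: "cantor b = (2 * of_bool (b 0) + cantor (\<lambda>k. b (Suc k))) / 3"
proof -
  have "cantor b = (\<Sum>k. 2 * of_bool (b (Suc k)) / 3 ^ Suc (Suc k)) + 2 * of_bool (b 0) / 3"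
    unfolding cantor_def using suminf_split_head[OF summable_cantor[of b]] by simp
  also have "(\<Sum>k. 2 * of_bool (b (Suc k)) / 3 ^ Suc (Suc k) :: real)
      = (\<Sum>k. 2 * of_bool (b (Suc k)) / 3 ^ Suc k) / 3"
    by (subst suminf_divide[OF summable_cantor, symmetric]) (simp add: field_simps)
  finally show ?thesis by (simp add: cantor_def add_divide_distrib)
qed

text \<open>It is 0 up to 1/3 and 1 from 2/3 on, so on the Cantor set it reads the first bit; it
  interpolates linearly across the gap.\<close>

definition ramp :: "real \<Rightarrow> real" where "ramp u = max 0 (min 1 (3 * u - 1))"

text \<open>A continuous extension to the line of the shift that deletes the first ternary digit of
  a point of the Cantor set.\<close>

definition expand :: "real \<Rightarrow> real" where "expand u = 3 * u - 2 * ramp u"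

definition digit :: "nat \<Rightarrow> real \<Rightarrow> real" where "digit k u = ramp ((expand ^^ k) u)"

lemma ramp_cantor: "ramp (cantor b) = of_bool (b 0)"
  using cantor_bounds[of "\<lambda>k. b (Suc k)"] cantor_unfold[of b] by (auto simp: ramp_def)

lemma digit_cantor: "digit k (cantor b) = of_bool (b k)"
proof -
  have "expand (cantor b) = cantor (\<lambda>k. b (Suc k))" for b
    using cantor_unfold[of b] by (simp add: expand_def ramp_cantor)
  then have "(expand ^^ k) (cantor b) = cantor (\<lambda>j. b (k + j))" for k
    by (induction k) auto
  then show ?thesis by (simp add: digit_def ramp_cantor)
qed

lemma digit_bounds: "0 \<le> digit k u" "digit k u \<le> 1"
  by (auto simp: digit_def ramp_def)

lemma continuous_digit: "continuous_on UNIV (digit k)"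
proof -
  have r: "continuous_on UNIV ramp" unfolding ramp_def by (intro continuous_intros)
  have "continuous_on UNIV expand" unfolding expand_def by (intro continuous_intros r)
  then have "continuous_on UNIV (expand ^^ k)"
    by (induction k) (auto simp: continuous_on_id' id_def[symmetric] o_def intro: continuous_on_compose2)
  then show ?thesis unfolding digit_def by (rule continuous_on_compose2[OF r]) simp
qed

lemma (in prob_space) integral_diff_le:
  fixes u v w :: "'a \<Rightarrow> real"
  assumes int: "integrable M u" "integrable M v" "integrable M w"
    and ae: "AE x in M. \<bar>u x - v x\<bar> \<le> c + d * w x" and w: "(\<integral>x. w x \<partial>M) \<le> c" and d: "0 \<le> d"
  shows "\<bar>(\<integral>x. u x \<partial>M) - (\<integral>x. v x \<partial>M)\<bar> \<le> c + d * c"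
proof -
  have "\<bar>(\<integral>x. u x \<partial>M) - (\<integral>x. v x \<partial>M)\<bar> = \<bar>\<integral>x. u x - v x \<partial>M\<bar>" using int by simp
  also have "\<dots> \<le> (\<integral>x. \<bar>u x - v x\<bar> \<partial>M)" by (rule integral_abs_bound)
  also have "\<dots> \<le> (\<integral>x. c + d * w x \<partial>M)" using int ae by (intro integral_mono_AE) auto
  also have "\<dots> = c + d * (\<integral>x. w x \<partial>M)" using int(3) by (simp add: prob_space)
  also have "\<dots> \<le> c + d * c" using mult_left_mono[OF w d] by simp
  finally show ?thesis .
qed

lemma proper_Cauchy_convergent:
  fixes X :: "nat \<Rightarrow> 'a::metric_space"
  assumes "proper_space TYPE('a)" "Cauchy X"
  shows "\<exists>l. X \<longlonglongrightarrow> l"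
proof -
  obtain r where "\<forall>y\<in>range X. dist (X 0) y \<le> r"
    using cauchy_imp_bounded[OF assms(2)] unfolding bounded_any_center[of _ "X 0"] by blast
  then have r: "range X \<subseteq> cball (X 0) r" by auto
  have "seq_compact (cball (X 0) r)"
    using assms(1) by (intro compact_imp_seq_compact) (simp add: proper_space_def)
  then obtain l s where "strict_mono s" "(X \<circ> s) \<longlonglongrightarrow> l"
    using r unfolding seq_compact_def by (metis range_subsetD)
  then show ?thesis using Cauchy_converges_subseq[OF assms(2)] by blast
qed

section \<open>Prokhorov's theorem on a proper space\<close>

context dense_seq
begin

lemma finite_cell_cover:
  assumes "proper_space TYPE('a)" "0 < \<rho>"
  shows "\<exists>I. \<forall>x. dist x x0 \<le> R \<longrightarrow> (\<exists>i\<le>I. dist x (e i) < \<rho>)"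
proof -
  have c: "compact (cball x0 R)" using assms by (simp add: proper_space_def)
  have cov: "cball x0 R \<subseteq> (\<Union>i\<in>UNIV. ball (e i) \<rho>)"
    using dense[OF assms(2)] by (force simp: dist_commute)
  obtain C where C: "C \<subseteq> UNIV" "finite C" "cball x0 R \<subseteq> (\<Union>i\<in>C. ball (e i) \<rho>)"
    by (rule compactE_image[OF c _ cov]) auto
  show ?thesis
  proof (rule exI[of _ "Max (insert 0 C)"], intro allI impI)
    fix x assume "dist x x0 \<le> R"
    then have "x \<in> cball x0 R" by (simp add: dist_commute)
    then obtain i where "i \<in> C" "dist x (e i) < \<rho>" using C(3) by (auto simp: dist_commute)
    then show "\<exists>i\<le>Max (insert 0 C). dist x (e i) < \<rho>" using C(2) by (intro exI[of _ i]) auto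
  qed
qed

text \<open>The bits \<open>dist x (e i) < 2\<^sup>-\<^sup>m\<close> are coded into a point of the Cantor set. There they become restrictions of
  continuous functions on the line, so that Helly's selection theorem passes to the limit in the law of all the
  bits, and the limit law is decoded by completeness.\<close>

theorem tight_imp_narrow_convergent_subsequence:
  fixes \<mu> :: "nat \<Rightarrow> 'a measure"
  assumes proper: "proper_space TYPE('a)" and \<mu>: "\<And>n. \<mu> n \<in> Prob"
    and tight: "\<And>\<epsilon>. 0 < \<epsilon> \<Longrightarrow> \<exists>R. \<forall>n. measure (\<mu> n) {x. R < dist x x0} \<le> \<epsilon>"
  shows "\<exists>r \<nu>. strict_mono r \<and> \<nu> \<in> Prob \<and>
    (\<forall>g. bounded_continuous g \<longrightarrow> (\<lambda>n. \<integral>x. g x \<partial>\<mu> (r n)) \<longlonglongrightarrow> (\<integral>x. g x \<partial>\<nu>))"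
proof -
  define bit where "bit m i x \<longleftrightarrow> dist x (e i) < (1/2) ^ m" for m i x
  define code where "code x = cantor (\<lambda>k. bit (fst (prod_decode k)) (snd (prod_decode k)) x)" for x
  define dg where "dg m i = digit (prod_encode (m, i))" for m i
  have dg_code: "dg m i (code x) = of_bool (bit m i x)" for m i x
    by (simp add: dg_def code_def digit_cantor)
  have dg01: "0 \<le> dg m i u" "dg m i u \<le> 1" for m i u by (auto simp: dg_def digit_bounds)
  have dg_cont: "continuous_on UNIV (dg m i)" for m i unfolding dg_def by (rule continuous_digit)
  have [measurable]: "dg m i \<in> borel_measurable borel" for m i
    by (intro borel_measurable_continuous_onI dg_cont)
  have [measurable]: "code \<in> borel_measurable borel"
    unfolding code_def cantor_def bit_def of_bool_def by measurable
  have \<mu>P: "prob_space (\<mu> n)" for n by (rule ProbD[OF \<mu>])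
  have M: "measurable (\<mu> n) N = measurable borel N" for n and N :: "real measure"
    by (rule measurable_Prob_cong[OF \<mu>])
  define Ls where "Ls n = distr (\<mu> n) borel code" for n
  have rd: "real_distribution (Ls n)" for n
    unfolding Ls_def real_distribution_def real_distribution_axioms_def
    by (auto intro!: prob_space.prob_space_distr[OF \<mu>P] simp: M)
  \<comment> \<open>Codes lie in the unit interval, so tightness of their laws is immediate.
    Tightness of the measures themselves is needed later, to decode the limit.\<close>
  have "tight Ls"
    unfolding tight_def
  proof (intro conjI allI impI rd, rule exI[of _ "-1"], rule exI[of _ 1], intro conjI allI)
    fix \<epsilon> :: real and n assume "0 < \<epsilon>"
    have "-1 < code x" "code x \<le> 1" for x
      unfolding code_def by (rule less_le_trans[OF _ cantor_bounds(1)]) (simp_all add: cantor_bounds)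
    then have "code -` {-1<..1} \<inter> space (\<mu> n) = space (\<mu> n)"
      by auto
    then have "measure (Ls n) {-1<..1} = 1"
      unfolding Ls_def by (subst measure_distr) (auto simp: M prob_space.prob_space[OF \<mu>P])
    then show "1 - \<epsilon> < measure (Ls n) {-1<..1}" using \<open>0 < \<epsilon>\<close> by simp
  qed simp
  from tight_imp_convergent_subsubsequence[OF this, of id]
  obtain s L where s: "strict_mono s" and L: "real_distribution L" and wc: "weak_conv_m (Ls \<circ> s) L"
    by (auto simp: strict_mono_def)
  interpret L: real_distribution L by fact
  have conv: "(\<lambda>n. \<integral>x. \<Theta> (code x) \<partial>\<mu> (s n)) \<longlonglongrightarrow> (\<integral>u. \<Theta> u \<partial>L)"
    if \<Theta>: "continuous_on UNIV \<Theta>" "\<And>u. \<bar>\<Theta> u\<bar> \<le> B" for \<Theta> :: "real \<Rightarrow> real" and B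
  proof -
    have [measurable]: "\<Theta> \<in> borel_measurable borel" by (intro borel_measurable_continuous_onI \<Theta>)
    have "(\<lambda>n. \<integral>u. \<Theta> u \<partial>(Ls \<circ> s) n) \<longlonglongrightarrow> (\<integral>u. \<Theta> u \<partial>L)"
      using \<Theta> by (intro weak_conv_imp_bdd_ae_continuous_conv[where B=B] L wc)
        (auto simp: rd continuous_on_eq_continuous_at)
    moreover have "(\<integral>u. \<Theta> u \<partial>(Ls \<circ> s) n) = (\<integral>x. \<Theta> (code x) \<partial>\<mu> (s n))" for n
      unfolding Ls_def by (simp add: integral_distr M)
    ultimately show ?thesis by simp
  qed
  have tail_int: "(\<integral>x. \<Theta> (code x) \<partial>\<mu> n) \<le> measure (\<mu> n) {x. R < dist x x0}"
    if \<Theta>: "continuous_on UNIV \<Theta>" "\<And>u. \<bar>\<Theta> u\<bar> \<le> B" "\<And>x. \<Theta> (code x) \<le> indicator {x. R < dist x x0} x"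
    for \<Theta> :: "real \<Rightarrow> real" and B R n
  proof -
    interpret prob_space "\<mu> n" by (rule \<mu>P)
    have [measurable]: "\<Theta> \<in> borel_measurable borel" by (intro borel_measurable_continuous_onI \<Theta>)
    have [measurable]: "{x. R < dist x x0} \<in> sets (\<mu> n)"
      unfolding ProbD(2)[OF \<mu>] by measurable
    have "integrable (\<mu> n) (\<lambda>x. \<Theta> (code x))"
      by (rule integrable_const_bound[where B=B]) (use \<Theta>(2) in \<open>auto simp: M\<close>)
    then have "(\<integral>x. \<Theta> (code x) \<partial>\<mu> n) \<le> (\<integral>x. indicator {x. R < dist x x0} x \<partial>\<mu> n)"
      using \<Theta>(3) by (intro integral_mono) (auto intro!: integrable_real_indicator simp: less_top[symmetric])
    then show ?thesis by (simp add: ProbD(3)[OF \<mu>])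
  qed
  \<comment> \<open>The limit law may charge numbers that are not codes. Any continuous relation
    between digits that holds at all codes still holds almost everywhere for \<open>L\<close>,
    because its integral is the limit of zeros.\<close>
  have null: "AE u in L. \<Theta> u = 0"
    if \<Theta>: "continuous_on UNIV \<Theta>" "\<And>u. 0 \<le> \<Theta> u \<and> \<Theta> u \<le> 1" "\<And>x. \<Theta> (code x) = 0" for \<Theta> :: "real \<Rightarrow> real"
  proof -
    have [measurable]: "\<Theta> \<in> borel_measurable borel" by (intro borel_measurable_continuous_onI \<Theta>)
    have "(\<lambda>n. \<integral>x. \<Theta> (code x) \<partial>\<mu> (s n)) \<longlonglongrightarrow> (\<integral>u. \<Theta> u \<partial>L)"
      using \<Theta> by (intro conv[of _ 1]) (auto simp: abs_le_iff intro: order_trans[of _ 0])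
    then have "(\<integral>u. \<Theta> u \<partial>L) = 0" by (simp add: \<Theta>(3) LIMSEQ_const_iff)
    moreover have "integrable L \<Theta>"
      by (rule L.integrable_const_bound[where B=1]) (use \<Theta>(2) in auto)
    ultimately show ?thesis using \<Theta>(2) by (subst (asm) integral_nonneg_eq_0_iff_AE) auto
  qed
  have AE1: "AE u in L. \<forall>m i. dg m i u = 0 \<or> dg m i u = 1"
  proof -
    have "AE u in L. dg m i u * (1 - dg m i u) = 0" for m i
      by (rule null) (auto intro!: continuous_intros dg_cont mult_le_one simp: dg01 dg_code)
    then have "AE u in L. dg m i u = 0 \<or> dg m i u = 1" for m i by simp
    then show ?thesis by (simp add: AE_all_countable)
  qed
  have AE2: "AE u in L. \<forall>m i m' i'. dg m i u * dg m' i' u \<noteq> 0 \<longrightarrow> dist (e i) (e i') \<le> (1/2) ^ m + (1/2) ^ m'"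
  proof -
    have "AE u in L. dg m i u * dg m' i' u \<noteq> 0 \<longrightarrow> dist (e i) (e i') \<le> (1/2) ^ m + (1/2) ^ m'" for m i m' i'
    proof (cases "dist (e i) (e i') \<le> (1/2) ^ m + (1/2) ^ m'")
      case False
      have "AE u in L. dg m i u * dg m' i' u = 0"
      proof (rule null)
        fix x
        have "\<not> (bit m i x \<and> bit m' i' x)"
          using False dist_triangle3[of "e i" "e i'" x] by (auto simp: bit_def)
        then show "dg m i (code x) * dg m' i' (code x) = 0" by (auto simp: dg_code)
      qed (auto intro!: continuous_intros dg_cont mult_le_one simp: dg01)
      then show ?thesis by eventually_elim simp
    qed simp
    then show ?thesis by (intro AE_all_countable[THEN iffD2] allI)
  qed
  have AE3: "AE u in L. \<forall>m. \<exists>i. dg m i u \<noteq> 0"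
  proof -
    have "AE u in L. \<exists>i. dg m i u \<noteq> 0" for m
    proof -
      define Z where "Z = {u. \<forall>i. dg m i u = 0}"
      have [measurable]: "Z \<in> sets borel" unfolding Z_def by measurable
      have "measure L Z \<le> \<epsilon>" if \<epsilon>: "0 < \<epsilon>" for \<epsilon>
      proof -
        obtain R where R: "\<And>n. measure (\<mu> n) {x. R < dist x x0} \<le> \<epsilon>" using tight[OF \<epsilon>] by blast
        obtain I where I: "\<And>x. dist x x0 \<le> R \<Longrightarrow> \<exists>i\<le>I. bit m i x"
          using finite_cell_cover[OF proper, of "(1/2)^m" x0 R] by (auto simp: bit_def)
        \<comment> \<open>\<open>\<Theta>\<close> is 1 on \<open>Z\<close> and vanishes at codes of
          points in the ball of radius \<open>R\<close>, which the first \<open>I + 1\<close> small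
          balls cover. Thus tightness prevents the limit from losing all bits of some level
          \<open>m\<close>.\<close>
        define \<Theta> where "\<Theta> u = (\<Prod>i\<le>I. 1 - dg m i u)" for u
        have \<Theta>01: "0 \<le> \<Theta> u" "\<Theta> u \<le> 1" for u
          unfolding \<Theta>_def by (auto intro!: prod_nonneg prod_le_1 simp: dg01)
        have \<Theta>c: "continuous_on UNIV \<Theta>" unfolding \<Theta>_def by (intro continuous_intros dg_cont)
        have [measurable]: "\<Theta> \<in> borel_measurable borel" by (intro borel_measurable_continuous_onI \<Theta>c)
        have int: "integrable L \<Theta>"
          by (rule L.integrable_const_bound[where B=1]) (use \<Theta>01 in auto)
        have "(\<integral>u. \<Theta> u \<partial>L) \<le> \<epsilon>"
        proof (rule LIMSEQ_le_const2[OF conv[OF \<Theta>c, of 1]])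
          show \<Theta>b: "\<bar>\<Theta> u\<bar> \<le> 1" for u using \<Theta>01[of u] by simp
          have "\<Theta> (code x) \<le> indicator {x. R < dist x x0} x" for x
          proof (cases "R < dist x x0")
            case False
            then obtain i where "i \<le> I" "bit m i x" using I[of x] by auto
            then have "\<Theta> (code x) = 0" unfolding \<Theta>_def by (intro prod_zero) (auto simp: dg_code)
            then show ?thesis by simp
          qed (use \<Theta>01 in auto)
          then have "(\<integral>x. \<Theta> (code x) \<partial>\<mu> (s n)) \<le> \<epsilon>" for n
            using tail_int[OF \<Theta>c \<Theta>b] R[of "s n"] by (meson order_trans)
          then show "\<exists>N. \<forall>n\<ge>N. (\<integral>x. \<Theta> (code x) \<partial>\<mu> (s n)) \<le> \<epsilon>" by blast
        qed
        moreover have "(\<integral>u. indicator Z u \<partial>L) \<le> (\<integral>u. \<Theta> u \<partial>L)"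
        proof (rule integral_mono[OF _ int])
          show "indicator Z u \<le> \<Theta> u" for u
            by (cases "u \<in> Z") (auto simp: Z_def \<Theta>_def prod_nonneg dg01)
        qed (auto intro!: integrable_real_indicator simp: less_top[symmetric])
        ultimately show ?thesis by simp
      qed
      then have "measure L Z \<le> 0" by (rule field_le_epsilon[where y=0, simplified])
      then have "Z \<in> null_sets L" by (auto simp: null_sets_def L.emeasure_eq_measure measure_le_0_iff)
      then show ?thesis by (rule AE_I') (auto simp: Z_def)
    qed
    then show ?thesis by (simp add: AE_all_countable)
  qed
  \<comment> \<open>Digit patterns that look like those of a point: bits are 0 or 1, balls with bit
    1 are compatible, and each level has a ball. Such a pattern determines a point by
    completeness.\<close>
  define \<Omega> where "\<Omega> = {u. (\<forall>m i. dg m i u = 0 \<or> dg m i u = 1) \<and>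
      (\<forall>m i m' i'. dg m i u * dg m' i' u \<noteq> 0 \<longrightarrow> dist (e i) (e i') \<le> (1/2) ^ m + (1/2) ^ m') \<and>
      (\<forall>m. \<exists>i. dg m i u \<noteq> 0)}"
  have \<Omega>_AE: "AE u in L. u \<in> \<Omega>" using AE1 AE2 AE3 by eventually_elim (simp add: \<Omega>_def)
  have [measurable]: "\<Omega> \<in> sets borel" unfolding \<Omega>_def by measurable
  define \<iota> where "\<iota> m u = (LEAST i. dg m i u = 1)" for m u
  have \<iota>: "dg m (\<iota> m u) u = 1" if "u \<in> \<Omega>" for m u
    unfolding \<iota>_def by (rule LeastI_ex) (use that in \<open>auto simp: \<Omega>_def, metis\<close>)
  have [measurable]: "\<iota> m \<in> measurable borel (count_space UNIV)" for m
    unfolding \<iota>_def by measurable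
  \<comment> \<open>The decoded approximation of level \<open>m\<close> is the centre of the first
    ball with bit 1. The value \<open>x0\<close> off the full-measure set \<open>\<Omega>\<close> is
    a mere default.\<close>
  define Gm where "Gm m u = (if u \<in> \<Omega> then e (\<iota> m u) else x0)" for m u
  have [measurable]: "Gm m \<in> borel_measurable borel" for m
  proof -
    have "(\<lambda>u. e (\<iota> m u)) \<in> borel_measurable borel"
      by (rule measurable_compose[of "\<iota> m" borel "count_space UNIV" e borel]) auto
    then show ?thesis unfolding Gm_def by (rule measurable_If_set) auto
  qed
  have Gm_dist: "dist (Gm m' u) (e i) \<le> (1/2) ^ m' + (1/2) ^ m" if "u \<in> \<Omega>" "dg m i u = 1" for m m' u i
    using that \<iota>[OF that(1), of m'] unfolding Gm_def \<Omega>_def by auto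
  have half: "(\<lambda>m. (1/2) ^ m :: real) \<longlonglongrightarrow> 0" by (rule LIMSEQ_power_zero) simp
  have "\<exists>l. (\<lambda>m. Gm m u) \<longlonglongrightarrow> l" for u
  proof (cases "u \<in> \<Omega>")
    case True
    have "Cauchy (\<lambda>m. Gm m u)"
    proof (rule metric_CauchyI)
      fix \<epsilon> :: real assume "0 < \<epsilon>"
      then obtain M where M: "(1/2) ^ M < \<epsilon> / 2" using real_arch_pow_inv[of "\<epsilon>/2" "1/2"] by auto
      show "\<exists>M. \<forall>m\<ge>M. \<forall>n\<ge>M. dist (Gm m u) (Gm n u) < \<epsilon>"
      proof (intro exI[of _ M] allI impI)
        fix m n assume mn: "M \<le> m" "M \<le> n"
        have "(1/2) ^ m \<le> ((1/2) ^ M :: real)" "(1/2) ^ n \<le> ((1/2) ^ M :: real)"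
          using mn by (auto intro: power_decreasing)
        then have "dist (Gm m u) (e (\<iota> n u)) < \<epsilon>"
          using Gm_dist[OF True \<iota>[OF True], of m n] M by linarith
        moreover have "Gm n u = e (\<iota> n u)" using True by (simp add: Gm_def)
        ultimately show "dist (Gm m u) (Gm n u) < \<epsilon>" by simp
      qed
    qed
    then show ?thesis by (rule proper_Cauchy_convergent[OF proper])
  next
    case False
    then have "(\<lambda>m. Gm m u) \<longlonglongrightarrow> x0" by (simp add: Gm_def)
    then show ?thesis ..
  qed
  then have "\<forall>u. \<exists>l. (\<lambda>m. Gm m u) \<longlonglongrightarrow> l" by blast
  from choice[OF this] obtain G where "\<forall>u. (\<lambda>m. Gm m u) \<longlonglongrightarrow> G u" by (elim exE)
  then have G: "(\<lambda>m. Gm m u) \<longlonglongrightarrow> G u" for u by blast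
  have [measurable]: "G \<in> borel_measurable borel"
    by (rule borel_measurable_LIMSEQ_metric[of Gm]) (auto simp: G)
  have G_dist: "dist (G u) (e i) \<le> (1/2) ^ m" if "u \<in> \<Omega>" "dg m i u = 1" for m u i
  proof (rule LIMSEQ_le)
    show "(\<lambda>m'. dist (Gm m' u) (e i)) \<longlonglongrightarrow> dist (G u) (e i)" by (intro tendsto_intros G)
    show "(\<lambda>m'. (1/2) ^ m' + (1/2) ^ m) \<longlonglongrightarrow> (1/2 :: real) ^ m"
      using tendsto_add[OF half tendsto_const, of "(1/2)^m"] by simp
    show "\<exists>N. \<forall>m'\<ge>N. dist (Gm m' u) (e i) \<le> (1/2) ^ m' + (1/2) ^ m" using Gm_dist[OF that] by blast
  qed
  define \<nu> where "\<nu> = distr L borel G"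
  have G_L: "G \<in> measurable L borel" by simp
  have \<nu>: "\<nu> \<in> Prob" unfolding \<nu>_def Prob_def by (simp add: L.prob_space_distr[OF G_L])
  have "(\<lambda>n. \<integral>x. h x \<partial>\<mu> (s n)) \<longlonglongrightarrow> (\<integral>x. h x \<partial>\<nu>)" if h: "bounded_continuous h" for h
  proof -
    obtain H where H: "0 < H" "\<And>x. \<bar>h x\<bar> \<le> H" and [measurable]: "h \<in> borel_measurable borel"
      using bounded_continuousD[OF h] by blast
    show ?thesis
    proof (rule LIMSEQ_I)
      fix \<epsilon>' :: real assume "0 < \<epsilon>'"
      \<comment> \<open>The approximation error \<open>\<epsilon> + 2 * H * \<epsilon>\<close>
        occurs once for \<open>\<mu> (s n)\<close> and once for \<open>\<nu>\<close>, and
        \<open>\<epsilon>\<close> once more for the limit in between: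
        \<open>3 * \<epsilon> + 4 * H * \<epsilon>\<close>.\<close>
      define \<epsilon> where "\<epsilon> = \<epsilon>' / (4 + 4 * H)"
      have "0 < \<epsilon>" using \<open>0 < \<epsilon>'\<close> H(1) by (simp add: \<epsilon>_def)
      moreover have "\<epsilon> * (4 + 4 * H) = \<epsilon>'" using H(1) by (simp add: \<epsilon>_def)
      ultimately have \<epsilon>: "0 < \<epsilon>" "3 * \<epsilon> + 4 * H * \<epsilon> < \<epsilon>'" by (auto simp: algebra_simps)
      obtain R where R: "\<And>n. measure (\<mu> n) {x. R < dist x x0} \<le> \<epsilon>" using tight[OF \<epsilon>(1)] by blast
      \<comment> \<open>Relevant centres lie within \<open>R + 1\<close> of \<open>x0\<close>, and
        the points compared with them within another 1, as \<open>(1/2) ^ m < 1\<close>.\<close>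
      have "continuous_on (cball x0 (R + 2)) h" using h continuous_on_subset by blast
      moreover have "compact (cball x0 (R + 2))" using proper by (simp add: proper_space_def)
      ultimately have "uniformly_continuous_on (cball x0 (R + 2)) h" by (rule compact_uniformly_continuous)
      then obtain \<delta> where \<delta>: "0 < \<delta>"
        "\<forall>x\<in>cball x0 (R + 2). \<forall>y\<in>cball x0 (R + 2). dist y x < \<delta> \<longrightarrow> dist (h y) (h x) < \<epsilon>"
        using \<epsilon>(1) unfolding uniformly_continuous_on_def by blast
      obtain m where m: "(1/2) ^ m < min \<delta> 1" using real_arch_pow_inv[of "min \<delta> 1" "1/2"] \<delta>(1) by auto
      obtain I where I: "\<And>x. dist x x0 \<le> R \<Longrightarrow> \<exists>i\<le>I. bit m i x"
        using finite_cell_cover[OF proper, of "(1/2)^m" x0 R] by (auto simp: bit_def)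
      define S where "S = {i. i \<le> I \<and> dist (e i) x0 \<le> R + 1}"
      have finS: "finite S" unfolding S_def by simp
      \<comment> \<open>At a genuine pattern \<open>sel i\<close> is 1 exactly when \<open>i\<close>
        is the first index with bit 1. Hence \<open>\<Theta>\<close> is the value of
        \<open>h\<close> at the selected centre, and \<open>W\<close> is 1 iff that centre lies
        outside \<open>S\<close>; both are continuous in the code.\<close>
      define sel where "sel i u = dg m i u * (\<Prod>j<i. 1 - dg m j u)" for i u
      define \<Theta> where "\<Theta> u = (\<Sum>i\<in>S. h (e i) * sel i u)" for u
      define W where "W u = 1 - (\<Sum>i\<in>S. sel i u)" for u
      have sel01: "0 \<le> sel i u" "sel i u \<le> 1" for i u
        unfolding sel_def by (auto intro!: mult_nonneg_nonneg mult_le_one prod_nonneg prod_le_1 simp: dg01)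
      have selc: "continuous_on UNIV (sel i)" for i unfolding sel_def by (intro continuous_intros dg_cont)
      have \<Theta>c: "continuous_on UNIV \<Theta>" unfolding \<Theta>_def by (intro continuous_intros selc)
      have Wc: "continuous_on UNIV W" unfolding W_def by (intro continuous_intros selc)
      have [measurable]: "\<Theta> \<in> borel_measurable borel" "W \<in> borel_measurable borel"
        by (intro borel_measurable_continuous_onI \<Theta>c Wc)+
      have \<Theta>b: "\<bar>\<Theta> u\<bar> \<le> real (card S) * H" for u
        unfolding \<Theta>_def using H sel01
        by (intro order_trans[OF sum_abs] sum_bounded_above) (auto simp: abs_mult intro!: mult_le_one order_trans[OF mult_left_le])
      have Wb: "\<bar>W u\<bar> \<le> 1 + real (card S)" for u
      proof -
        have "\<bar>\<Sum>i\<in>S. sel i u\<bar> \<le> real (card S) * 1"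
          using sel01 by (intro order_trans[OF sum_abs] sum_bounded_above) auto
        then show ?thesis unfolding W_def by linarith
      qed
      \<comment> \<open>Stated for an abstract pattern \<open>v\<close> and point \<open>y\<close>,
        because it is applied both to \<open>code x\<close> with \<open>x\<close> and to
        \<open>u\<close> with the decoded point \<open>G u\<close>.\<close>
      have core: "\<bar>h y - \<Theta> v\<bar> \<le> \<epsilon> + 2 * H * W v" "W v = of_bool (i0 \<notin> S)"
        if v: "\<And>i. dg m i v = 0 \<or> dg m i v = 1" and i0: "dg m i0 v = 1" "\<And>j. j < i0 \<Longrightarrow> dg m j v \<noteq> 1"
          and y: "dist y (e i0) \<le> (1/2) ^ m" for y v i0
      proof -
        have sel: "sel i v = of_bool (i = i0)" for i
        proof (cases i i0 rule: linorder_cases)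
          case less
          then show ?thesis using v[of i] i0(2)[of i] by (auto simp: sel_def)
        next
          case equal
          have "(\<Prod>j<i0. 1 - dg m j v) = 1" using v i0(2) by (intro prod.neutral) auto
          then show ?thesis using equal i0(1) by (simp add: sel_def)
        next
          case greater
          have "(\<Prod>j<i. 1 - dg m j v) = 0" using greater i0(1) by (intro prod_zero) auto
          then show ?thesis using greater by (simp add: sel_def)
        qed
        have W: "W v = of_bool (i0 \<notin> S)" unfolding W_def by (simp add: sel finS of_bool_def sum.delta)
        have \<Theta>: "\<Theta> v = (if i0 \<in> S then h (e i0) else 0)"
          unfolding \<Theta>_def by (simp add: sel finS of_bool_def if_distrib[where f="\<lambda>t. _ * t"] sum.delta cong: if_cong)
        show "W v = of_bool (i0 \<notin> S)" by (rule W)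
        show "\<bar>h y - \<Theta> v\<bar> \<le> \<epsilon> + 2 * H * W v"
        proof (cases "i0 \<in> S")
          case True
          then have "dist (e i0) x0 \<le> R + 1" by (simp add: S_def)
          moreover have "dist y x0 \<le> dist y (e i0) + dist (e i0) x0" by (rule dist_triangle)
          ultimately have "\<bar>h y - h (e i0)\<bar> < \<epsilon>"
            using y m unfolding dist_real_def[symmetric] by (intro \<delta>(2)[rule_format]) (auto simp: dist_commute)
          then show ?thesis using True by (simp add: W \<Theta>)
        next
          case False
          then show ?thesis using H(2)[of y] H(1) \<epsilon>(1) by (simp add: W \<Theta>)
        qed
      qed
      have code_core: "\<bar>h x - \<Theta> (code x)\<bar> \<le> \<epsilon> + 2 * H * W (code x)"
          "W (code x) \<le> indicator {x. R < dist x x0} x" for x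
      proof -
        define i0 where "i0 = (LEAST i. bit m i x)"
        have b: "bit m i0 x" unfolding i0_def bit_def by (rule LeastI_ex) (rule dense, simp)
        have less: "\<not> bit m j x" if "j < i0" for j using that not_less_Least unfolding i0_def by blast
        have "dist x (e i0) \<le> (1/2)^m" using b by (simp add: bit_def)
        note c = core[of "code x" i0 x, OF _ _ _ this]
        show "\<bar>h x - \<Theta> (code x)\<bar> \<le> \<epsilon> + 2 * H * W (code x)"
          by (rule c) (auto simp: dg_code b less)
        have W: "W (code x) = of_bool (i0 \<notin> S)" by (rule c) (auto simp: dg_code b less)
        show "W (code x) \<le> indicator {x. R < dist x x0} x"
        proof (cases "R < dist x x0")
          case False
          then obtain i where i: "i \<le> I" "bit m i x" using I[of x] by auto
          then have "i0 \<le> I" unfolding i0_def using Least_le[of "\<lambda>i. bit m i x"] order_trans by blast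
          moreover have "dist (e i0) x0 \<le> R + 1"
            using b m False dist_triangle3[of "e i0" x0 x] by (simp add: bit_def)
          ultimately show ?thesis by (simp add: W S_def)
        qed (simp add: W)
      qed
      have W_int: "(\<integral>x. W (code x) \<partial>\<mu> n) \<le> \<epsilon>" for n
        using tail_int[OF Wc Wb code_core(2)] R[of n] by (meson order_trans)
      have A: "\<bar>(\<integral>x. h x \<partial>\<mu> n) - (\<integral>x. \<Theta> (code x) \<partial>\<mu> n)\<bar> \<le> \<epsilon> + 2 * H * \<epsilon>" for n
      proof -
        interpret prob_space "\<mu> n" by (rule \<mu>P)
        have i1: "integrable (\<mu> n) (\<lambda>x. W (code x))"
          by (rule integrable_const_bound[where B="1 + real (card S)"]) (use Wb in \<open>auto simp: M\<close>)
        have i2: "integrable (\<mu> n) (\<lambda>x. \<Theta> (code x))"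
          by (rule integrable_const_bound[where B="real (card S) * H"]) (use \<Theta>b in \<open>auto simp: M\<close>)
        have i3: "integrable (\<mu> n) h" by (rule integrable_bounded_continuous[OF h \<mu>])
        show ?thesis
          by (rule integral_diff_le[OF i3 i2 i1]) (use code_core(1) W_int[of n] H(1) in auto)
      qed
      have WL: "(\<integral>u. W u \<partial>L) \<le> \<epsilon>"
        by (rule LIMSEQ_le_const2[OF conv[OF Wc Wb]]) (use W_int in blast)
      have B: "\<bar>(\<integral>x. h x \<partial>\<nu>) - (\<integral>u. \<Theta> u \<partial>L)\<bar> \<le> \<epsilon> + 2 * H * \<epsilon>"
      proof -
        have i1: "integrable L W"
          by (rule L.integrable_const_bound[where B="1 + real (card S)"]) (use Wb in auto)
        have i2: "integrable L \<Theta>"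
          by (rule L.integrable_const_bound[where B="real (card S) * H"]) (use \<Theta>b in auto)
        have i3: "integrable L (\<lambda>u. h (G u))"
          by (rule L.integrable_const_bound[where B=H]) (use H in auto)
        have ae: "AE u in L. \<bar>h (G u) - \<Theta> u\<bar> \<le> \<epsilon> + 2 * H * W u"
          using \<Omega>_AE
        proof eventually_elim
          case (elim u)
          show ?case
          proof (rule core(1))
            show "dg m i u = 0 \<or> dg m i u = 1" for i using elim by (simp add: \<Omega>_def)
            show "dg m (\<iota> m u) u = 1" by (rule \<iota>[OF elim])
            then show "dist (G u) (e (\<iota> m u)) \<le> (1/2)^m" by (rule G_dist[OF elim])
            show "dg m j u \<noteq> 1" if "j < \<iota> m u" for j using that not_less_Least unfolding \<iota>_def by blast
          qed
        qed
        have "\<bar>(\<integral>u. h (G u) \<partial>L) - (\<integral>u. \<Theta> u \<partial>L)\<bar> \<le> \<epsilon> + 2 * H * \<epsilon>"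
          by (rule L.integral_diff_le[OF i3 i2 i1 ae WL]) (use H(1) in simp)
        then show ?thesis by (simp add: \<nu>_def integral_distr)
      qed
      obtain N where N: "\<And>n. N \<le> n \<Longrightarrow> \<bar>(\<integral>x. \<Theta> (code x) \<partial>\<mu> (s n)) - (\<integral>u. \<Theta> u \<partial>L)\<bar> < \<epsilon>"
        using LIMSEQ_D[OF conv[OF \<Theta>c \<Theta>b] \<epsilon>(1)] by auto
      show "\<exists>N. \<forall>n\<ge>N. norm ((\<integral>x. h x \<partial>\<mu> (s n)) - (\<integral>x. h x \<partial>\<nu>)) < \<epsilon>'"
      proof (intro exI[of _ N] allI impI)
        fix n assume "N \<le> n"
        then show "norm ((\<integral>x. h x \<partial>\<mu> (s n)) - (\<integral>x. h x \<partial>\<nu>)) < \<epsilon>'"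
          using N[of n] A[of "s n"] B \<epsilon>(2) by (simp add: abs_less_iff abs_le_iff)
      qed
    qed
  qed
  then show ?thesis using s \<nu> by blast
qed

end

section \<open>Moment balls and the Wasserstein topology\<close>

text \<open>Markov's inequality for the \<open>p\<close>-th power of the distance.\<close>

lemma moment_tail:
  assumes p: "1 \<le> p" and \<mu>: "\<mu> \<in> Prob" and L: "Lp_le p \<mu> (\<lambda>x. dist x a) C" and R: "0 < R"
  shows "measure \<mu> {x. R < dist x a} \<le> C powr p / R powr p"
proof -
  interpret prob_space \<mu> by (rule ProbD[OF \<mu>])
  have [measurable]: "{x. R < dist x a} \<in> sets \<mu>" unfolding ProbD(2)[OF \<mu>] by measurable
  have "ennreal (R powr p) * emeasure \<mu> {x. R < dist x a}
      = (\<integral>\<^sup>+ x. ennreal (R powr p) * indicator {x. R < dist x a} x \<partial>\<mu>)"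
    by (simp add: nn_integral_cmult_indicator)
  also have "\<dots> \<le> (\<integral>\<^sup>+ x. ennreal (dist x a powr p) \<partial>\<mu>)"
    using p R by (intro nn_integral_mono) (auto simp: indicator_def intro!: ennreal_leI powr_mono2)
  also have "\<dots> \<le> ennreal (C powr p)" using L by (simp add: Lp_le_def)
  finally have "R powr p * measure \<mu> {x. R < dist x a} \<le> C powr p"
    by (simp add: emeasure_eq_measure flip: ennreal_mult)
  then show ?thesis using R by (simp add: field_simps)
qed

definition moment_ball :: "real \<Rightarrow> 'a::metric_space \<Rightarrow> real \<Rightarrow> 'a measure set" where
  "moment_ball p a C = {\<mu> \<in> Prob. Lp_le p \<mu> (\<lambda>x. dist x a) C}"

lemma moment_ball_Pp: "1 \<le> p \<Longrightarrow> moment_ball p a C \<subseteq> Pp p"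
  by (auto simp: moment_ball_def in_Pp_iff[of p _ a])

lemma min_real_tendsto: "(\<lambda>n. min t (real n)) \<longlonglongrightarrow> t"
proof (rule tendsto_eventually)
  obtain N :: nat where "t \<le> real N" using real_arch_simple by blast
  then show "\<forall>\<^sub>F n in sequentially. min t (real n) = t"
    by (auto simp: eventually_sequentially min_def intro!: exI[of _ N])
qed

text \<open>The moment bound gives tightness by Markov. It survives narrow limits because the
  truncated powers \<open>min (dist x a powr p) (real c)\<close> are bounded continuous and increase
  to the full power.\<close>

lemma (in dense_seq) compactin_moment_ball:
  fixes a :: 'a
  assumes proper: "proper_space TYPE('a)" and p: "1 \<le> p"
  shows "compactin narrow_top (moment_ball p a C)"
proof -
  obtain d :: "nat \<Rightarrow> 'a \<Rightarrow> real" where d: "\<forall>i. bounded_continuous (d i)"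
    "\<forall>\<mu>\<in>Prob. \<forall>\<nu>\<in>Prob. (\<forall>i. (\<integral>x. d i x \<partial>\<mu>) = (\<integral>x. d i x \<partial>\<nu>)) \<longrightarrow> \<mu> = \<nu>"
    using determining_sequence by (elim exE conjE)
  show ?thesis
  proof (rule compactin_narrow_sequentially[where d=d])
    show "moment_ball p a C \<subseteq> Prob" by (auto simp: moment_ball_def)
    show "bounded_continuous (d i)" for i using d by blast
    show "\<mu> = \<nu>" if "\<mu> \<in> moment_ball p a C" "\<nu> \<in> moment_ball p a C" "\<And>i. (\<integral>x. d i x \<partial>\<mu>) = (\<integral>x. d i x \<partial>\<nu>)" for \<mu> \<nu>
      using that d(2) by (auto simp: moment_ball_def)
    fix \<mu> :: "nat \<Rightarrow> 'a measure" assume *: "\<And>n. \<mu> n \<in> moment_ball p a C"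
    then have \<mu>: "\<mu> n \<in> Prob" and L: "Lp_le p (\<mu> n) (\<lambda>x. dist x a) C" for n by (auto simp: moment_ball_def)
    have C: "0 \<le> C" using L[of 0] by (rule Lp_le_nonneg)
    have tight: "\<exists>R. \<forall>n. measure (\<mu> n) {x. R < dist x a} \<le> \<epsilon>" if \<epsilon>: "0 < \<epsilon>" for \<epsilon>
    proof (intro exI allI)
      fix n
      \<comment> \<open>\<open>R powr p\<close> must be at least
        \<open>C powr p / \<epsilon>\<close>; the summand 1 keeps \<open>R\<close> positive when
        \<open>C = 0\<close>.\<close>
      define R where "R = (C powr p / \<epsilon>) powr (1/p) + 1"
      have "0 < R" by (simp add: R_def add_nonneg_pos)
      have "C powr p / \<epsilon> = ((C powr p / \<epsilon>) powr (1/p)) powr p" using p \<epsilon> by (simp add: powr_powr)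
      also have "\<dots> \<le> R powr p" using p by (intro powr_mono2) (auto simp: R_def)
      finally have "C powr p / R powr p \<le> \<epsilon>" using \<epsilon> \<open>0 < R\<close> by (simp add: field_simps)
      then show "measure (\<mu> n) {x. R < dist x a} \<le> \<epsilon>"
        using moment_tail[OF p \<mu> L \<open>0 < R\<close>, of n] by (simp add: R_def)
    qed
    have "\<exists>r \<nu>. strict_mono r \<and> \<nu> \<in> Prob \<and>
        (\<forall>g. bounded_continuous g \<longrightarrow> (\<lambda>n. \<integral>x. g x \<partial>\<mu> (r n)) \<longlonglongrightarrow> (\<integral>x. g x \<partial>\<nu>))"
      by (rule tight_imp_narrow_convergent_subsequence[OF proper \<mu>]) (rule tight)
    then obtain r \<nu> where r: "strict_mono r" and \<nu>: "\<nu> \<in> Prob"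
      and conv: "\<forall>g. bounded_continuous g \<longrightarrow> (\<lambda>n. \<integral>x. g x \<partial>\<mu> (r n)) \<longlonglongrightarrow> (\<integral>x. g x \<partial>\<nu>)"
      by (elim exE conjE)
    have "(\<integral>\<^sup>+ x. ennreal (dist x a powr p) \<partial>\<nu>) \<le> ennreal (C powr p)"
    proof (rule LIMSEQ_le_const2)
      let ?g = "\<lambda>c x. min (dist x a powr p) (real c)"
      show "(\<lambda>c. \<integral>\<^sup>+ x. ennreal (?g c x) \<partial>\<nu>) \<longlonglongrightarrow> (\<integral>\<^sup>+ x. ennreal (dist x a powr p) \<partial>\<nu>)"
      proof (rule nn_integral_LIMSEQ)
        show "incseq (\<lambda>c x. ennreal (?g c x))" by (auto simp: incseq_def le_fun_def intro!: ennreal_leI)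
        show "(\<lambda>c. ennreal (?g c x)) \<longlonglongrightarrow> ennreal (dist x a powr p)" for x
          by (intro tendsto_ennrealI min_real_tendsto)
      qed (auto simp: measurable_Prob_cong[OF \<nu>])
      have "(\<integral>\<^sup>+ x. ennreal (?g c x) \<partial>\<nu>) \<le> ennreal (C powr p)" for c
      proof -
        have g: "bounded_continuous (?g c)"
        proof
          show "continuous_on UNIV (?g c)"
            using p by (intro continuous_on_min continuous_on_powr' continuous_intros) auto
          show "bounded (range (?g c))" by (auto simp: bounded_iff intro!: exI[of _ "real c"])
        qed
        have eq: "(\<integral>\<^sup>+ x. ennreal (?g c x) \<partial>\<kappa>) = ennreal (\<integral>x. ?g c x \<partial>\<kappa>)" if "\<kappa> \<in> Prob" for \<kappa>
          by (rule nn_integral_eq_integral[OF integrable_bounded_continuous[OF g that]]) simp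
        have "(\<integral>x. ?g c x \<partial>\<mu> n) \<le> C powr p" for n
        proof -
          have "ennreal (\<integral>x. ?g c x \<partial>\<mu> n) \<le> (\<integral>\<^sup>+ x. ennreal (dist x a powr p) \<partial>\<mu> n)"
            unfolding eq[OF \<mu>, symmetric] by (intro nn_integral_mono ennreal_leI) simp
          also have "\<dots> \<le> ennreal (C powr p)" using L[of n] by (simp add: Lp_le_def)
          finally show ?thesis by simp
        qed
        then have "(\<integral>x. ?g c x \<partial>\<nu>) \<le> C powr p"
          using LIMSEQ_le_const2[OF conv[rule_format, OF g]] by blast
        then show ?thesis by (simp add: eq[OF \<nu>] ennreal_leI)
      qed
      then show "\<exists>N. \<forall>c\<ge>N. (\<integral>\<^sup>+ x. ennreal (?g c x) \<partial>\<nu>) \<le> ennreal (C powr p)" by blast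
    qed
    then have "\<nu> \<in> moment_ball p a C" using \<nu> C by (simp add: moment_ball_def Lp_le_def)
    then show "\<exists>r \<nu>. strict_mono r \<and> \<nu> \<in> moment_ball p a C \<and>
        (\<forall>g. bounded_continuous g \<longrightarrow> (\<lambda>n. \<integral>x. g x \<partial>\<mu> (r n)) \<longlonglongrightarrow> (\<integral>x. g x \<partial>\<nu>))"
      using r conv by blast
  qed
qed

text \<open>The infimal convolution of \<open>h\<close> with \<open>real n\<close> times the
  distance: \<open>n\<close>-Lipschitz and increasing to \<open>h\<close> for continuous nonnegative
  \<open>h\<close>. It carries estimates from Lipschitz to continuous functions.\<close>

definition inf_conv :: "('a::metric_space \<Rightarrow> real) \<Rightarrow> nat \<Rightarrow> 'a \<Rightarrow> real" where
  "inf_conv h n x = (INF y. h y + real n * dist x y)"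

context
  fixes h :: "'a::metric_space \<Rightarrow> real"
  assumes h_nonneg: "\<And>x. 0 \<le> h x"
begin

lemma inf_conv_bdd: "bdd_below (range (\<lambda>y. h y + real n * dist x y))"
  by (intro bdd_belowI2[of _ 0]) (simp add: h_nonneg)

lemma inf_conv_le: "inf_conv h n x \<le> h y + real n * dist x y"
  unfolding inf_conv_def by (rule cINF_lower[OF inf_conv_bdd]) simp

lemma inf_conv_greatest: "(\<And>y. c \<le> h y + real n * dist x y) \<Longrightarrow> c \<le> inf_conv h n x"
  unfolding inf_conv_def by (rule cINF_greatest) auto

lemma inf_conv_nonneg: "0 \<le> inf_conv h n x"
  by (rule inf_conv_greatest) (simp add: h_nonneg)

lemma inf_conv_mono:
  assumes "m \<le> n" shows "inf_conv h m x \<le> inf_conv h n x"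
proof (rule inf_conv_greatest)
  fix y
  from assms have "real m * dist x y \<le> real n * dist x y" by (intro mult_right_mono) auto
  then show "inf_conv h m x \<le> h y + real n * dist x y" using inf_conv_le[of m x y] by linarith
qed

lemma inf_conv_Lipschitz: "\<bar>inf_conv h n x - inf_conv h n y\<bar> \<le> real n * dist x y"
proof -
  have "inf_conv h n x - real n * dist x y \<le> inf_conv h n y" for x y
  proof (rule inf_conv_greatest)
    fix z
    have "real n * dist x z \<le> real n * dist x y + real n * dist y z"
      by (simp flip: distrib_left add: mult_left_mono dist_triangle)
    then show "inf_conv h n x - real n * dist x y \<le> h z + real n * dist y z"
      using inf_conv_le[of n x z] by linarith
  qed
  from this[of x y] this[of y x] show ?thesis by (simp add: abs_le_iff dist_commute)
qed

lemma inf_conv_tendsto: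
  assumes "continuous_on UNIV h"
  shows "(\<lambda>n. inf_conv h n x) \<longlonglongrightarrow> h x"
proof (rule LIMSEQ_I)
  fix \<epsilon> :: real assume \<epsilon>: "0 < \<epsilon>"
  have "isCont h x" using assms by (simp add: continuous_on_eq_continuous_at)
  then obtain \<delta> where \<delta>: "0 < \<delta>" "\<forall>y. dist y x < \<delta> \<longrightarrow> dist (h y) (h x) < \<epsilon> / 2"
    using \<epsilon> unfolding continuous_at_eps_delta by (meson half_gt_zero)
  obtain N :: nat where N: "h x < real N * \<delta>" using reals_Archimedean3[OF \<delta>(1)] by blast
  show "\<exists>N. \<forall>n\<ge>N. norm (inf_conv h n x - h x) < \<epsilon>"
  proof (intro exI[of _ N] allI impI)
    fix n assume n: "N \<le> n"
    have "h x - \<epsilon> / 2 \<le> inf_conv h n x"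
    proof (rule inf_conv_greatest)
      fix y
      show "h x - \<epsilon> / 2 \<le> h y + real n * dist x y"
      proof (cases "dist y x < \<delta>")
        case True
        then have "h x - \<epsilon>/2 \<le> h y" using \<delta>(2)[rule_format, OF True] unfolding dist_real_def by linarith
        then show ?thesis by (simp add: add_increasing2)
      next
        case False
        then have "real N * \<delta> \<le> real n * dist x y" using n \<delta>(1) by (intro mult_mono) (auto simp: dist_commute)
        then show ?thesis using N h_nonneg[of y] \<epsilon> by linarith
      qed
    qed
    moreover have "inf_conv h n x \<le> h x" using inf_conv_le[of n x x] by simp
    ultimately show "norm (inf_conv h n x - h x) < \<epsilon>" using \<epsilon> by (simp add: abs_less_iff)
  qed
qed

end

lemma couplings_pair:
  assumes M: "prob_space M" and [measurable]: "u \<in> measurable M borel" "v \<in> measurable M borel"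
  shows "distr M (borel \<Otimes>\<^sub>M borel) (\<lambda>z. (u z, v z)) \<in> couplings (distr M borel u) (distr M borel v)"
proof -
  have m: "(\<lambda>z. (u z, v z)) \<in> measurable M (borel \<Otimes>\<^sub>M borel)" by measurable
  show ?thesis
    by (auto simp: couplings_def prob_space.prob_space_distr[OF M m] distr_distr[OF _ m] o_def)
qed

locale wass_space = dense_seq +
  fixes p :: real
  assumes p: "1 \<le> p" and proper: "proper_space TYPE('a)"
begin

sublocale W: Metric_space "Pp p :: 'a measure set" "wass p"
  by (rule Metric_space_wass[OF p])

lemma wass_distr_le:
  assumes M: "prob_space M" and [measurable]: "u \<in> measurable M borel" "v \<in> measurable M (borel :: 'a measure)"
    and L: "Lp_le p M (\<lambda>z. dist (u z) (v z)) w"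
  shows "wass p (distr M borel u) (distr M borel v) \<le> w"
  by (rule wass_le[OF p couplings_pair[OF M]]) (use L in \<open>simp_all add: Lp_le_distr\<close>)

section \<open>Bounded and closed sets for the Wasserstein metric\<close>

lemma topspace_wp: "topspace (wp_top p) = (Pp p :: 'a measure set)"
  by (simp add: wp_top_def)

lemma openin_wp:
  "openin (wp_top p) U \<longleftrightarrow> U \<subseteq> Pp p \<and> (\<forall>\<mu>\<in>U. \<exists>r>0. \<forall>\<nu>\<in>Pp p. wass p \<mu> \<nu> < r \<longrightarrow> \<nu> \<in> (U :: 'a measure set))"
  unfolding wp_top_def W.openin_mtopology by (fastforce simp: subset_iff)

lemma distr_const_return:
  assumes "\<mu> \<in> Prob" shows "distr \<mu> borel (\<lambda>_. a) = return borel (a :: 'a)"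
proof (rule measure_eqI)
  interpret prob_space \<mu> by (rule ProbD[OF assms])
  fix A :: "'a set" assume A: "A \<in> sets (distr \<mu> borel (\<lambda>_. a))"
  show "emeasure (distr \<mu> borel (\<lambda>_. a)) A = emeasure (return borel a) A"
    using A emeasure_space_1 by (cases "a \<in> A") (auto simp: emeasure_distr)
qed simp

lemma wass_return_le:
  fixes a :: 'a
  assumes \<mu>: "\<mu> \<in> Prob" and L: "Lp_le p \<mu> (\<lambda>x. dist x a) C"
  shows "wass p (return borel a) \<mu> \<le> (C :: real)"
proof -
  have "distr \<mu> borel (\<lambda>x. x) = \<mu>" by (rule distr_id2) (simp add: ProbD[OF \<mu>])
  then show ?thesis
    using wass_distr_le[OF ProbD(1)[OF \<mu>], of "\<lambda>_. a" "\<lambda>x. x" C] L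
    by (simp add: distr_const_return[OF \<mu>] measurable_Prob_cong[OF \<mu>] dist_commute)
qed

lemma dist_Lip: "\<bar>dist x a - dist y a\<bar> \<le> dist x (y :: 'a)"
  using dist_triangle[of x a y] dist_triangle[of y a x] by (simp add: abs_le_iff dist_commute)

lemma wp_bounded_iff:
  "wp_bounded p S \<longleftrightarrow> (\<exists>C. S \<subseteq> moment_ball p (a :: 'a) C)"
proof
  assume "wp_bounded p S"
  then have "W.mbounded S" by (simp add: wp_bounded_def)
  then obtain \<nu> B where B: "S \<subseteq> W.mcball \<nu> B" unfolding W.mbounded_def by blast
  show "\<exists>C. S \<subseteq> moment_ball p a C"
  proof (cases "S = {}")
    case False
    then have \<nu>: "\<nu> \<in> Pp p" using B by auto
    then obtain c where c: "Lp_le p \<nu> (\<lambda>x. dist x a) c" using in_Pp_iff[OF p] by blast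
    have "\<mu> \<in> moment_ball p a (c + B)" if "\<mu> \<in> S" for \<mu>
    proof -
      have \<mu>: "\<mu> \<in> Pp p" "wass p \<mu> \<nu> \<le> B" using B that wass_commute[of p \<nu> \<mu>] by auto
      show ?thesis
        using Lp_le_wass[OF p \<mu>(1) \<nu> dist_Lip _ c \<mu>(2)] Pp_Prob[OF \<mu>(1)] by (simp add: moment_ball_def)
    qed
    then show ?thesis by blast
  qed auto
next
  assume "\<exists>C. S \<subseteq> moment_ball p a C"
  then obtain C where C: "S \<subseteq> moment_ball p a C" ..
  have "S \<subseteq> W.mcball (return borel a) C"
  proof
    fix \<mu> assume "\<mu> \<in> S"
    then have "\<mu> \<in> Pp p" "\<mu> \<in> Prob" "Lp_le p \<mu> (\<lambda>x. dist x a) C"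
      using C moment_ball_Pp[OF p, of a C] by (auto simp: moment_ball_def)
    then show "\<mu> \<in> W.mcball (return borel a) C"
      using wass_return_le by (simp add: return_in_Pp[OF p])
  qed
  then show "wp_bounded p S" unfolding wp_bounded_def W.mbounded_def by blast
qed

text \<open>If the bound fails at \<open>\<mu>\<close>, it fails with some slack
  \<open>\<delta>\<close>, and the Lipschitz estimate keeps it failing at distance less than
  \<open>\<delta> / (real n + 1)\<close>.\<close>

lemma closedin_Lp_le_Lipschitz:
  fixes h :: "'a \<Rightarrow> real"
  assumes h: "\<And>x y. \<bar>h x - h y\<bar> \<le> real n * dist x y" "\<And>x. 0 \<le> h x" and C: "0 \<le> C"
  shows "closedin (wp_top p) {\<mu> \<in> Pp p. Lp_le p \<mu> h C}"
proof -
  have "\<exists>r>0. \<forall>\<nu>\<in>Pp p. wass p \<mu> \<nu> < r \<longrightarrow> \<not> Lp_le p \<nu> h C" if \<mu>: "\<mu> \<in> Pp p" "\<not> Lp_le p \<mu> h C" for \<mu>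
  proof -
    obtain \<delta> where \<delta>: "0 < \<delta>" "\<not> Lp_le p \<mu> h (C + \<delta>)" using Lp_le_limit[OF p C] \<mu>(2) by blast
    have "Lp_le p \<mu> h (C + \<delta>)" if \<nu>: "\<nu> \<in> Pp p" "wass p \<mu> \<nu> < \<delta> / (real n + 1)" "Lp_le p \<nu> h C" for \<nu>
      by (rule Lp_le_mono[OF p Lp_le_wass_Lipschitz[OF p \<mu>(1) \<nu>(1) h _ \<nu>(3,2)]])
         (use \<delta>(1) h(2) in \<open>auto simp: divide_simps algebra_simps\<close>)
    then show ?thesis using \<delta> by (intro exI[of _ "\<delta> / (real n + 1)"]) auto
  qed
  then have "openin (wp_top p) (Pp p - {\<mu> \<in> Pp p. Lp_le p \<mu> h C})"
    unfolding openin_wp by auto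
  then show ?thesis by (auto simp: closedin_def topspace_wp)
qed

text \<open>By monotone convergence the bound for \<open>h\<close> is the conjunction of the bounds
  for all \<open>inf_conv h n\<close>, so the set is an intersection of closed sets.\<close>

lemma closedin_Lp_le:
  fixes h :: "'a \<Rightarrow> real"
  assumes h: "continuous_on UNIV h" "\<And>x. 0 \<le> h x" and C: "0 \<le> C"
  shows "closedin (wp_top p) {\<mu> \<in> Pp p. Lp_le p \<mu> h C}"
proof -
  have "Lp_le p \<mu> h C \<longleftrightarrow> (\<forall>n. Lp_le p \<mu> (inf_conv h n) C)" if \<mu>: "\<mu> \<in> Pp p" for \<mu>
  proof
    assume *: "Lp_le p \<mu> h C"
    show "\<forall>n. Lp_le p \<mu> (inf_conv h n) C"
    proof
      fix n
      have "inf_conv h n x \<le> h x" for x using inf_conv_le[of h, OF h(2), of n x x] by simp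
      then show "Lp_le p \<mu> (inf_conv h n) C"
        by (rule Lp_le_mono[OF p * inf_conv_nonneg[of h, OF h(2)]]) simp
    qed
  next
    assume *: "\<forall>n. Lp_le p \<mu> (inf_conv h n) C"
    have m: "inf_conv h n \<in> borel_measurable \<mu>" for n
      unfolding measurable_Prob_cong[OF Pp_Prob[OF \<mu>]]
      by (rule borel_measurable_Lipschitz[OF inf_conv_Lipschitz[of h, OF h(2)]])
    have "(\<lambda>n. \<integral>\<^sup>+ x. ennreal (inf_conv h n x powr p) \<partial>\<mu>) \<longlonglongrightarrow> (\<integral>\<^sup>+ x. ennreal (h x powr p) \<partial>\<mu>)"
    proof (rule nn_integral_LIMSEQ)
      show "incseq (\<lambda>n x. ennreal (inf_conv h n x powr p))"
        using p by (auto simp: incseq_def le_fun_def intro!: ennreal_leI powr_mono2 inf_conv_mono[of h, OF h(2)] inf_conv_nonneg[of h, OF h(2)])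
      show "(\<lambda>n. ennreal (inf_conv h n x powr p)) \<longlonglongrightarrow> ennreal (h x powr p)" for x
        using p by (intro tendsto_ennrealI tendsto_powr' inf_conv_tendsto[of h, OF h(2) h(1)] tendsto_const)
          (auto simp: inf_conv_nonneg[of h, OF h(2)])
    qed (use m in measurable)
    then have "(\<integral>\<^sup>+ x. ennreal (h x powr p) \<partial>\<mu>) \<le> ennreal (C powr p)"
      by (rule LIMSEQ_le_const2) (use * in \<open>auto simp: Lp_le_def\<close>)
    then show "Lp_le p \<mu> h C" using C by (simp add: Lp_le_def)
  qed
  then have "{\<mu> \<in> Pp p. Lp_le p \<mu> h C} = (\<Inter>n. {\<mu> \<in> Pp p. Lp_le p \<mu> (inf_conv h n) C})" by auto
  moreover have "closedin (wp_top p) {\<mu> \<in> Pp p. Lp_le p \<mu> (inf_conv h n) C}" for n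
    by (rule closedin_Lp_le_Lipschitz[OF inf_conv_Lipschitz[of h, OF h(2)] inf_conv_nonneg[of h, OF h(2)] C])
  then have "closedin (wp_top p) (\<Inter>n. {\<mu> \<in> Pp p. Lp_le p \<mu> (inf_conv h n) C})"
    by (intro closedin_INT) auto
  ultimately show ?thesis by simp
qed

text \<open>With \<open>H\<close> bounding \<open>g\<close>, the integral of \<open>g\<close> is at
  most \<open>c\<close> iff the norm of \<open>h = (g + H) powr (1/p)\<close> is at most
  \<open>(c + H) powr (1/p)\<close>. This turns integrals into norms that \<open>wass\<close>
  controls; applied to \<open>g\<close> and to its negative it gives both semicontinuities.\<close>

lemma continuous_map_wp_integral:
  fixes g :: "'a \<Rightarrow> real"
  assumes g: "bounded_continuous g"
  shows "continuous_map (wp_top p) euclideanreal (\<lambda>\<mu>. \<integral>x. g x \<partial>\<mu>)"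
proof -
  have cl: "closedin (wp_top p) {\<mu> \<in> Pp p. (\<integral>x. g x \<partial>\<mu>) \<le> c}" if g: "bounded_continuous g" for g :: "'a \<Rightarrow> real" and c
  proof -
    obtain H where H: "0 < H" "\<And>x. \<bar>g x\<bar> \<le> H" using bounded_continuousD[OF g] by blast
    have gH: "0 \<le> g x + H" for x using H(2)[of x] by linarith
    define h where "h x = (g x + H) powr (1/p)" for x
    have hp: "h x powr p = g x + H" for x using p gH by (simp add: h_def powr_powr)
    have int: "(\<integral>\<^sup>+ x. ennreal (h x powr p) \<partial>\<mu>) = ennreal ((\<integral>x. g x \<partial>\<mu>) + H)" "0 \<le> (\<integral>x. g x \<partial>\<mu>) + H"
      if \<mu>: "\<mu> \<in> Pp p" for \<mu>
    proof -
      interpret prob_space \<mu> by (rule ProbD[OF Pp_Prob[OF \<mu>]])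
      have i: "integrable \<mu> g" by (rule integrable_bounded_continuous[OF g Pp_Prob[OF \<mu>]])
      then have e: "(\<integral>x. g x + H \<partial>\<mu>) = (\<integral>x. g x \<partial>\<mu>) + H" by (simp add: prob_space)
      have "0 \<le> (\<integral>x. g x + H \<partial>\<mu>)" using gH by simp
      then show "0 \<le> (\<integral>x. g x \<partial>\<mu>) + H" by (simp only: e)
      have "(\<integral>\<^sup>+ x. ennreal (g x + H) \<partial>\<mu>) = ennreal (\<integral>x. g x + H \<partial>\<mu>)"
        by (rule nn_integral_eq_integral) (use i gH in auto)
      then show "(\<integral>\<^sup>+ x. ennreal (h x powr p) \<partial>\<mu>) = ennreal ((\<integral>x. g x \<partial>\<mu>) + H)" by (simp only: hp e)
    qed
    show ?thesis
    proof (cases "0 \<le> c + H")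
      case True
      define C where "C = (c + H) powr (1/p)"
      have Cp: "C powr p = c + H" "0 \<le> C" using p True by (auto simp: C_def powr_powr)
      have "Lp_le p \<mu> h C \<longleftrightarrow> (\<integral>x. g x \<partial>\<mu>) \<le> c" if \<mu>: "\<mu> \<in> Pp p" for \<mu>
        using int[OF \<mu>] Cp True by (simp add: Lp_le_def ennreal_le_iff)
      then have "{\<mu> \<in> Pp p. (\<integral>x. g x \<partial>\<mu>) \<le> c} = {\<mu> \<in> Pp p. Lp_le p \<mu> h C}" by auto
      moreover have "closedin (wp_top p) \<dots>"
      proof (rule closedin_Lp_le)
        show "continuous_on UNIV h"
          unfolding h_def using g gH p by (intro continuous_on_powr' continuous_intros) auto
      qed (auto simp: h_def Cp)
      ultimately show ?thesis by simp
    next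
      case False
      have "{\<mu> \<in> Pp p. (\<integral>x. g x \<partial>\<mu>) \<le> c} = {}"
      proof (intro equals0I, elim CollectE conjE)
        fix \<mu> assume "\<mu> \<in> Pp p" "(\<integral>x. g x \<partial>\<mu>) \<le> c"
        then show False using int(2)[of \<mu>] False by linarith
      qed
      then show ?thesis by (simp only: closedin_empty)
    qed
  qed
  have "bounded_continuous (\<lambda>x. - g x)"
    using g by (auto intro: continuous_intros simp: bounded_iff)
  from cl[OF this] have "closedin (wp_top p) {\<mu> \<in> Pp p. c \<le> (\<integral>x. g x \<partial>\<mu>)}" for c
    using \<open>\<And>c. closedin (wp_top p) {\<mu> \<in> Pp p. (\<integral>x. - g x \<partial>\<mu>) \<le> c}\<close>[of "- c"] by simp
  with cl[OF g] show ?thesis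
    unfolding continuous_map_upper_lower_semicontinuous_le topspace_wp by simp
qed

lemma continuous_map_return: "continuous_map euclidean (wp_top p) (\<lambda>x::'a. return borel x)"
proof -
  have w: "wass p (return borel x) (return borel y) \<le> dist x y" for x y :: 'a
    by (intro wass_return_le return_in_Prob) (simp add: Lp_le_return[OF p] dist_commute)
  have "open {x. return borel x \<in> U}" if U: "openin (wp_top p) U" for U :: "'a measure set"
    unfolding open_contains_ball
  proof
    fix x assume "x \<in> {x. return borel x \<in> U}"
    then obtain r where r: "r > 0" "\<forall>\<nu>\<in>Pp p. wass p (return borel x) \<nu> < r \<longrightarrow> \<nu> \<in> U"
      using U unfolding openin_wp by blast
    have "ball x r \<subseteq> {x. return borel x \<in> U}"
    proof
      fix y assume "y \<in> ball x r"
      then have "wass p (return borel x) (return borel y) < r" using w[of x y] by simp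
      then show "y \<in> {x. return borel x \<in> U}" using r(2) return_in_Pp[OF p] by blast
    qed
    then show "\<exists>e>0. ball x e \<subseteq> {x. return borel x \<in> U}" using r(1) by blast
  qed
  then show ?thesis
    by (auto simp: continuous_map_def topspace_wp return_in_Pp[OF p])
qed

end

section \<open>Mixtures with a Dirac mass\<close>

context wass_space
begin

text \<open>The weight is parametrised as \<open>\<tau>\<^sup>p\<close> because \<open>\<tau>\<close> is the factor by which \<open>p\<close>-costs scale.\<close>

definition coin :: "real \<Rightarrow> 'a measure \<Rightarrow> (bool \<times> 'a) measure" where
  "coin \<tau> k = measure_pmf (bernoulli_pmf (\<tau> powr p)) \<Otimes>\<^sub>M k"

text \<open>The law with weight \<open>\<tau> powr p\<close> at \<open>x\<close> and the remaining
  weight on \<open>k\<close>. As mixtures for different \<open>x\<close>, and \<open>k\<close>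
  itself through \<open>snd\<close>, are functions on one space \<open>coin\<close>, they come
  already coupled.\<close>

definition mixt :: "real \<Rightarrow> 'a measure \<Rightarrow> 'a \<Rightarrow> 'a measure" where
  "mixt \<tau> k x = distr (coin \<tau> k) borel (\<lambda>z. if fst z then x else snd z)"

context
  fixes \<tau> :: real and k :: "'a measure"
  assumes \<tau>: "0 \<le> \<tau>" "\<tau> \<le> 1" and k: "k \<in> Prob"
begin

lemma weight: "0 \<le> \<tau> powr p" "\<tau> powr p \<le> 1"
  using \<tau> p powr_le1[of p \<tau>] by simp_all

lemma prob_space_coin: "prob_space (coin \<tau> k)"
proof -
  interpret k: prob_space k by (rule ProbD[OF k])
  interpret pair_prob_space "measure_pmf (bernoulli_pmf (\<tau> powr p))" k ..
  show ?thesis unfolding coin_def by unfold_locales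
qed

lemma measurable_coin_snd: "snd \<in> measurable (coin \<tau> k) borel"
proof -
  have "measurable (coin \<tau> k) k = measurable (coin \<tau> k) borel"
    by (rule measurable_cong_sets[OF refl ProbD(2)[OF k]])
  then show ?thesis using measurable_snd unfolding coin_def by blast
qed

lemma measurable_coin_if:
  assumes "u \<in> measurable borel N" "v \<in> measurable borel N"
  shows "(\<lambda>z. if fst z then u (snd z) else v (snd z)) \<in> measurable (coin \<tau> k) N"
proof (rule measurable_If)
  show "(\<lambda>z. u (snd z)) \<in> measurable (coin \<tau> k) N" "(\<lambda>z. v (snd z)) \<in> measurable (coin \<tau> k) N"
    using assms by (auto intro: measurable_compose[OF measurable_coin_snd])
  have "fst -` {True} \<inter> space (coin \<tau> k) \<in> sets (coin \<tau> k)"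
    unfolding coin_def by (rule measurable_sets[OF measurable_fst]) simp
  then show "{z \<in> space (coin \<tau> k). fst z} \<in> sets (coin \<tau> k)"
    by (simp add: vimage_def Int_def conj_commute)
qed

lemma nn_integral_coin:
  assumes "u \<in> borel_measurable borel" "v \<in> borel_measurable borel"
  shows "(\<integral>\<^sup>+ z. (if fst z then u (snd z) else v (snd z)) \<partial>coin \<tau> k) =
    (\<integral>\<^sup>+ z. u z \<partial>k) * ennreal (\<tau> powr p) + (\<integral>\<^sup>+ z. v z \<partial>k) * ennreal (1 - \<tau> powr p)"
proof -
  interpret k: prob_space k by (rule ProbD[OF k])
  have "(\<integral>\<^sup>+ z. (if fst z then u (snd z) else v (snd z)) \<partial>coin \<tau> k) =
     (\<integral>\<^sup>+ b. \<integral>\<^sup>+ z. (if b then u z else v z) \<partial>k \<partial>measure_pmf (bernoulli_pmf (\<tau> powr p)))"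
    using measurable_coin_if[OF assms] unfolding coin_def by (subst k.nn_integral_fst[symmetric]) (auto cong: if_cong)
  also have "\<dots> = (\<integral>\<^sup>+ z. u z \<partial>k) * ennreal (\<tau> powr p) + (\<integral>\<^sup>+ z. v z \<partial>k) * ennreal (1 - \<tau> powr p)"
    by (subst nn_integral_bernoulli_pmf) (auto simp: weight)
  finally show ?thesis .
qed

lemma distr_coin_snd: "distr (coin \<tau> k) borel snd = k"
proof (rule measure_eqI)
  fix A assume "A \<in> sets (distr (coin \<tau> k) borel snd)"
  then have A: "A \<in> sets borel" by simp
  have "emeasure (distr (coin \<tau> k) borel snd) A = (\<integral>\<^sup>+ z. indicator A z \<partial>distr (coin \<tau> k) borel snd)"
    using A by simp
  also have "\<dots> = (\<integral>\<^sup>+ z. (if fst z then indicator A (snd z) else indicator A (snd z)) \<partial>coin \<tau> k)"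
    using A by (subst nn_integral_distr[OF measurable_coin_snd]) auto
  also have "\<dots> = emeasure k A * ennreal (\<tau> powr p) + emeasure k A * ennreal (1 - \<tau> powr p)"
    using A by (subst nn_integral_coin) (auto simp: ProbD[OF k])
  also have "\<dots> = emeasure k A"
    using weight by (simp flip: distrib_left ennreal_plus)
  finally show "emeasure (distr (coin \<tau> k) borel snd) A = emeasure k A" .
qed (simp add: ProbD[OF k])

text \<open>Restriction to an independent event of probability \<open>\<tau> powr p\<close> scales
  the norm by \<open>\<tau>\<close>.\<close>

lemma Lp_le_coin:
  assumes "Lp_le p k u c" "u \<in> borel_measurable borel" "\<And>z. 0 \<le> u z"
  shows "Lp_le p (coin \<tau> k) (\<lambda>z. if fst z then u (snd z) else 0) (\<tau> * c)"
proof -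
  have "(\<integral>\<^sup>+ z. ennreal ((if fst z then u (snd z) else 0) powr p) \<partial>coin \<tau> k)
      = (\<integral>\<^sup>+ z. (if fst z then ennreal (u (snd z) powr p) else 0) \<partial>coin \<tau> k)"
    by (intro nn_integral_cong) simp
  also have "\<dots> = (\<integral>\<^sup>+ z. ennreal (u z powr p) \<partial>k) * ennreal (\<tau> powr p)"
    using assms(2) by (subst nn_integral_coin) auto
  also have "\<dots> \<le> ennreal (c powr p) * ennreal (\<tau> powr p)"
    using assms(1) by (intro mult_right_mono) (auto simp: Lp_le_def)
  also have "\<dots> = ennreal ((\<tau> * c) powr p)"
    using \<tau> Lp_le_nonneg[OF assms(1)] by (simp add: powr_mult mult.commute flip: ennreal_mult)
  finally show ?thesis using \<tau> Lp_le_nonneg[OF assms(1)] by (simp add: Lp_le_def)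
qed

lemma measurable_mixt: "(\<lambda>z. if fst z then x else snd z) \<in> measurable (coin \<tau> k) borel"
  by (rule measurable_coin_if[of "\<lambda>_. x" borel "\<lambda>z. z"]) simp_all

lemma mixt_Prob: "mixt \<tau> k x \<in> Prob"
  unfolding mixt_def Prob_def using prob_space.prob_space_distr[OF prob_space_coin measurable_mixt] by simp

lemma Lp_le_mixt:
  assumes "Lp_le p k h c" "h \<in> borel_measurable borel" "\<And>z. 0 \<le> h z"
  shows "Lp_le p (mixt \<tau> k x) h (c + \<tau> * h x)"
proof -
  have 1: "Lp_le p (coin \<tau> k) (\<lambda>z. h (snd z)) c"
    using assms Lp_le_distr[OF measurable_coin_snd assms(2)] by (simp add: distr_coin_snd)
  have 2: "Lp_le p (coin \<tau> k) (\<lambda>z. if fst z then h x else 0) (\<tau> * h x)"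
    using assms(3) by (intro Lp_le_coin[of "\<lambda>_. h x"] Lp_le_const ProbD[OF k]) auto
  have "Lp_le p (coin \<tau> k) (\<lambda>z. h (snd z) + (if fst z then h x else 0)) (c + \<tau> * h x)"
    using assms(3) measurable_compose[OF measurable_coin_snd assms(2)] measurable_coin_if[of "\<lambda>_. h x" borel "\<lambda>_. 0"]
    by (intro Lp_le_add[OF p 1 2]) auto
  then have "Lp_le p (coin \<tau> k) (\<lambda>z. h (if fst z then x else snd z)) (c + \<tau> * h x)"
    by (rule Lp_le_mono[OF p]) (use assms(3) in auto)
  then show ?thesis unfolding mixt_def by (simp add: Lp_le_distr[OF measurable_mixt assms(2)])
qed

text \<open>The atom at \<open>x\<close> alone contributes \<open>(\<tau> * h x) powr p\<close>.
  This converts norm bounds on mixtures into pointwise bounds on \<open>h\<close>.\<close>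

lemma Lp_le_mixtD:
  assumes "Lp_le p (mixt \<tau> k x) h B" "h \<in> borel_measurable borel" "0 \<le> h x"
  shows "\<tau> * h x \<le> B"
proof -
  interpret k: prob_space k by (rule ProbD[OF k])
  have "ennreal ((\<tau> * h x) powr p) = (\<integral>\<^sup>+ z. ennreal (h x powr p) \<partial>k) * ennreal (\<tau> powr p)"
    using \<tau> assms(3) by (simp add: k.emeasure_space_1 powr_mult ennreal_mult mult.commute)
  also have "\<dots> \<le> (\<integral>\<^sup>+ z. (if fst z then ennreal (h x powr p) else ennreal (h (snd z) powr p)) \<partial>coin \<tau> k)"
    using assms(2) by (subst nn_integral_coin) (auto simp: add_increasing2)
  also have "\<dots> = (\<integral>\<^sup>+ z. ennreal (h (if fst z then x else snd z) powr p) \<partial>coin \<tau> k)"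
    by (intro nn_integral_cong) simp
  also have "\<dots> = (\<integral>\<^sup>+ z. ennreal (h z powr p) \<partial>mixt \<tau> k x)"
    unfolding mixt_def using assms(2) by (subst nn_integral_distr[OF measurable_mixt]) auto
  also have "\<dots> \<le> ennreal (B powr p)" using assms(1) by (simp add: Lp_le_def)
  finally have "(\<tau> * h x) powr p \<le> B powr p" by simp
  moreover have "B powr p < (\<tau> * h x) powr p" if "B < \<tau> * h x"
    using that p Lp_le_nonneg[OF assms(1)] by (intro powr_less_mono2) auto
  ultimately show ?thesis by (meson not_le)
qed

lemma wass_mixt_base:
  assumes "Lp_le p k (\<lambda>z. dist z x) c"
  shows "wass p k (mixt \<tau> k x) \<le> \<tau> * c"
proof -
  have "Lp_le p (coin \<tau> k) (\<lambda>z. if fst z then dist (snd z) x else 0) (\<tau> * c)"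
    by (rule Lp_le_coin[OF assms]) auto
  moreover have "(\<lambda>z. if fst z then dist (snd z) x else 0) = (\<lambda>z. dist (snd z) (if fst z then x else snd z))" by auto
  ultimately have "wass p (distr (coin \<tau> k) borel snd) (mixt \<tau> k x) \<le> \<tau> * c"
    unfolding mixt_def by (intro wass_distr_le prob_space_coin measurable_coin_snd measurable_mixt) simp
  then show ?thesis by (simp add: distr_coin_snd)
qed

lemma wass_mixt_mixt: "wass p (mixt \<tau> k x) (mixt \<tau> k y) \<le> \<tau> * dist x y"
proof -
  have "Lp_le p (coin \<tau> k) (\<lambda>z. if fst z then dist x y else 0) (\<tau> * dist x y)"
    by (rule Lp_le_coin[of "\<lambda>_. dist x y"]) (auto intro!: Lp_le_const ProbD[OF k])
  moreover have "(\<lambda>z. if fst z then dist x y else 0) =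
      (\<lambda>z. dist (if fst z then x else snd z) (if fst z then y else snd z))" by auto
  ultimately show ?thesis
    unfolding mixt_def by (intro wass_distr_le prob_space_coin measurable_mixt) simp
qed

end

lemma mixt_Pp:
  assumes "0 \<le> \<tau>" "\<tau> \<le> 1" "k \<in> Pp p" shows "mixt \<tau> k x \<in> Pp p"
proof -
  obtain c where "Lp_le p k (\<lambda>z. dist z x) c" using assms(3) in_Pp_iff[OF p] by blast
  then have "Lp_le p (mixt \<tau> k x) (\<lambda>z. dist z x) (c + \<tau> * dist x x)"
    using assms by (intro Lp_le_mixt) (auto simp: Pp_Prob)
  then show ?thesis using mixt_Prob[OF assms(1,2) Pp_Prob[OF assms(3)]] in_Pp_iff[OF p] by blast
qed

text \<open>A 1-Lipschitz measure of excess over radius \<open>D\<close>: a small norm of it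
  expresses uniform \<open>p\<close>-integrability and is stable under small \<open>wass\<close>
  perturbations.\<close>

definition tail :: "'a \<Rightarrow> real \<Rightarrow> 'a \<Rightarrow> real" where
  "tail a D x = max 0 (dist x a - D)"

lemma tail_Lip: "\<bar>tail a D x - tail a D y\<bar> \<le> dist x y"
  using dist_Lip[of x a y] unfolding tail_def by linarith

lemma tail_measurable [measurable]: "tail a D \<in> borel_measurable borel"
  unfolding tail_def by measurable

lemma tail_nonneg: "0 \<le> tail a D x"
  by (simp add: tail_def)

lemma eventually_small_tail:
  assumes \<mu>: "\<mu> \<in> Pp p" and \<eta>: "0 < \<eta>"
  shows "\<exists>n::nat. Lp_le p \<mu> (tail a (real n)) \<eta>"
proof -
  obtain B where B: "Lp_le p \<mu> (\<lambda>x. dist x a) B" using \<mu> in_Pp_iff[OF p] by blast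
  have m: "measurable \<mu> N = measurable borel N" for N :: "ennreal measure"
    by (rule measurable_Prob_cong[OF Pp_Prob[OF \<mu>]])
  have "(\<lambda>n. \<integral>\<^sup>+ x. ennreal (tail a (real n) x powr p) \<partial>\<mu>) \<longlonglongrightarrow> (\<integral>\<^sup>+ x. 0 \<partial>\<mu>)"
  proof (rule nn_integral_dominated_convergence[where w="\<lambda>x. ennreal (dist x a powr p)"])
    show "(\<integral>\<^sup>+ x. ennreal (dist x a powr p) \<partial>\<mu>) < \<infinity>"
      using B by (auto simp: Lp_le_def elim: order_le_less_trans)
    show "AE x in \<mu>. ennreal (tail a (real n) x powr p) \<le> ennreal (dist x a powr p)" for n
      using p by (intro AE_I2 ennreal_leI powr_mono2) (auto simp: tail_def)
    show "AE x in \<mu>. (\<lambda>n. ennreal (tail a (real n) x powr p)) \<longlonglongrightarrow> 0"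
    proof (intro AE_I2 tendsto_eventually)
      fix x
      obtain N :: nat where "dist x a \<le> real N" using real_arch_simple by blast
      then show "\<forall>\<^sub>F n in sequentially. ennreal (tail a (real n) x powr p) = 0"
        by (auto simp: eventually_sequentially tail_def intro!: exI[of _ N])
    qed
  qed (auto simp: m)
  moreover have "(0::ennreal) < ennreal (\<eta> powr p)" using \<eta> by simp
  ultimately have "\<forall>\<^sub>F n in sequentially. (\<integral>\<^sup>+ x. ennreal (tail a (real n) x powr p) \<partial>\<mu>) < ennreal (\<eta> powr p)"
    unfolding nn_integral_const mult_zero_left by (rule order_tendstoD(2))
  then obtain n where "(\<integral>\<^sup>+ x. ennreal (tail a (real n) x powr p) \<partial>\<mu>) < ennreal (\<eta> powr p)"
    by (auto simp: eventually_sequentially)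
  then show ?thesis using \<eta> by (intro exI[of _ n]) (auto simp: Lp_le_def)
qed

lemma openin_Lp_less:
  assumes h: "\<And>x y. \<bar>h x - h y\<bar> \<le> dist x (y::'a)" "\<And>x. 0 \<le> h x"
  shows "openin (wp_top p) {\<mu> \<in> Pp p. \<exists>c<\<eta>. Lp_le p \<mu> h c}"
  unfolding openin_wp
proof (intro conjI ballI)
  fix \<mu> assume "\<mu> \<in> {\<mu> \<in> Pp p. \<exists>c<\<eta>. Lp_le p \<mu> h c}"
  then obtain c where c: "\<mu> \<in> Pp p" "c < \<eta>" "Lp_le p \<mu> h c" by auto
  show "\<exists>r>0. \<forall>\<nu>\<in>Pp p. wass p \<mu> \<nu> < r \<longrightarrow> \<nu> \<in> {\<mu> \<in> Pp p. \<exists>c<\<eta>. Lp_le p \<mu> h c}"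
  proof (intro exI[of _ "\<eta> - c"] conjI ballI impI)
    fix \<nu> assume \<nu>: "\<nu> \<in> Pp p" "wass p \<mu> \<nu> < \<eta> - c"
    have "Lp_le p \<nu> h (c + wass p \<nu> \<mu>)"
      by (rule Lp_le_wass[OF p \<nu>(1) c(1) h c(3)]) simp
    moreover have "c + wass p \<nu> \<mu> < \<eta>" using \<nu>(2) wass_commute[of p \<mu> \<nu>] by simp
    ultimately show "\<nu> \<in> {\<mu> \<in> Pp p. \<exists>c<\<eta>. Lp_le p \<mu> h c}" using \<nu>(1) by auto
  qed (use c in simp)
qed auto

text \<open>A Dini argument: each measure has small tails beyond some radius, the sets where a given
  radius works strictly are open, and a finite subcover gives a common radius.\<close>

lemma compact_uniform_tail:
  assumes K: "compactin (wp_top p) K" and \<eta>: "0 < \<eta>"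
  shows "\<exists>D\<ge>0. \<forall>k\<in>K. Lp_le p k (tail a D) \<eta>"
proof -
  have KP: "K \<subseteq> Pp p" using compactin_subset_topspace[OF K] by (simp add: topspace_wp)
  define U where "U n = {\<mu> \<in> Pp p. \<exists>c<\<eta>. Lp_le p \<mu> (tail a (real n)) c}" for n :: nat
  have opn: "openin (wp_top p) (U n)" for n
    unfolding U_def by (rule openin_Lp_less[OF tail_Lip tail_nonneg])
  have "K \<subseteq> \<Union>(range U)"
  proof
    fix k assume "k \<in> K"
    then obtain n :: nat where "Lp_le p k (tail a (real n)) (\<eta>/2)"
      using eventually_small_tail[of k "\<eta>/2" a] KP \<eta> by auto
    moreover have "\<eta>/2 < \<eta>" using \<eta> by simp
    ultimately have "k \<in> U n" using \<open>k \<in> K\<close> KP unfolding U_def by blast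
    then show "k \<in> \<Union>(range U)" by blast
  qed
  then obtain \<F> where \<F>: "finite \<F>" "\<F> \<subseteq> range U" "K \<subseteq> \<Union>\<F>"
    using compactinD[OF K, of "range U"] opn by blast
  obtain I where I: "finite I" "\<F> = U ` I" using finite_subset_image[OF \<F>(1,2)] by blast
  define D where "D = real (Max (insert 0 I))"
  have "Lp_le p k (tail a D) \<eta>" if "k \<in> K" for k
  proof -
    obtain n where n: "n \<in> I" "k \<in> U n" using \<F>(3) I(2) \<open>k \<in> K\<close> by blast
    then obtain c where c: "c < \<eta>" "Lp_le p k (tail a (real n)) c" by (auto simp: U_def)
    have "real n \<le> D" using n(1) I(1) by (simp add: D_def)
    then show ?thesis
      using c(1) by (intro Lp_le_mono[OF p c(2)]) (auto simp: tail_def)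
  qed
  then show ?thesis by (intro exI[of _ D]) (auto simp: D_def)
qed

end

section \<open>Growth of the map\<close>

locale attractor_map = wass_space +
  fixes f :: "'a \<Rightarrow> 'a" and K :: "'a measure set" and a :: 'a
  assumes f_cont: "continuous_on UNIV f"
    and push_self: "(\<lambda>\<mu>. distr \<mu> borel f) ` Pp p \<subseteq> Pp p"
    and attr: "global_attractor p (\<lambda>\<mu>. distr \<mu> borel f) K"
    and unif: "\<exists>U V. openin (wp_top p) V \<and> K \<subseteq> V \<and> V \<subseteq> U \<and> U \<subseteq> Pp p \<and>
                 (\<forall>\<epsilon>>0. \<exists>\<delta>>0. \<forall>\<mu>\<in>U. \<forall>\<nu>\<in>U. wass p \<mu> \<nu> < \<delta> \<longrightarrow>
                    wass p (distr \<mu> borel f) (distr \<nu> borel f) < \<epsilon>)"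
begin

lemma f_measurable [measurable]: "f \<in> borel_measurable borel"
  by (rule borel_measurable_continuous_onI[OF f_cont])

lemma f_Prob_measurable: "\<mu> \<in> Prob \<Longrightarrow> f \<in> measurable \<mu> borel"
  by (simp add: measurable_Prob_cong)

lemma funpow_measurable: "f ^^ j \<in> borel_measurable borel"
  by (induction j) (auto simp: id_def intro: measurable_comp)

lemma push_Pp: "\<mu> \<in> Pp p \<Longrightarrow> distr \<mu> borel f \<in> Pp p"
  using push_self by blast

lemma funpow_push:
  assumes "\<mu> \<in> Pp p"
  shows "((\<lambda>\<mu>. distr \<mu> borel f) ^^ j) \<mu> = distr \<mu> borel (f ^^ j)"
    and "((\<lambda>\<mu>. distr \<mu> borel f) ^^ j) \<mu> \<in> Pp p"
proof -
  show "((\<lambda>\<mu>. distr \<mu> borel f) ^^ j) \<mu> \<in> Pp p"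
    using assms by (induction j) (auto simp: push_Pp)
  have m: "f ^^ j \<in> measurable \<mu> borel" for j
    using funpow_measurable by (simp add: measurable_Prob_cong[OF Pp_Prob[OF assms]])
  show "((\<lambda>\<mu>. distr \<mu> borel f) ^^ j) \<mu> = distr \<mu> borel (f ^^ j)"
  proof (induction j)
    case 0
    have "distr \<mu> borel (\<lambda>x. x) = \<mu>" by (rule distr_id2) (simp add: ProbD[OF Pp_Prob[OF assms]])
    then show ?case by (simp add: id_def)
  next
    case (Suc j)
    have "distr (distr \<mu> borel (f ^^ j)) borel f = distr \<mu> borel (f \<circ> f ^^ j)"
      by (rule distr_distr) (use m in auto)
    then show ?case using Suc by (simp add: o_def)
  qed
qed

lemma K_Pp: "K \<subseteq> Pp p" and K_compact: "compactin (wp_top p) K"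
  and K_invariant: "(\<lambda>\<mu>. distr \<mu> borel f) ` K = K"
  using attr by (auto simp: global_attractor_def)

lemma attracts_moment_ball:
  assumes "0 < \<epsilon>"
  shows "\<exists>N. \<forall>n\<ge>N. \<forall>\<mu>\<in>moment_ball p a C. \<exists>k\<in>K. wass p (((\<lambda>\<mu>. distr \<mu> borel f) ^^ n) \<mu>) k < \<epsilon>"
proof -
  have "moment_ball p a C \<subseteq> Pp p \<and> wp_bounded p (moment_ball p a C)"
    using moment_ball_Pp[OF p] wp_bounded_iff by blast
  then have "\<exists>N. \<forall>n\<ge>N. \<forall>y\<in>((\<lambda>\<mu>. distr \<mu> borel f) ^^ n) ` moment_ball p a C. \<exists>k\<in>K. wass p y k < \<epsilon>"
    using attr assms unfolding global_attractor_def by blast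
  then show ?thesis by blast
qed

lemma K_nonempty: "K \<noteq> {}"
proof -
  have "return borel a \<in> moment_ball p a 0"
    by (simp add: moment_ball_def return_in_Prob Lp_le_return[OF p])
  then show ?thesis using attracts_moment_ball[OF zero_less_one, of 0] by blast
qed

text \<open>A Dirac mass far away, mixed into \<open>\<delta>\<^sub>a\<close> with the weight that keeps the moment bounded, is attracted by
  the uniformly \<open>p\<close>-integrable set \<open>K\<close>; this forces the far point itself to move inwards.\<close>

lemma funpow_contracts:
  assumes \<eta>: "0 < \<eta>"
  shows "\<exists>J D. \<forall>j\<ge>J. \<forall>y. dist ((f ^^ j) y) a \<le> D + \<eta> * dist y a"
proof -
  have \<eta>2: "0 < \<eta> / 2" using \<eta> by simp
  obtain D where D: "\<forall>k\<in>K. Lp_le p k (tail a D) (\<eta>/2)"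
    using compact_uniform_tail[OF K_compact \<eta>2] by blast
  obtain N where N: "\<forall>n\<ge>N. \<forall>\<mu>\<in>moment_ball p a 1. \<exists>k\<in>K. wass p (((\<lambda>\<mu>. distr \<mu> borel f) ^^ n) \<mu>) k < \<eta>/2"
    using attracts_moment_ball[OF \<eta>2] by blast
  have "dist ((f ^^ j) y) a \<le> (D + \<eta>) + \<eta> * dist y a" if j: "N \<le> j" for j y
  proof -
    \<comment> \<open>With \<open>\<tau> = 1 / s\<close> the weight is admissible and the norm
      \<open>\<tau> * dist y a\<close> of the mixture is at most 1. Undoing the factor costs
      \<open>s\<close>, which is at most \<open>1 + dist y a\<close>.\<close>
    define s where "s = max 1 (dist y a)"
    define \<tau> where "\<tau> = 1 / s"
    have s: "1 \<le> s" "dist y a \<le> s" by (auto simp: s_def)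
    have \<tau>: "0 \<le> \<tau>" "\<tau> \<le> 1" "\<tau> * dist y a \<le> 1" using s by (auto simp: \<tau>_def divide_simps)
    define \<mu> where "\<mu> = mixt \<tau> (return borel a) y"
    have "Lp_le p \<mu> (\<lambda>x. dist x a) (0 + \<tau> * dist y a)"
      unfolding \<mu>_def using \<tau> by (intro Lp_le_mixt) (auto simp: return_in_Prob Lp_le_return[OF p])
    then have "Lp_le p \<mu> (\<lambda>x. dist x a) 1" by (rule Lp_le_mono[OF p]) (use \<tau>(3) in auto)
    moreover have \<mu>: "\<mu> \<in> Prob" unfolding \<mu>_def using \<tau> by (intro mixt_Prob return_in_Prob)
    ultimately have mb: "\<mu> \<in> moment_ball p a 1" by (simp add: moment_ball_def)
    then have \<mu>P: "\<mu> \<in> Pp p" using moment_ball_Pp[OF p] by blast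
    obtain k where k: "k \<in> K" "wass p (distr \<mu> borel (f ^^ j)) k < \<eta>/2"
      using N[rule_format, OF j mb] funpow_push(1)[OF \<mu>P, of j] by auto
    have d1: "distr \<mu> borel (f ^^ j) \<in> Pp p" using funpow_push[OF \<mu>P, of j] by simp
    have d2: "k \<in> Pp p" using k(1) K_Pp by blast
    have "Lp_le p (distr \<mu> borel (f ^^ j)) (tail a D) (\<eta>/2 + \<eta>/2)"
      by (rule Lp_le_wass[OF p d1 d2 tail_Lip tail_nonneg]) (use D k in auto)
    then have "Lp_le p \<mu> (\<lambda>x. tail a D ((f ^^ j) x)) \<eta>"
      using funpow_measurable by (subst (asm) Lp_le_distr) (auto simp: measurable_Prob_cong[OF \<mu>])
    then have "\<tau> * tail a D ((f ^^ j) y) \<le> \<eta>"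
      unfolding \<mu>_def using \<tau> measurable_compose[OF funpow_measurable tail_measurable]
      by (intro Lp_le_mixtD[where h="\<lambda>x. tail a D ((f ^^ j) x)"]) (auto simp: return_in_Prob tail_nonneg)
    then have "tail a D ((f ^^ j) y) \<le> \<eta> * s" using s by (simp add: \<tau>_def divide_simps)
    also have "\<dots> \<le> \<eta> * (1 + dist y a)" using \<eta> by (intro mult_left_mono) (auto simp: s_def)
    finally show ?thesis by (simp add: tail_def algebra_simps)
  qed
  then show ?thesis by blast
qed

section \<open>Growth and large-scale regularity from uniform continuity\<close>

definition uc_near :: "'a measure \<Rightarrow> real \<Rightarrow> real \<Rightarrow> real \<Rightarrow> bool" where
  "uc_near k r \<epsilon> \<delta> \<longleftrightarrow> (\<forall>\<mu>\<in>Pp p. \<forall>\<nu>\<in>Pp p. wass p k \<mu> < r \<longrightarrow> wass p k \<nu> < r \<longrightarrow> wass p \<mu> \<nu> < \<delta> \<longrightarrow>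
     wass p (distr \<mu> borel f) (distr \<nu> borel f) < \<epsilon>)"

text \<open>The neighbourhood of \<open>K\<close> contains a ball around any chosen \<open>k\<close>
  in \<open>K\<close>; the mixtures below are formed with this \<open>k\<close>. The radius is fixed
  before \<open>\<epsilon>\<close> and \<open>\<delta>\<close>.\<close>

lemma uniformly_continuous_near: "\<exists>k\<in>K. \<exists>r>0. \<forall>\<epsilon>>0. \<exists>\<delta>>0. uc_near k r \<epsilon> \<delta>"
proof -
  obtain U V where UV: "openin (wp_top p) V" "K \<subseteq> V" "V \<subseteq> U" and uc: "\<forall>\<epsilon>>0. \<exists>\<delta>>0. \<forall>\<mu>\<in>U. \<forall>\<nu>\<in>U. wass p \<mu> \<nu> < \<delta> \<longrightarrow>
      wass p (distr \<mu> borel f) (distr \<nu> borel f) < \<epsilon>"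
    using unif by blast
  obtain k where k: "k \<in> K" using K_nonempty by blast
  then obtain r where r: "r > 0" "\<forall>\<nu>\<in>Pp p. wass p k \<nu> < r \<longrightarrow> \<nu> \<in> V"
    using UV unfolding openin_wp by blast
  then have "\<forall>\<mu>\<in>Pp p. wass p k \<mu> < r \<longrightarrow> \<mu> \<in> U" using UV(3) by blast
  then have "\<forall>\<epsilon>>0. \<exists>\<delta>>0. uc_near k r \<epsilon> \<delta>" using uc unfolding uc_near_def by meson
  then show ?thesis using k r(1) by blast
qed

text \<open>Moving a share of \<open>k\<close> to \<open>x\<close> costs at most
  \<open>\<tau> * (c + R)\<close>, and the chosen \<open>\<tau>\<close> makes this less than
  \<open>\<rho>\<close>. The weight decays only like \<open>1 / R\<close>, so pointwise bounds
  obtained from it grow linearly.\<close>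

lemma mixt_near:
  assumes k: "k \<in> Pp p" and c: "Lp_le p k (\<lambda>x. dist x a) c" and \<rho>: "0 < \<rho>" and x: "dist x a \<le> R"
    and \<tau>: "\<tau> = \<rho> / (\<rho> + c + R)"
  shows "0 < \<tau>" "\<tau> \<le> 1" "wass p k (mixt \<tau> k x) < \<rho>"
proof -
  have "0 \<le> c" "0 \<le> R" using Lp_le_nonneg[OF c] x zero_le_dist[of x a] by linarith+
  then have S: "0 < \<rho> + c + R" "c + R < \<rho> + c + R" "\<rho> \<le> \<rho> + c + R" using \<rho> by auto
  show t: "0 < \<tau>" "\<tau> \<le> 1" using S \<rho> by (auto simp: \<tau>)
  have "Lp_le p k (\<lambda>z. dist z a + dist x a) (c + dist x a)"
    using Pp_Prob[OF k] by (intro Lp_le_add[OF p c] Lp_le_const) (auto simp: ProbD measurable_Prob_cong)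
  then have "Lp_le p k (\<lambda>z. dist z x) (c + R)"
    by (rule Lp_le_mono[OF p]) (use x in \<open>auto intro: dist_triangle2\<close>)
  then have "wass p k (mixt \<tau> k x) \<le> \<tau> * (c + R)"
    using t by (intro wass_mixt_base Pp_Prob[OF k]) auto
  also have "\<dots> < \<tau> * (\<rho> + c + R)" using S t by (intro mult_strict_left_mono)
  also have "\<dots> = \<rho>" using S by (simp add: \<tau>)
  finally show "wass p k (mixt \<tau> k x) < \<rho>" .
qed

text \<open>The image of the mixture of \<open>k\<close> and \<open>x\<close> stays within 1 of the
  image of \<open>k\<close>, so its norm is at most \<open>c' + 1\<close>. The share of
  \<open>f x\<close> is \<open>\<tau> * dist (f x) a\<close>, with \<open>\<tau>\<close> inversely
  proportional to \<open>\<rho> + c + dist x a\<close>.\<close>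

lemma linear_growth: "\<exists>A\<ge>0. \<exists>B\<ge>0. \<forall>x. dist (f x) a \<le> A * dist x a + B"
proof -
  obtain k r where k: "k \<in> K" and r: "r > 0" and uc: "\<forall>\<epsilon>>0. \<exists>\<delta>>0. uc_near k r \<epsilon> \<delta>"
    using uniformly_continuous_near by blast
  obtain \<delta> where \<delta>: "\<delta> > 0" "uc_near k r 1 \<delta>" using uc zero_less_one by blast
  have kP: "k \<in> Pp p" using k K_Pp by blast
  obtain c where c: "Lp_le p k (\<lambda>x. dist x a) c" using kP in_Pp_iff[OF p] by blast
  obtain c' where c': "Lp_le p (distr k borel f) (\<lambda>x. dist x a) c'" using push_Pp[OF kP] in_Pp_iff[OF p] by blast
  have c0: "0 \<le> c" "0 \<le> c'" using c c' by (auto simp: Lp_le_nonneg)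
  define \<rho> where "\<rho> = min r \<delta>"
  have \<rho>: "0 < \<rho>" "\<rho> \<le> r" "\<rho> \<le> \<delta>" using r \<delta>(1) by (auto simp: \<rho>_def)
  have "dist (f x) a \<le> (c' + 1) / \<rho> * dist x a + (c' + 1) / \<rho> * (\<rho> + c)" for x
  proof -
    define \<tau> where "\<tau> = \<rho> / (\<rho> + c + dist x a)"
    note near = mixt_near[OF kP c \<rho>(1) order_refl \<tau>_def]
    have \<tau>: "0 \<le> \<tau>" "\<tau> \<le> 1" "0 < \<tau>" and w: "wass p k (mixt \<tau> k x) < \<rho>" using near by auto
    have mP: "mixt \<tau> k x \<in> Pp p" by (rule mixt_Pp[OF \<tau>(1,2) kP])
    have "wass p k k < r" using wass_self[OF p Pp_Prob[OF kP]] r by simp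
    then have "wass p (distr k borel f) (distr (mixt \<tau> k x) borel f) < 1"
      using \<delta>(2)[unfolded uc_near_def, rule_format, OF kP mP] w \<rho> by linarith
    then have "Lp_le p (distr (mixt \<tau> k x) borel f) (\<lambda>x. dist x a) (c' + 1)"
      using wass_commute[of p "distr k borel f"]
      by (intro Lp_le_wass[OF p push_Pp[OF mP] push_Pp[OF kP] dist_Lip _ c']) auto
    then have "Lp_le p (mixt \<tau> k x) (\<lambda>x. dist (f x) a) (c' + 1)"
      by (subst (asm) Lp_le_distr[OF f_Prob_measurable[OF Pp_Prob[OF mP]]]) auto
    then have "\<tau> * dist (f x) a \<le> c' + 1"
      by (intro Lp_le_mixtD[OF \<tau>(1,2) Pp_Prob[OF kP], where h="\<lambda>x. dist (f x) a"]) auto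
    then have "dist (f x) a \<le> (c' + 1) / \<tau>" using \<tau> by (simp add: field_simps)
    also have "\<dots> = (c' + 1) / \<rho> * dist x a + (c' + 1) / \<rho> * (\<rho> + c)"
      using \<rho> by (simp add: \<tau>_def distrib_left add_divide_distrib algebra_simps)
    finally show ?thesis .
  qed
  moreover have "0 \<le> (c' + 1) / \<rho>" "0 \<le> (c' + 1) / \<rho> * (\<rho> + c)" using c0 \<rho> by auto
  ultimately show ?thesis by blast
qed

lemma linear_growth_funpow: "\<exists>A\<ge>0. \<exists>B\<ge>0. \<forall>x. dist ((f ^^ j) x) a \<le> A * dist x a + B"
proof (induction j)
  case 0
  show ?case by (intro exI[of _ 1] exI[of _ 0] conjI) auto
next
  case (Suc j)
  then obtain A B where AB: "0 \<le> A" "0 \<le> B" "\<And>x. dist ((f ^^ j) x) a \<le> A * dist x a + B" by blast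
  obtain A' B' where AB': "0 \<le> A'" "0 \<le> B'" "\<And>x. dist (f x) a \<le> A' * dist x a + B'" using linear_growth by blast
  have "dist ((f ^^ Suc j) x) a \<le> (A' * A) * dist x a + (A' * B + B')" for x
  proof -
    have "dist ((f ^^ Suc j) x) a \<le> A' * dist ((f ^^ j) x) a + B'" using AB'(3) by simp
    also have "\<dots> \<le> A' * (A * dist x a + B) + B'" using AB(3) AB'(1) by (intro add_right_mono mult_left_mono)
    finally show ?thesis by (simp add: algebra_simps)
  qed
  moreover have "0 \<le> A' * A" "0 \<le> A' * B + B'" using AB AB' by auto
  ultimately show ?case by blast
qed

text \<open>Two Dirac masses mixed into the same \<open>k \<in> K\<close> are compared through a bump function around \<open>f y\<close> which is
  so narrow that the common part \<open>f\<^sub>* k\<close> contributes little to its norm.\<close>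

lemma almost_Lipschitz:
  assumes \<epsilon>: "0 < \<epsilon>"
  shows "\<exists>C\<ge>0. \<exists>L\<ge>0. \<forall>y z. dist (f y) (f z) \<le> \<epsilon> * dist z a + C * dist y z + L"
proof -
  obtain k r where k: "k \<in> K" and r: "r > 0" and uc: "\<forall>\<epsilon>>0. \<exists>\<delta>>0. uc_near k r \<epsilon> \<delta>"
    using uniformly_continuous_near by blast
  \<comment> \<open>The factor 1/8 makes the threshold \<open>q = 2 * e1 / \<tau>\<close> equal to
    \<open>\<epsilon> * (r + c + R) / 4\<close>; the case analysis below loses another factor
    4.\<close>
  define e1 where "e1 = \<epsilon> * r / 8"
  have e1: "0 < e1" using \<epsilon> r by (simp add: e1_def)
  obtain \<delta> where \<delta>: "\<delta> > 0" "uc_near k r e1 \<delta>" using uc e1 by blast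
  obtain D where D: "0 \<le> D" "\<forall>k\<in>K. Lp_le p k (tail a D) e1"
    using compact_uniform_tail[OF K_compact e1] by blast
  obtain A B where AB: "0 \<le> A" "0 \<le> B" "\<And>x. dist (f x) a \<le> A * dist x a + B" using linear_growth by blast
  have kP: "k \<in> Pp p" using k K_Pp by blast
  have fk: "distr k borel f \<in> K" using k K_invariant by blast
  obtain c where c: "Lp_le p k (\<lambda>x. dist x a) c" using kP in_Pp_iff[OF p] by blast
  have c0: "0 \<le> c" using c by (rule Lp_le_nonneg)
  have key: "min (dist (f x) (f y)) (dist (f y) a / 2) \<le> 2 * e1 / \<tau>"
    if R: "dist x a \<le> R" "dist y a \<le> R" and \<tau>_def: "\<tau> = r / (r + c + R)" and close: "\<tau> * dist x y < \<delta>"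
      and far: "2 * D \<le> dist (f y) a" for x y R \<tau>
  proof -
    note near = mixt_near[OF kP c r _ \<tau>_def]
    have \<tau>: "0 \<le> \<tau>" "\<tau> \<le> 1" "0 < \<tau>" using near(1,2)[OF R(1)] by auto
    have mP: "mixt \<tau> k x \<in> Pp p" for x by (rule mixt_Pp[OF \<tau>(1,2) kP])
    have "wass p (mixt \<tau> k y) (mixt \<tau> k x) \<le> \<tau> * dist y x"
      by (rule wass_mixt_mixt[OF \<tau>(1,2) Pp_Prob[OF kP]])
    also have "\<dots> < \<delta>" using close by (simp add: dist_commute)
    finally have w: "wass p (distr (mixt \<tau> k y) borel f) (distr (mixt \<tau> k x) borel f) < e1"
      by (intro \<delta>(2)[unfolded uc_near_def, rule_format] mP near(3) R)
    \<comment> \<open>\<open>q\<close> is at most \<open>dist (f x) (f y)\<close>, so the bump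
      \<open>h\<close> of radius \<open>q\<close> around \<open>f y\<close> vanishes at
      \<open>f x\<close>. It is at most half of \<open>dist (f y) a\<close>, so together with
      \<open>2 * D \<le> dist (f y) a\<close> the bump lies below \<open>tail a D\<close>.\<close>
    define q where "q = min (dist (f x) (f y)) (dist (f y) a / 2)"
    define h where "h z = max 0 (q - dist z (f y))" for z
    have hL: "\<bar>h u - h v\<bar> \<le> dist u v" for u v
      using dist_Lip[of u "f y" v] unfolding h_def by linarith
    have h0: "0 \<le> h u" for u by (simp add: h_def)
    have [measurable]: "h \<in> borel_measurable borel" unfolding h_def by measurable
    have h_tail: "h z \<le> tail a D z" for z
      using far dist_triangle[of "f y" a z] by (auto simp: h_def tail_def q_def dist_commute min_def)
    have "Lp_le p (distr k borel f) h e1"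
      by (rule Lp_le_mono[OF p, of _ "tail a D" e1]) (use D(2) fk h0 h_tail in auto)
    then have "Lp_le p k (\<lambda>z. h (f z)) e1"
      by (subst (asm) Lp_le_distr[OF f_Prob_measurable[OF Pp_Prob[OF kP]]]) auto
    then have "Lp_le p (mixt \<tau> k x) (\<lambda>z. h (f z)) (e1 + \<tau> * h (f x))"
      by (intro Lp_le_mixt[OF \<tau>(1,2) Pp_Prob[OF kP], where h="\<lambda>z. h (f z)"]) (auto simp: h0)
    moreover have "h (f x) = 0" by (simp add: h_def q_def)
    ultimately have "Lp_le p (distr (mixt \<tau> k x) borel f) h e1"
      by (subst Lp_le_distr[OF f_Prob_measurable[OF Pp_Prob[OF mP]]]) auto
    then have "Lp_le p (distr (mixt \<tau> k y) borel f) h (e1 + e1)"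
      using w by (intro Lp_le_wass[OF p push_Pp[OF mP] push_Pp[OF mP] hL h0]) auto
    then have "Lp_le p (mixt \<tau> k y) (\<lambda>z. h (f z)) (2 * e1)"
      by (subst (asm) Lp_le_distr[OF f_Prob_measurable[OF Pp_Prob[OF mP]]]) auto
    then have "\<tau> * h (f y) \<le> 2 * e1"
      by (intro Lp_le_mixtD[OF \<tau>(1,2) Pp_Prob[OF kP], where h="\<lambda>z. h (f z)"]) (auto simp: h0)
    then have "h (f y) \<le> 2 * e1 / \<tau>" using \<tau> by (simp add: field_simps)
    moreover have "h (f y) = q" by (simp add: h_def q_def)
    ultimately show ?thesis by (simp add: q_def)
  qed
  define C where "C = \<epsilon> + 2 * A * r / \<delta>"
  define L where "L = \<epsilon> * (r + c) + 4 * D + 2 * B"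
  have "dist (f y) (f z) \<le> \<epsilon> * dist z a + C * dist y z + L" for y z
  proof -
    define R where "R = dist z a + dist y z"
    define \<tau> where "\<tau> = r / (r + c + R)"
    have R: "dist y a \<le> R" "dist z a \<le> R" "0 \<le> R" unfolding R_def using dist_triangle[of y a z] by auto
    have S: "0 < r + c + R" using r c0 R by simp
    have nn: "0 \<le> \<epsilon> * dist z a" "0 \<le> \<epsilon> * dist y z" "0 \<le> \<epsilon> * (r + c)" "0 \<le> 2 * A * r / \<delta> * dist y z"
      using \<epsilon> r c0 AB \<delta>(1) by auto
    show ?thesis
    proof (cases "\<tau> * dist y z < \<delta>")
      case True
      define q where "q = 2 * e1 / \<tau>"
      have q4: "4 * q = \<epsilon> * (r + c + R)"
        using r S by (simp add: q_def e1_def \<tau>_def field_simps)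
      then have q0: "0 \<le> q" using mult_pos_pos[OF \<epsilon> S] by linarith
      have k1: "min (dist (f y) (f z)) (dist (f z) a / 2) \<le> q \<or> dist (f z) a \<le> 2 * D"
        using key[OF R(1,2) \<tau>_def True] by (auto simp: q_def)
      have k2: "min (dist (f y) (f z)) (dist (f y) a / 2) \<le> q \<or> dist (f y) a \<le> 2 * D"
        using key[OF R(2,1) \<tau>_def] True by (auto simp: q_def dist_commute)
      \<comment> \<open>Either one minimum is attained by \<open>dist (f y) (f z)\<close>, which is
        then at most \<open>q\<close>, or both images lie within \<open>2 * q + 2 * D\<close> of
        \<open>a\<close>.\<close>
      have "dist (f y) (f z) \<le> 4 * q + 4 * D"
        using k1 k2 q0 D(1) dist_triangle2[of "f y" "f z" a] by (auto simp: min_le_iff_disj)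
      also have "\<dots> = \<epsilon> * dist z a + \<epsilon> * dist y z + \<epsilon> * (r + c) + 4 * D"
        unfolding q4 R_def by (simp add: algebra_simps)
      finally show ?thesis using nn AB(2) unfolding C_def L_def distrib_right by linarith
    next
      case False
      \<comment> \<open>The points are now far apart relative to \<open>R\<close>, so linear growth
        suffices; this produces the summand \<open>2 * A * r / \<delta>\<close> of
        \<open>C\<close>.\<close>
      then have "\<delta> * (r + c + R) \<le> r * dist y z" using S by (simp add: \<tau>_def field_simps)
      moreover have "\<delta> * R \<le> \<delta> * (r + c + R)" using \<delta>(1) r c0 by (intro mult_left_mono) auto
      ultimately have "\<delta> * R \<le> r * dist y z" by linarith
      then have "R \<le> r / \<delta> * dist y z" using \<delta>(1) by (simp add: field_simps)
      then have "2 * A * R \<le> 2 * A * (r / \<delta> * dist y z)" using AB(1) by (intro mult_left_mono) auto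
      then have AR: "2 * A * R \<le> 2 * A * r / \<delta> * dist y z" by simp
      have "dist (f y) (f z) \<le> dist (f y) a + dist (f z) a" by (rule dist_triangle2)
      also have "\<dots> \<le> (A * dist y a + B) + (A * dist z a + B)" by (intro add_mono AB(3))
      also have "\<dots> \<le> (A * R + B) + (A * R + B)" using R AB(1) by (intro add_mono mult_left_mono) auto
      also have "\<dots> = 2 * A * R + 2 * B" by simp
      also have "\<dots> \<le> 2 * A * r / \<delta> * dist y z + 2 * B" using AR by simp
      finally show ?thesis using nn D(1) unfolding C_def L_def distrib_right by linarith
    qed
  qed
  moreover have "0 \<le> C" "0 \<le> L"
    using \<epsilon> AB r \<delta>(1) c0 D(1) by (auto simp: C_def L_def)
  ultimately show ?thesis by blast
qed

end

section \<open>Noisy iterates\<close>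

lemma kernel_Prob:
  fixes k :: "'a::metric_space \<Rightarrow> 'a measure"
  assumes "k \<in> borel \<rightarrow>\<^sub>M prob_algebra borel" shows "k x \<in> Prob"
  using measurable_space[OF assms, of x] by (simp add: space_prob_algebra Prob_def)

lemma kernel_subprob:
  fixes k :: "'a::metric_space \<Rightarrow> 'a measure"
  assumes "k \<in> borel \<rightarrow>\<^sub>M prob_algebra borel" "\<mu> \<in> Prob"
  shows "k \<in> \<mu> \<rightarrow>\<^sub>M subprob_algebra borel"
  using measurable_prob_algebraD[OF assms(1)] by (simp add: measurable_Prob_cong[OF assms(2)])

lemma bind_Prob:
  fixes k :: "'a::metric_space \<Rightarrow> 'a measure"
  assumes "k \<in> borel \<rightarrow>\<^sub>M prob_algebra borel" "\<mu> \<in> Prob"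
  shows "bind \<mu> k \<in> Prob"
proof -
  note k = kernel_subprob[OF assms]
  have "prob_space (bind \<mu> k)"
    by (rule prob_space.prob_space_bind[OF ProbD(1)[OF assms(2)] _ k])
       (simp add: ProbD kernel_Prob[OF assms(1)])
  moreover have "sets (bind \<mu> k) = sets borel"
    by (rule sets_bind[OF sets_kernel[OF k]]) (auto simp: ProbD[OF assms(2)])
  ultimately show ?thesis by (simp add: Prob_def)
qed

abbreviation bind_pow :: "('a::metric_space \<Rightarrow> 'a measure) \<Rightarrow> nat \<Rightarrow> 'a measure \<Rightarrow> 'a measure" where
  "bind_pow k j \<equiv> (\<lambda>\<mu>. bind \<mu> k) ^^ j"

lemma funpow_bind_Prob:
  fixes k :: "'a::metric_space \<Rightarrow> 'a measure"
  assumes "k \<in> borel \<rightarrow>\<^sub>M prob_algebra borel" "\<mu> \<in> Prob"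
  shows "bind_pow k j \<mu> \<in> Prob"
  using assms(2) by (induction j) (auto intro: bind_Prob[OF assms(1)])

lemma measurable_funpow_bind_return:
  fixes k :: "'a::metric_space \<Rightarrow> 'a measure"
  assumes "k \<in> borel \<rightarrow>\<^sub>M prob_algebra borel"
  shows "(\<lambda>x. bind_pow k j (return borel x)) \<in> borel \<rightarrow>\<^sub>M prob_algebra borel"
proof (induction j)
  case 0
  show ?case using measurable_return_prob_space[of borel] by simp
next
  case (Suc j)
  then show ?case using measurable_bind_prob_space[OF Suc assms] by simp
qed

text \<open>Chapman--Kolmogorov by associativity of \<open>bind\<close>. It reduces estimates on
  iterates of a measure to chains started at points.\<close>

lemma funpow_bind_eq:
  fixes k :: "'a::metric_space \<Rightarrow> 'a measure"
  assumes k: "k \<in> borel \<rightarrow>\<^sub>M prob_algebra borel" and \<mu>: "\<mu> \<in> Prob"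
  shows "bind_pow k j \<mu> = bind \<mu> (\<lambda>x. bind_pow k j (return borel x))"
proof (induction j)
  case 0
  show ?case using bind_return''[of \<mu> borel] by (simp add: ProbD[OF \<mu>])
next
  case (Suc j)
  have "bind (bind \<mu> (\<lambda>x. bind_pow k j (return borel x))) k
      = bind \<mu> (\<lambda>x. bind (bind_pow k j (return borel x)) k)"
    by (rule bind_assoc[OF kernel_subprob[OF measurable_funpow_bind_return[OF k] \<mu>] measurable_prob_algebraD[OF k]])
  then show ?case using Suc by simp
qed

context attractor_map
begin

text \<open>The noise size is normalised to 1, so that the constants below are uniform over all such
  kernels and hence over all large \<open>n\<close>.\<close>

definition noisy :: "('a \<Rightarrow> 'a measure) \<Rightarrow> bool" where
  "noisy k \<longleftrightarrow> k \<in> borel \<rightarrow>\<^sub>M prob_algebra borel \<and> (\<forall>x. Lp_le p (k x) (\<lambda>y. dist y (f x)) 1)"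

lemma noisyD:
  assumes "noisy k"
  shows "k \<in> borel \<rightarrow>\<^sub>M prob_algebra borel" "Lp_le p (k x) (\<lambda>y. dist y b) (1 + dist (f x) b)"
proof -
  show k: "k \<in> borel \<rightarrow>\<^sub>M prob_algebra borel" using assms by (simp add: noisy_def)
  note P = kernel_Prob[OF k, of x]
  have "Lp_le p (k x) (\<lambda>y. dist y (f x)) 1" using assms by (simp add: noisy_def)
  then have "Lp_le p (k x) (\<lambda>y. dist y (f x) + dist (f x) b) (1 + dist (f x) b)"
    by (intro Lp_le_add[OF p] Lp_le_const) (auto simp: ProbD[OF P] measurable_Prob_cong[OF P])
  then show "Lp_le p (k x) (\<lambda>y. dist y b) (1 + dist (f x) b)"
    by (rule Lp_le_mono[OF p]) (auto intro: dist_triangle)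
qed

lemma Lp_le_bind_affine:
  fixes k :: "'a \<Rightarrow> 'a measure"
  assumes k: "k \<in> borel \<rightarrow>\<^sub>M prob_algebra borel" and \<mu>: "\<mu> \<in> Prob" and h: "h \<in> borel_measurable borel"
    and L: "\<And>x. Lp_le p (k x) h (u + v * dist x b)" and uv: "0 \<le> u" "0 \<le> v"
    and c: "Lp_le p \<mu> (\<lambda>x. dist x b) c"
  shows "Lp_le p (bind \<mu> k) h (u + v * c)"
proof (rule Lp_le_bind[OF kernel_subprob[OF k \<mu>] h L])
  have "Lp_le p \<mu> (\<lambda>x. v * dist x b) (v * c)"
    using uv by (intro Lp_le_scale[OF p c]) (auto simp: measurable_Prob_cong[OF \<mu>])
  then show "Lp_le p \<mu> (\<lambda>x. u + v * dist x b) (u + v * c)"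
    using uv by (intro Lp_le_add[OF p] Lp_le_const ProbD[OF \<mu>]) (auto simp: measurable_Prob_cong[OF \<mu>])
qed

text \<open>On the scale of the distance to \<open>a\<close>, noise of bounded size does not matter.\<close>

lemma noisy_tracks:
  "\<forall>\<epsilon>>0. \<exists>L\<ge>0. \<forall>k x. noisy k \<longrightarrow>
     Lp_le p (bind_pow k j (return borel x)) (\<lambda>y. dist y ((f ^^ j) x)) (\<epsilon> * dist x a + L)"
proof (induction j)
  case 0
  show ?case
  proof (intro allI impI, rule exI[of _ 0], intro conjI allI impI)
    fix \<epsilon> :: real and k x assume "0 < \<epsilon>"
    then show "Lp_le p (bind_pow k 0 (return borel x)) (\<lambda>y. dist y ((f ^^ 0) x)) (\<epsilon> * dist x a + 0)"
      by (simp add: Lp_le_return[OF p])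
  qed simp
next
  case (Suc j)
  show ?case
  proof (intro allI impI)
    fix \<epsilon> :: real assume \<epsilon>: "0 < \<epsilon>"
    obtain A B where AB: "0 \<le> A" "0 \<le> B" "\<forall>x. dist ((f ^^ j) x) a \<le> A * dist x a + B"
      using linear_growth_funpow[of j] by blast
    \<comment> \<open>The order of choice: \<open>e1\<close> from the growth constant
      \<open>A\<close> of the \<open>j\<close>-th iterate, then \<open>C\<close> and
      \<open>L\<close> from \<open>e1\<close>, then \<open>e2\<close> from \<open>C\<close>, and
      last \<open>L'\<close> from the induction hypothesis at \<open>e2\<close>. This is why the
      induction runs over all slopes \<open>\<epsilon>\<close> at once.\<close>
    define e1 where "e1 = \<epsilon> / (2 * (A + 1))"
    have e1: "0 < e1" "e1 * A \<le> \<epsilon> / 2" using \<epsilon> AB(1) by (auto simp: e1_def field_simps)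
    obtain C L where CL: "0 \<le> C" "0 \<le> L" "\<forall>y z. dist (f y) (f z) \<le> e1 * dist z a + C * dist y z + L"
      using almost_Lipschitz[OF e1(1)] by blast
    define e2 where "e2 = \<epsilon> / (2 * (C + 1))"
    have e2: "0 < e2" "C * e2 \<le> \<epsilon> / 2" using \<epsilon> CL(1) by (auto simp: e2_def field_simps)
    obtain L' where L': "0 \<le> L'" "\<forall>k x. noisy k \<longrightarrow>
        Lp_le p (bind_pow k j (return borel x)) (\<lambda>y. dist y ((f ^^ j) x)) (e2 * dist x a + L')"
      using Suc[rule_format, OF e2(1)] by blast
    define M where "M = 1 + e1 * B + L + C * L'"
    have "Lp_le p (bind_pow k (Suc j) (return borel x)) (\<lambda>y. dist y ((f ^^ Suc j) x)) (\<epsilon> * dist x a + M)"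
      if k: "noisy k" for k x
    proof -
      define z where "z = (f ^^ j) x"
      define \<mu> where "\<mu> = bind_pow k j (return borel x)"
      have \<mu>: "\<mu> \<in> Prob" unfolding \<mu>_def by (rule funpow_bind_Prob[OF noisyD(1)[OF k] return_in_Prob])
      have L1: "Lp_le p (bind \<mu> k) (\<lambda>y. dist y (f z)) ((1 + e1 * dist z a + L) + C * (e2 * dist x a + L'))"
      proof (rule Lp_le_bind_affine[OF noisyD(1)[OF k] \<mu>])
        show "Lp_le p (k y) (\<lambda>w. dist w (f z)) (1 + e1 * dist z a + L + C * dist y z)" for y
          using CL(3)[rule_format, of y z]
          by (intro Lp_le_mono[OF p noisyD(2)[OF k, of y "f z"]]) auto
        show "Lp_le p \<mu> (\<lambda>y. dist y z) (e2 * dist x a + L')"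
          unfolding \<mu>_def z_def using L'(2) k by blast
      qed (use e1 CL in auto)
      have "(1 + e1 * dist z a + L) + C * (e2 * dist x a + L') \<le> \<epsilon> * dist x a + M"
      proof -
        have "e1 * dist z a \<le> e1 * (A * dist x a + B)"
          unfolding z_def using e1(1) AB(3) by (intro mult_left_mono) auto
        moreover have "e1 * A * dist x a \<le> \<epsilon> / 2 * dist x a" using e1(2) by (intro mult_right_mono) auto
        moreover have "C * e2 * dist x a \<le> \<epsilon> / 2 * dist x a" using e2(2) by (intro mult_right_mono) auto
        ultimately show ?thesis by (simp add: M_def algebra_simps)
      qed
      then have "Lp_le p (bind \<mu> k) (\<lambda>y. dist y (f z)) (\<epsilon> * dist x a + M)"
        by (intro Lp_le_mono[OF p L1]) auto
      then show ?thesis by (simp add: \<mu>_def z_def)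
    qed
    moreover have "0 \<le> M" unfolding M_def using e1 AB CL L' by auto
    ultimately show "\<exists>L\<ge>0. \<forall>k x. noisy k \<longrightarrow>
        Lp_le p (bind_pow k (Suc j) (return borel x)) (\<lambda>y. dist y ((f ^^ Suc j) x)) (\<epsilon> * dist x a + L)"
      by blast
  qed
qed

text \<open>A crude one-step bound, used to cover the times that are not multiples of
  \<open>J\<close>.\<close>

lemma noisy_step:
  "\<exists>A\<ge>0. \<exists>B\<ge>0. \<forall>k \<mu> c. noisy k \<longrightarrow> \<mu> \<in> Prob \<longrightarrow> Lp_le p \<mu> (\<lambda>x. dist x a) c \<longrightarrow>
     Lp_le p (bind \<mu> k) (\<lambda>x. dist x a) (B + A * c)"
proof -
  obtain A B where AB: "0 \<le> A" "0 \<le> B" "\<forall>x. dist (f x) a \<le> A * dist x a + B"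
    using linear_growth by blast
  have "Lp_le p (bind \<mu> k) (\<lambda>x. dist x a) ((1 + B) + A * c)"
    if k: "noisy k" and \<mu>: "\<mu> \<in> Prob" and c: "Lp_le p \<mu> (\<lambda>x. dist x a) c" for k \<mu> c
  proof (rule Lp_le_bind_affine[OF noisyD(1)[OF k] \<mu> _ _ _ _ c])
    show "Lp_le p (k x) (\<lambda>x. dist x a) ((1 + B) + A * dist x a)" for x
      using AB(3)[rule_format, of x] by (intro Lp_le_mono[OF p noisyD(2)[OF k, of x a]]) auto
  qed (use AB in auto)
  moreover have "0 \<le> 1 + B" using AB by simp
  ultimately show ?thesis using AB(1) by blast
qed

text \<open>From a start at \<open>x\<close>, the deterministic point contributes \<open>D0\<close>
  plus a quarter of \<open>dist x a\<close>, and the tracking error \<open>L\<close> plus another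
  quarter; the affine bound then passes to all starting laws.\<close>

lemma noisy_contracts:
  "\<exists>J>0. \<exists>D\<ge>0. \<forall>k \<mu> c. noisy k \<longrightarrow> \<mu> \<in> Prob \<longrightarrow> Lp_le p \<mu> (\<lambda>x. dist x a) c \<longrightarrow>
     Lp_le p (bind_pow k J \<mu>) (\<lambda>x. dist x a) (D + 1/2 * c)"
proof -
  have quarter: "(0::real) < 1/4" by simp
  obtain J0 D0 where JD: "\<forall>j\<ge>J0. \<forall>y. dist ((f ^^ j) y) a \<le> D0 + 1/4 * dist y a"
    using funpow_contracts[OF quarter] by blast
  \<comment> \<open>The successor only ensures \<open>0 < J\<close>, needed for division with
    remainder by \<open>J\<close>.\<close>
  define J where "J = Suc J0"
  have D0: "dist ((f ^^ J) y) a \<le> D0 + 1/4 * dist y a" for y using JD[rule_format, of J y] by (simp add: J_def)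
  have "0 \<le> D0" using order_trans[OF zero_le_dist D0[of a]] by simp
  obtain L where L: "0 \<le> L" "\<forall>k x. noisy k \<longrightarrow>
      Lp_le p (bind_pow k J (return borel x)) (\<lambda>y. dist y ((f ^^ J) x)) (1/4 * dist x a + L)"
    using noisy_tracks[of J, rule_format, OF quarter] by blast
  have "Lp_le p (bind_pow k J \<mu>) (\<lambda>x. dist x a) ((D0 + L) + 1/2 * c)"
    if k: "noisy k" and \<mu>: "\<mu> \<in> Prob" and c: "Lp_le p \<mu> (\<lambda>x. dist x a) c" for k \<mu> c
    unfolding funpow_bind_eq[OF noisyD(1)[OF k] \<mu>, of J]
  proof (rule Lp_le_bind_affine[OF measurable_funpow_bind_return[OF noisyD(1)[OF k]] \<mu> _ _ _ _ c])
    fix x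
    let ?\<nu> = "bind_pow k J (return borel x)"
    have \<nu>: "?\<nu> \<in> Prob" by (rule funpow_bind_Prob[OF noisyD(1)[OF k] return_in_Prob])
    have "Lp_le p ?\<nu> (\<lambda>y. dist y ((f ^^ J) x) + dist ((f ^^ J) x) a) ((1/4 * dist x a + L) + dist ((f ^^ J) x) a)"
      using L(2) k by (intro Lp_le_add[OF p] Lp_le_const ProbD[OF \<nu>]) (auto simp: measurable_Prob_cong[OF \<nu>])
    then show "Lp_le p ?\<nu> (\<lambda>y. dist y a) ((D0 + L) + 1/2 * dist x a)"
    proof (rule Lp_le_mono[OF p])
      show "(1/4 * dist x a + L) + dist ((f ^^ J) x) a \<le> (D0 + L) + 1/2 * dist x a" using D0[of x] by simp
    qed (auto intro: dist_triangle)
  qed (use L \<open>0 \<le> D0\<close> in auto)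
  moreover have "0 < J" "0 \<le> D0 + L" using L \<open>0 \<le> D0\<close> by (auto simp: J_def)
  ultimately show ?thesis by blast
qed

end

section \<open>The weak attractor of a noisy map\<close>

locale noisy_map = wass_space +
  fixes P :: "'a measure \<Rightarrow> 'a measure" and k :: "'a \<Rightarrow> 'a measure" and a :: 'a
    and A B D :: real and J :: nat
  assumes k: "k \<in> borel \<rightarrow>\<^sub>M prob_algebra borel"
    and P_bind: "\<mu> \<in> Pp p \<Longrightarrow> P \<mu> = bind \<mu> k"
    and P_Pp: "\<mu> \<in> Pp p \<Longrightarrow> P \<mu> \<in> Pp p"
    and P_cont: "continuous_map (wp_top p) (wp_top p) P"
    and step: "\<mu> \<in> Pp p \<Longrightarrow> Lp_le p \<mu> (\<lambda>x. dist x a) c \<Longrightarrow> Lp_le p (P \<mu>) (\<lambda>x. dist x a) (B + A * c)"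
    and contracts: "\<mu> \<in> Pp p \<Longrightarrow> Lp_le p \<mu> (\<lambda>x. dist x a) c \<Longrightarrow> Lp_le p ((P ^^ J) \<mu>) (\<lambda>x. dist x a) (D + 1/2 * c)"
    and J_pos: "0 < J" and D_nonneg: "0 \<le> D"
begin

abbreviation moment_le :: "'a measure \<Rightarrow> real \<Rightarrow> bool" where
  "moment_le \<mu> c \<equiv> Lp_le p \<mu> (\<lambda>x. dist x a) c"

lemma moment_le_mono: "moment_le \<mu> c \<Longrightarrow> c \<le> c' \<Longrightarrow> moment_le \<mu> c'"
  by (rule Lp_le_mono[OF p]) auto

lemma funpow_Pp: "\<mu> \<in> Pp p \<Longrightarrow> (P ^^ j) \<mu> \<in> Pp p"
  by (induction j) (auto simp: P_Pp)

lemma iterates_bounded: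
  "\<exists>C. \<forall>\<mu>\<in>Pp p. moment_le \<mu> c \<longrightarrow> (\<forall>j. moment_le ((P ^^ j) \<mu>) C)"
proof -
  define b where "b r = ((\<lambda>c. B + A * c) ^^ r) c" for r
  have b: "moment_le ((P ^^ r) \<mu>) (b r)" if "\<mu> \<in> Pp p" "moment_le \<mu> c" for \<mu> r
    using that by (induction r) (auto simp: b_def intro!: step funpow_Pp)
  \<comment> \<open>Since \<open>C\<close> is at least \<open>2 * D\<close>, one block of
    \<open>J\<close> steps maps the bound \<open>C\<close> to \<open>D + C / 2 \<le> C\<close>; the
    values \<open>b r\<close> cover the first block.\<close>
  define C where "C = Max (insert (2 * D) (b ` {..<J}))"
  have C: "2 * D \<le> C" "\<And>r. r < J \<Longrightarrow> b r \<le> C" by (auto simp: C_def)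
  have "moment_le ((P ^^ (J * q + r)) \<mu>) C" if \<mu>: "\<mu> \<in> Pp p" "moment_le \<mu> c" and r: "r < J" for \<mu> q r
  proof (induction q)
    case 0
    show ?case using moment_le_mono[OF b[OF \<mu>] C(2)[OF r]] by simp
  next
    case (Suc q)
    have "moment_le ((P ^^ J) ((P ^^ (J * q + r)) \<mu>)) (D + 1/2 * C)"
      by (rule contracts[OF funpow_Pp[OF \<mu>(1)] Suc])
    moreover have "(P ^^ J) ((P ^^ (J * q + r)) \<mu>) = (P ^^ (J * Suc q + r)) \<mu>"
      by (simp add: funpow_add[symmetric] flip: comp_apply[of "P ^^ J"]) (simp add: add.assoc)
    ultimately show ?case using C(1) by (auto intro: moment_le_mono)
  qed
  then have "moment_le ((P ^^ j) \<mu>) C" if "\<mu> \<in> Pp p" "moment_le \<mu> c" for \<mu> j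
    using that J_pos mod_less_divisor[OF J_pos, of j] mult_div_mod_eq[of J j] by metis
  then show ?thesis by blast
qed

lemma orbit_funpow:
  fixes \<sigma> :: "int \<Rightarrow> 'a measure"
  assumes "\<And>i. P (\<sigma> i) = \<sigma> (i + 1)"
  shows "(P ^^ n) (\<sigma> i) = \<sigma> (i + int n)"
  by (induction n) (auto simp: assms algebra_simps)

text \<open>Each return of \<open>J\<close> steps into the past halves the excess of the bound over
  \<open>2 * D\<close>, and a bounded full orbit allows arbitrarily many returns.\<close>

lemma orbit_moment:
  fixes \<sigma> :: "int \<Rightarrow> 'a measure"
  assumes orb: "\<And>i. P (\<sigma> i) = \<sigma> (i + 1)" and "range \<sigma> \<subseteq> Pp p" "wp_bounded p (range \<sigma>)"
  shows "moment_le (\<sigma> i) (2 * D)"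
proof -
  obtain C where "range \<sigma> \<subseteq> moment_ball p a C" using assms(3) wp_bounded_iff by blast
  then have C: "moment_le (\<sigma> i) C" for i by (auto simp: moment_ball_def)
  then have C0: "0 \<le> C" by (rule Lp_le_nonneg)
  have *: "moment_le (\<sigma> i) (2 * D + C / 2 ^ n)" for i n
  proof (induction n arbitrary: i)
    case 0
    show ?case using moment_le_mono[OF C] D_nonneg by simp
  next
    case (Suc n)
    have "moment_le ((P ^^ J) (\<sigma> (i - int J))) (D + 1/2 * (2 * D + C / 2 ^ n))"
      using assms(2) by (intro contracts Suc) auto
    moreover have "(P ^^ J) (\<sigma> (i - int J)) = \<sigma> i" by (simp add: orbit_funpow[of \<sigma>, OF orb])
    moreover have "D + 1/2 * (2 * D + C / 2 ^ n) = 2 * D + C / 2 ^ Suc n" by (simp add: field_simps)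
    ultimately show ?case by (simp only:)
  qed
  show ?thesis
  proof (rule Lp_le_limit[OF p])
    show "0 \<le> 2 * D" using D_nonneg by simp
    fix \<delta> :: real assume "0 < \<delta>"
    then obtain n where n: "(1/2) ^ n < \<delta> / (C + 1)"
      using real_arch_pow_inv[of "\<delta> / (C + 1)" "1/2"] C0 by auto
    have "C * (1/2) ^ n \<le> (C + 1) * (1/2) ^ n" by (intro mult_right_mono) auto
    also have "\<dots> \<le> \<delta>" using n C0 by (simp add: field_simps)
    finally have "C / 2 ^ n \<le> \<delta>" by (simp add: power_divide)
    then show "moment_le (\<sigma> i) (2 * D + \<delta>)" by (intro moment_le_mono[OF *[of i n]]) simp
  qed
qed

text \<open>A common moment bound for all iterates that start within \<open>2 * D + 1\<close>.
  \<open>SOME\<close> picks a witness of \<open>iterates_bounded\<close>.\<close>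

definition bd :: real where
  "bd = (SOME C. \<forall>\<mu>\<in>Pp p. moment_le \<mu> (2 * D + 1) \<longrightarrow> (\<forall>j. moment_le ((P ^^ j) \<mu>) C))"

lemma bd: "\<mu> \<in> Pp p \<Longrightarrow> moment_le \<mu> (2 * D + 1) \<Longrightarrow> moment_le ((P ^^ j) \<mu>) bd"
  using someI_ex[OF iterates_bounded[of "2 * D + 1"]] unfolding bd_def[symmetric] by blast

text \<open>Prescribing the whole forward orbit makes invariance automatic and exhibits the set as
  an intersection of preimages of one ball, hence closed in both topologies.\<close>

definition nbhd :: "'a measure set" where
  "nbhd = {\<mu> \<in> Pp p. \<forall>j. (P ^^ j) \<mu> \<in> moment_ball p a bd}"

definition core :: "'a measure set" where
  "core = (\<Inter>i. (P ^^ i) ` nbhd)"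

lemma nbhdI: "\<mu> \<in> Pp p \<Longrightarrow> moment_le \<mu> (2 * D + 1) \<Longrightarrow> \<mu> \<in> nbhd"
  unfolding nbhd_def moment_ball_def using bd Pp_Prob[OF funpow_Pp] by simp

lemma nbhd_Pp: "nbhd \<subseteq> Pp p"
  by (auto simp: nbhd_def)

lemma nbhd_moment_ball: "nbhd \<subseteq> moment_ball p a bd"
  by (auto simp: nbhd_def dest: spec[of _ 0])

lemma return_nbhd: "return borel a \<in> nbhd"
  using D_nonneg by (intro nbhdI return_in_Pp[OF p]) (simp add: Lp_le_return[OF p])

lemma bd_nonneg: "0 \<le> bd"
  using return_nbhd nbhd_moment_ball by (auto simp: moment_ball_def intro: Lp_le_nonneg)

lemma nbhd_invariant: "\<mu> \<in> nbhd \<Longrightarrow> (P ^^ i) \<mu> \<in> nbhd"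
  unfolding nbhd_def by (auto simp: funpow_Pp simp flip: funpow_add[THEN fun_cong, simplified])

lemma nbhd_bounded: "S \<subseteq> nbhd \<Longrightarrow> wp_bounded p S"
  using nbhd_moment_ball wp_bounded_iff by blast

section \<open>Closedness, narrow continuity and compactness\<close>

lemma continuous_map_funpow:
  assumes "continuous_map X X Q" shows "continuous_map X X (Q ^^ j)"
proof (induction j)
  case (Suc j)
  then show ?case using continuous_map_compose[OF Suc assms] by (simp add: o_def)
qed (simp add: id_def)

text \<open>The topology is left abstract because the argument is needed for
  \<open>wp_top p\<close>, to isolate, and for \<open>weak_top p\<close>, to get
  compactness.\<close>

lemma closedin_nbhd_preimage:
  assumes "continuous_map X X P" "closedin X (moment_ball p a bd)" "topspace X = Pp p"
  shows "closedin X nbhd"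
proof -
  have "closedin X {\<mu> \<in> topspace X. (P ^^ j) \<mu> \<in> moment_ball p a bd}" for j
    by (rule closedin_continuous_map_preimage[OF continuous_map_funpow[OF assms(1)] assms(2)])
  then have "closedin X (\<Inter>j. {\<mu> \<in> Pp p. (P ^^ j) \<mu> \<in> moment_ball p a bd})"
    by (intro closedin_INT) (auto simp: assms(3))
  moreover have "nbhd = (\<Inter>j. {\<mu> \<in> Pp p. (P ^^ j) \<mu> \<in> moment_ball p a bd})" by (auto simp: nbhd_def)
  ultimately show ?thesis by simp
qed

lemma closedin_nbhd: "closedin (wp_top p) nbhd"
proof -
  have mb: "moment_ball p a bd = {\<mu> \<in> Pp p. Lp_le p \<mu> (\<lambda>x. dist x a) bd}"
    using moment_ball_Pp[OF p, of a bd] by (auto simp: moment_ball_def Pp_Prob)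
  have "closedin (wp_top p) (moment_ball p a bd)"
    unfolding mb by (intro closedin_Lp_le bd_nonneg continuous_intros) auto
  then show ?thesis by (rule closedin_nbhd_preimage[OF P_cont _ topspace_wp])
qed

text \<open>The map is a composition of \<open>wp_top\<close>-continuous ones: \<open>x\<close> to
  its Dirac mass, then \<open>P\<close>, which turns it into \<open>k x\<close>, then integration of
  \<open>g\<close>.\<close>

lemma kernel_Feller:
  assumes g: "bounded_continuous g"
  shows "bounded_continuous (\<lambda>x. \<integral>y. g y \<partial>k x)"
proof
  obtain H where H: "0 < H" "\<And>x. \<bar>g x\<bar> \<le> H" and gm: "g \<in> borel_measurable borel"
    using bounded_continuousD[OF g] by blast
  have eq: "P (return borel x) = k x" for x
    using P_bind[OF return_in_Pp[OF p]] bind_return[OF measurable_prob_algebraD[OF k], of x] by simp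
  have "continuous_map euclidean euclideanreal ((\<lambda>\<mu>. \<integral>y. g y \<partial>\<mu>) \<circ> (P \<circ> (\<lambda>x. return borel x)))"
    by (rule continuous_map_compose[OF continuous_map_compose[OF continuous_map_return P_cont] continuous_map_wp_integral[OF g]])
  then show "continuous_on UNIV (\<lambda>x. \<integral>y. g y \<partial>k x)" by (simp add: o_def eq)
  have "\<bar>\<integral>y. g y \<partial>k x\<bar> \<le> H" for x
  proof -
    interpret prob_space "k x" by (rule ProbD[OF kernel_Prob[OF k]])
    have i: "integrable (k x) g" by (rule integrable_bounded_continuous[OF g kernel_Prob[OF k]])
    have "\<bar>\<integral>y. g y \<partial>k x\<bar> \<le> (\<integral>y. \<bar>g y\<bar> \<partial>k x)" by (rule integral_abs_bound)
    also have "\<dots> \<le> (\<integral>y. H \<partial>k x)" using i H by (intro integral_mono) auto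
    finally show ?thesis by (simp add: prob_space)
  qed
  then show "bounded (range (\<lambda>x. \<integral>y. g y \<partial>k x))" by (auto simp: bounded_iff)
qed

lemma integral_P:
  assumes g: "bounded_continuous g" and \<mu>: "\<mu> \<in> Pp p"
  shows "(\<integral>y. g y \<partial>P \<mu>) = (\<integral>x. (\<integral>y. g y \<partial>k x) \<partial>\<mu>)"
proof -
  obtain H where H: "\<And>x. \<bar>g x\<bar> \<le> H" and gm: "g \<in> borel_measurable borel"
    using bounded_continuousD[OF g] by blast
  interpret prob_space \<mu> by (rule ProbD[OF Pp_Prob[OF \<mu>]])
  have "emeasure (k x) (space (k x)) \<le> ennreal 1" for x
    using prob_space.emeasure_space_1[OF ProbD(1)[OF kernel_Prob[OF k]]] by simp
  then show ?thesis
    unfolding P_bind[OF \<mu>] using H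
    by (intro integral_bind[OF gm _ kernel_subprob[OF k Pp_Prob[OF \<mu>]] finite_measure_axioms, of H 1]) auto
qed

lemma continuous_map_weak_integral:
  "bounded_continuous g \<Longrightarrow> continuous_map (weak_top p) euclideanreal (\<lambda>\<mu>. \<integral>x. g x \<partial>\<mu>)"
  unfolding weak_top_def by (intro continuous_map_from_subtopology continuous_map_narrow_integral)

text \<open>By duality: integrating \<open>g\<close> against \<open>P \<mu>\<close> is integrating
  against \<open>\<mu>\<close> a function that is again bounded and continuous by the Feller
  property.\<close>

lemma continuous_map_weak: "continuous_map (weak_top p) (weak_top p) P"
proof -
  have "continuous_map (weak_top p) narrow_top P"
  proof (rule continuous_map_into_narrow)
    show "P \<mu> \<in> Prob" if "\<mu> \<in> topspace (weak_top p)" for \<mu>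
      using that by (auto simp: topspace_weak intro: Pp_Prob P_Pp)
    fix g :: "'a \<Rightarrow> real" assume g: "bounded_continuous g"
    show "continuous_map (weak_top p) euclideanreal (\<lambda>\<mu>. \<integral>y. g y \<partial>P \<mu>)"
      by (rule continuous_map_eq[OF continuous_map_weak_integral[OF kernel_Feller[OF g]]])
         (simp add: topspace_weak integral_P[OF g])
  qed
  then show ?thesis
    using P_Pp topspace_weak[of p, where 'a='a]
    unfolding weak_top_def by (subst continuous_map_in_subtopology) auto
qed

lemma Hausdorff_weak: "Hausdorff_space (weak_top p :: 'a measure topology)"
  unfolding weak_top_def by (rule Hausdorff_space_subtopology[OF Hausdorff_narrow])

lemma compactin_weak_moment_ball: "compactin (weak_top p) (moment_ball p a C)"
  unfolding weak_top_def compactin_subtopology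
  using compactin_moment_ball[OF proper p] moment_ball_Pp[OF p] by blast

lemma compactin_nbhd: "compactin (weak_top p) nbhd"
  by (rule closed_compactin[OF compactin_weak_moment_ball nbhd_moment_ball
        closedin_nbhd_preimage[OF continuous_map_weak _ topspace_weak]])
     (rule compactin_imp_closedin[OF Hausdorff_weak compactin_weak_moment_ball])

lemma closedin_iterate: "closedin (weak_top p) ((P ^^ i) ` nbhd)"
  by (rule compactin_imp_closedin[OF Hausdorff_weak
        image_compactin[OF compactin_nbhd continuous_map_funpow[OF continuous_map_weak]]])

section \<open>The core as maximal invariant set and weak attractor\<close>

lemma iterate_mono:
  assumes "i \<le> j" shows "(P ^^ j) ` nbhd \<subseteq> (P ^^ i) ` nbhd"
proof
  fix x assume "x \<in> (P ^^ j) ` nbhd"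
  then obtain y where y: "y \<in> nbhd" "x = (P ^^ j) y" by blast
  have "P ^^ j = P ^^ i \<circ> P ^^ (j - i)" using assms by (simp flip: funpow_add)
  then have "x = (P ^^ i) ((P ^^ (j - i)) y)" using y(2) by simp
  then show "x \<in> (P ^^ i) ` nbhd" using nbhd_invariant[OF y(1)] by blast
qed

lemma core_nbhd: "core \<subseteq> nbhd"
proof -
  have "core \<subseteq> (P ^^ 0) ` nbhd" unfolding core_def by (rule INT_lower) simp
  then show ?thesis by simp
qed

lemma compactin_core: "compactin (weak_top p) core"
proof (rule closed_compactin[OF compactin_nbhd core_nbhd])
  show "closedin (weak_top p) core" unfolding core_def by (intro closedin_INT closedin_iterate) auto
qed

lemma core_invariant: "P ` core = core"
proof
  show "P ` core \<subseteq> core"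
  proof
    fix x assume "x \<in> P ` core"
    then obtain y where y: "y \<in> core" "x = P y" by blast
    show "x \<in> core"
      unfolding core_def
    proof
      fix i
      obtain z where z: "z \<in> nbhd" "y = (P ^^ i) z" using y(1) by (auto simp: core_def)
      have "x = (P ^^ i) (P z)" using y(2) z(2) by (simp add: funpow_swap1)
      then show "x \<in> (P ^^ i) ` nbhd" using nbhd_invariant[OF z(1), of 1] by auto
    qed
  qed
  show "core \<subseteq> P ` core"
  proof
    fix x assume x: "x \<in> core"
    \<comment> \<open>\<open>C i\<close> collects the preimages of \<open>x\<close> in the
      \<open>i\<close>-th image; it is nonempty because \<open>x\<close> lies in the image number
      \<open>Suc i\<close>. Compactness gives a preimage common to all \<open>i\<close>, which lies
      in \<open>core\<close>.\<close>
    define C where "C i = (P ^^ i) ` nbhd \<inter> {y \<in> topspace (weak_top p). P y \<in> {x}}" for i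
    have xP: "x \<in> topspace (weak_top p)" using x core_nbhd nbhd_Pp by (auto simp: topspace_weak)
    have "closedin (weak_top p) {x}" using xP closedin_Hausdorff_singleton[OF Hausdorff_weak] by blast
    then have "closedin (weak_top p) {y \<in> topspace (weak_top p). P y \<in> {x}}"
      by (rule closedin_continuous_map_preimage[OF continuous_map_weak])
    then have "closedin (weak_top p) (C i)" for i
      unfolding C_def by (intro closedin_Int closedin_iterate)
    moreover have CN: "C i \<subseteq> nbhd" for i using nbhd_invariant by (auto simp: C_def)
    moreover have "closedin (weak_top p) nbhd" using closedin_iterate[of 0] by simp
    ultimately have cl: "closedin (subtopology (weak_top p) nbhd) (C i)" for i
      by (simp add: closedin_closed_subtopology)
    have ne: "C i \<noteq> {}" for i
    proof -
      have "x \<in> (P ^^ Suc i) ` nbhd" using x unfolding core_def by blast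
      then obtain z where z: "z \<in> nbhd" "x = P ((P ^^ i) z)" by auto
      then have "(P ^^ i) z \<in> C i" using nbhd_invariant[OF z(1), of i] nbhd_Pp by (auto simp: C_def topspace_weak)
      then show ?thesis by blast
    qed
    have dec: "decseq C" unfolding C_def decseq_def using iterate_mono by blast
    have "compact_space (subtopology (weak_top p) nbhd)"
      using compactin_nbhd by (simp add: compact_space_subtopology)
    then have "(\<Inter>i. C i) \<noteq> {}" by (rule compact_space_imp_nest[OF _ cl ne dec])
    then obtain y where y: "\<And>i. y \<in> C i" by auto
    then have "y \<in> core" "x = P y" by (auto simp: C_def core_def)
    then show "x \<in> P ` core" by blast
  qed
qed

lemma orbit_in_nbhd:
  fixes \<sigma> :: "int \<Rightarrow> 'a measure"
  assumes "\<And>i. P (\<sigma> i) = \<sigma> (i + 1)" "range \<sigma> \<subseteq> Pp p" "wp_bounded p (range \<sigma>)"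
  shows "range \<sigma> \<subseteq> nbhd"
proof
  fix x assume "x \<in> range \<sigma>"
  then obtain i where i: "x = \<sigma> i" by blast
  have "moment_le x (2 * D + 1)" unfolding i by (rule moment_le_mono[OF orbit_moment[OF assms]]) simp
  then show "x \<in> nbhd" using i assms(2) by (intro nbhdI) auto
qed

text \<open>Every bounded full orbit already lies in \<open>nbhd\<close>, so all sets between
  \<open>nbhd\<close> and \<open>Pp p\<close> have the same maximal invariant set. The two extreme
  choices of \<open>N\<close> give isolation and the statement on all bounded orbits.\<close>

lemma max_inv_core:
  assumes N: "nbhd \<subseteq> N" "N \<subseteq> Pp p"
  shows "max_inv p P N = core"
proof
  show "max_inv p P N \<subseteq> core"
  proof
    fix x assume "x \<in> max_inv p P N"
    then obtain \<sigma> :: "int \<Rightarrow> 'a measure" where \<sigma>: "x \<in> range \<sigma>" "range \<sigma> \<subseteq> N"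
      "\<forall>i. P (\<sigma> i) = \<sigma> (i + 1)" "wp_bounded p (range \<sigma>)"
      unfolding max_inv_def by blast
    then have orb: "\<And>i. P (\<sigma> i) = \<sigma> (i + 1)" by blast
    have r: "range \<sigma> \<subseteq> nbhd" by (rule orbit_in_nbhd[OF orb _ \<sigma>(4)]) (use \<sigma>(2) N in blast)
    obtain i where i: "x = \<sigma> i" using \<sigma>(1) by blast
    have "x = (P ^^ n) (\<sigma> (i - int n))" for n by (simp add: orbit_funpow[of \<sigma>, OF orb] i)
    then show "x \<in> core" unfolding core_def using r by blast
  qed
  show "core \<subseteq> max_inv p P N"
  proof
    fix x assume x: "x \<in> core"
    \<comment> \<open>\<open>q\<close> chooses preimages inside \<open>core\<close>, available as
      \<open>P\<close> maps \<open>core\<close> onto itself; iterating it builds the backward half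
      of an orbit.\<close>
    define q where "q y = (SOME z. z \<in> core \<and> P z = y)" for y
    have q: "q y \<in> core" "P (q y) = y" if "y \<in> core" for y
    proof -
      have "y \<in> P ` core" using that by (simp add: core_invariant)
      then have "\<exists>z. z \<in> core \<and> P z = y" by auto
      from someI_ex[OF this] show "q y \<in> core" "P (q y) = y" by (auto simp: q_def)
    qed
    have qn: "(q ^^ n) x \<in> core" for n by (induction n) (auto simp: x q)
    have pn: "(P ^^ n) x \<in> core" for n
    proof (induction n)
      case (Suc n)
      then have "P ((P ^^ n) x) \<in> P ` core" by (rule imageI)
      then show ?case by (simp add: core_invariant)
    qed (simp add: x)
    define \<sigma> where "\<sigma> i = (if 0 \<le> i then (P ^^ nat i) x else (q ^^ nat (- i)) x)" for i :: int
    have r: "range \<sigma> \<subseteq> core" using pn qn by (auto simp: \<sigma>_def)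
    have "P (\<sigma> i) = \<sigma> (i + 1)" for i
    proof (cases "0 \<le> i")
      case True
      then have "nat (i + 1) = Suc (nat i)" by simp
      then show ?thesis using True by (simp add: \<sigma>_def)
    next
      case False
      define n where "n = nat (- i) - 1"
      have n: "nat (- i) = Suc n" "nat (- (i + 1)) = n" using False by (auto simp: n_def)
      have "P (\<sigma> i) = (q ^^ n) x" using False n(1) q(2)[OF qn[of n]] by (simp add: \<sigma>_def)
      also have "\<dots> = \<sigma> (i + 1)"
      proof (cases "i = -1")
        case True
        then show ?thesis using n by (simp add: \<sigma>_def)
      next
        case False': False
        then show ?thesis using False n(2) by (simp add: \<sigma>_def)
      qed
      finally show ?thesis .
    qed
    moreover have "x \<in> range \<sigma>" by (rule range_eqI[of _ _ 0]) (simp add: \<sigma>_def)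
    moreover have "range \<sigma> \<subseteq> N" using r core_nbhd N(1) by blast
    moreover have "wp_bounded p (range \<sigma>)" using r core_nbhd by (intro nbhd_bounded) blast
    ultimately show "x \<in> max_inv p P N" unfolding max_inv_def by blast
  qed
qed

lemma isolating_nbhd_core: "isolating_nbhd p P nbhd core"
  unfolding isolating_nbhd_def
proof (intro conjI nbhd_Pp closedin_nbhd max_inv_core order_refl)
  \<comment> \<open>Points of \<open>core\<close> lie on bounded full orbits and so have moment
    bound \<open>2 * D\<close>; the strict bound \<open>2 * D + 1\<close> gives an open set that
    still lies in \<open>nbhd\<close>.\<close>
  define V where "V = {\<mu> \<in> Pp p. \<exists>c<2 * D + 1. Lp_le p \<mu> (\<lambda>x. dist x a) c}"
  have "openin (wp_top p) V" unfolding V_def by (rule openin_Lp_less[OF dist_Lip]) simp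
  moreover have "V \<subseteq> nbhd"
    unfolding V_def by (auto intro!: nbhdI intro: moment_le_mono)
  moreover have "core \<subseteq> V"
  proof
    fix x assume x: "x \<in> core"
    then have "x \<in> max_inv p P (Pp p)" using max_inv_core[OF nbhd_Pp order_refl] by simp
    then obtain \<sigma> :: "int \<Rightarrow> 'a measure" where \<sigma>: "x \<in> range \<sigma>" "range \<sigma> \<subseteq> Pp p"
      "\<forall>i. P (\<sigma> i) = \<sigma> (i + 1)" "wp_bounded p (range \<sigma>)"
      unfolding max_inv_def by blast
    obtain i where "x = \<sigma> i" using \<sigma>(1) by blast
    moreover have "moment_le (\<sigma> i) (2 * D)" using \<sigma> by (intro orbit_moment) auto
    moreover have "2 * D < 2 * D + 1" by simp
    ultimately show "x \<in> V" unfolding V_def using \<sigma>(1,2) by blast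
  qed
  ultimately show "\<exists>V. openin (wp_top p) V \<and> core \<subseteq> V \<and> V \<subseteq> nbhd" by blast
qed

lemma pos_invariant_nbhd: "pos_invariant P nbhd"
  unfolding pos_invariant_def using nbhd_invariant[of _ 1] by auto

lemma weak_attractor_core: "weak_attractor p P core"
  unfolding weak_attractor_def
proof (intro conjI core_invariant, rule exI[of _ nbhd], intro conjI isolating_nbhd_core pos_invariant_nbhd allI impI; elim conjE)
  fix \<mu>s :: "nat \<Rightarrow> 'a measure" and m :: "nat \<Rightarrow> nat" and \<nu>
  assume \<mu>s: "\<forall>n. \<mu>s n \<in> nbhd" and m: "filterlim m at_top sequentially"
    and lim: "limitin (weak_top p) (\<lambda>n. (P ^^ m n) (\<mu>s n)) \<nu> sequentially"
  show "\<nu> \<in> core"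
    unfolding core_def
  proof
    fix i
    have "\<forall>\<^sub>F n in sequentially. i \<le> m n" using m by (simp add: filterlim_at_top)
    then have "\<forall>\<^sub>F n in sequentially. (P ^^ m n) (\<mu>s n) \<in> (P ^^ i) ` nbhd"
      by eventually_elim (use iterate_mono \<mu>s in blast)
    then show "\<nu> \<in> (P ^^ i) ` nbhd" by (rule limitin_closedin[OF lim closedin_iterate]) simp
  qed
qed

text \<open>The Krylov--Bogoliubov argument, with the nested closed sets of measures that are invariant up to \<open>2 / (n + 1)\<close>.\<close>

lemma stationary_exists: "\<exists>\<nu>\<in>core. P \<nu> = \<nu>"
proof -
  define Q where "Q g x = (\<integral>y. g y \<partial>k x)" for g :: "'a \<Rightarrow> real" and x
  \<comment> \<open>Test functions bounded by 1 allow the same tolerance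
    \<open>2 / (real n + 1)\<close> for all of them; general ones are rescaled at the end.\<close>
  define G where "G = {g :: 'a \<Rightarrow> real. bounded_continuous g \<and> (\<forall>x. \<bar>g x\<bar> \<le> 1)}"
  have zero: "(\<lambda>_. 0) \<in> G" by (auto simp: G_def)
  define M where "M = moment_ball p a bd"
  define I where "I n = {- (2 / (real n + 1))..2 / (real n + 1)}" for n :: nat
  have closed_I: "closed (I n)" for n by (simp add: I_def)
  define E where "E n = (\<Inter>g\<in>G. {\<mu> \<in> M. (\<integral>x. Q g x \<partial>\<mu>) - (\<integral>x. g x \<partial>\<mu>) \<in> I n})" for n :: nat
  have MP: "M \<subseteq> Pp p" unfolding M_def by (rule moment_ball_Pp[OF p])
  have Mc: "compactin (weak_top p) M" unfolding M_def by (rule compactin_weak_moment_ball)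
  then have Mcl: "closedin (weak_top p) M" by (rule compactin_imp_closedin[OF Hausdorff_weak])
  have cl: "closedin (subtopology (weak_top p) M) (E n)" for n
  proof -
    have "closedin (weak_top p) {\<mu> \<in> M. (\<integral>x. Q g x \<partial>\<mu>) - (\<integral>x. g x \<partial>\<mu>) \<in> I n}"
      if "g \<in> G" for g
    proof -
      have g: "bounded_continuous g" using that by (simp add: G_def)
      have "continuous_map (weak_top p) euclideanreal (\<lambda>\<mu>. (\<integral>x. Q g x \<partial>\<mu>) - (\<integral>x. g x \<partial>\<mu>))"
        unfolding Q_def by (intro continuous_map_diff continuous_map_weak_integral kernel_Feller g)
      then have "closedin (weak_top p) {\<mu> \<in> topspace (weak_top p). (\<integral>x. Q g x \<partial>\<mu>) - (\<integral>x. g x \<partial>\<mu>) \<in> I n}"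
        by (rule closedin_continuous_map_preimage) (simp add: closed_I)
      then have "closedin (weak_top p) (M \<inter> {\<mu> \<in> topspace (weak_top p). (\<integral>x. Q g x \<partial>\<mu>) - (\<integral>x. g x \<partial>\<mu>) \<in> I n})"
        by (rule closedin_Int[OF Mcl])
      moreover have "M \<inter> {\<mu> \<in> topspace (weak_top p). (\<integral>x. Q g x \<partial>\<mu>) - (\<integral>x. g x \<partial>\<mu>) \<in> I n}
         = {\<mu> \<in> M. (\<integral>x. Q g x \<partial>\<mu>) - (\<integral>x. g x \<partial>\<mu>) \<in> I n}"
        using MP by (auto simp: topspace_weak)
      ultimately show ?thesis by simp
    qed
    then have "closedin (weak_top p) (E n)" unfolding E_def using zero by (intro closedin_INT) auto
    moreover have "E n \<subseteq> M" unfolding E_def using zero by blast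
    ultimately show ?thesis by (simp add: closedin_closed_subtopology[OF Mcl])
  qed
  have ne: "E n \<noteq> {}" for n
  proof -
    define orb where "orb j = (P ^^ j) (return borel a)" for j
    have orbM: "orb j \<in> M" for j using return_nbhd by (simp add: orb_def M_def nbhd_def)
    then have orbP: "orb j \<in> Prob" "moment_le (orb j) bd" "orb j \<in> Pp p" for j
      using MP by (auto simp: M_def moment_ball_def)
    \<comment> \<open>The average over the times 0 to \<open>n\<close> is the law of the orbit at a
      uniformly random time. As a \<open>bind\<close> it inherits the moment bound, and the defect
      of invariance telescopes to two terms over \<open>n + 1\<close>.\<close>
    define q where "q = measure_pmf (pmf_of_set {..n})"
    define av where "av = bind q orb"
    have orb_m: "orb \<in> q \<rightarrow>\<^sub>M subprob_algebra borel"
      using orbP(1) by (auto simp: q_def space_subprob_algebra ProbD prob_space_imp_subprob_space)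
    have "prob_space av"
      unfolding av_def q_def
      by (rule prob_space.prob_space_bind[OF prob_space_measure_pmf _ orb_m[unfolded q_def]]) (simp add: ProbD orbP(1))
    moreover have "sets av = sets borel"
      unfolding av_def by (rule sets_bind) (auto simp: ProbD orbP(1) q_def)
    ultimately have av: "av \<in> Prob" by (simp add: Prob_def)
    have "moment_le av bd"
      unfolding av_def
      by (rule Lp_le_bind[OF orb_m, where B="\<lambda>_. bd"])
         (auto simp: orbP q_def intro!: Lp_le_const prob_space_measure_pmf bd_nonneg)
    then have avM: "av \<in> M" using av by (simp add: M_def moment_ball_def)
    have int: "(\<integral>x. g x \<partial>av) = (\<Sum>j\<le>n. \<integral>x. g x \<partial>orb j) / (real n + 1)" if g: "bounded_continuous g" for g
    proof -
      obtain H where H: "\<And>x. \<bar>g x\<bar> \<le> H" and gm: "g \<in> borel_measurable borel"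
        using bounded_continuousD[OF g] by blast
      have "emeasure (orb j) (space (orb j)) \<le> ennreal 1" for j
        using prob_space.emeasure_space_1[OF ProbD(1)[OF orbP(1)]] by simp
      then have "(\<integral>x. g x \<partial>av) = (\<integral>j. (\<integral>x. g x \<partial>orb j) \<partial>q)"
        unfolding av_def using H
        by (intro integral_bind[OF gm _ orb_m, of H 1]) (auto simp: q_def intro: measure_pmf.finite_measure_axioms)
      also have "\<dots> = (\<Sum>j\<le>n. \<integral>x. g x \<partial>orb j) / (real n + 1)"
        unfolding q_def by (subst integral_pmf_of_set) (auto simp: add.commute)
      finally show ?thesis .
    qed
    have "(\<integral>x. Q g x \<partial>av) - (\<integral>x. g x \<partial>av) \<in> I n" if "g \<in> G" for g
    proof -
      have g: "bounded_continuous g" and g1: "\<And>x. \<bar>g x\<bar> \<le> 1" using that by (auto simp: G_def)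
      define S where "S j = (\<integral>x. g x \<partial>orb j)" for j
      have "(\<integral>x. Q g x \<partial>orb j) = S (Suc j)" for j
        using integral_P[OF g orbP(3)[of j]] by (simp add: Q_def S_def orb_def)
      then have "(\<integral>x. Q g x \<partial>av) - (\<integral>x. g x \<partial>av) = ((\<Sum>j\<le>n. S (Suc j)) - (\<Sum>j\<le>n. S j)) / (real n + 1)"
        using int[OF kernel_Feller[OF g]] int[OF g] by (simp add: Q_def S_def diff_divide_distrib)
      also have "(\<Sum>j\<le>n. S (Suc j)) - (\<Sum>j\<le>n. S j) = S (Suc n) - S 0"
        by (induction n) auto
      finally have eq: "(\<integral>x. Q g x \<partial>av) - (\<integral>x. g x \<partial>av) = (S (Suc n) - S 0) / (real n + 1)" .
      have "\<bar>S j\<bar> \<le> 1" for j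
      proof -
        interpret prob_space "orb j" by (rule ProbD[OF orbP(1)])
        have i: "integrable (orb j) g" by (rule integrable_bounded_continuous[OF g orbP(1)])
        have "\<bar>S j\<bar> \<le> (\<integral>x. \<bar>g x\<bar> \<partial>orb j)" unfolding S_def by (rule integral_abs_bound)
        also have "\<dots> \<le> (\<integral>x. 1 \<partial>orb j)" using i g1 by (intro integral_mono) auto
        finally show ?thesis by (simp add: prob_space)
      qed
      from this[of "Suc n"] this[of 0] have "\<bar>S (Suc n) - S 0\<bar> \<le> 2" by linarith
      then have "\<bar>(S (Suc n) - S 0) / (real n + 1)\<bar> \<le> 2 / (real n + 1)"
        by (simp add: abs_divide divide_right_mono)
      then show ?thesis unfolding eq I_def atLeastAtMost_iff by linarith
    qed
    then have "av \<in> E n" unfolding E_def using avM by blast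
    then show ?thesis by blast
  qed
  have dec: "decseq E"
  proof (rule decseq_SucI)
    fix n
    have "2 / (real (Suc n) + 1) \<le> 2 / (real n + 1)" by (intro divide_left_mono) auto
    then have "I (Suc n) \<subseteq> I n"
      unfolding I_def by (intro atLeastatMost_subset_iff[THEN iffD2] disjI2) linarith
    then show "E (Suc n) \<subseteq> E n"
      unfolding E_def by (intro INF_superset_mono order_refl Collect_mono impI conj_mono) blast+
  qed
  have "compact_space (subtopology (weak_top p) M)"
    using Mc by (simp add: compact_space_subtopology)
  then have "(\<Inter>n. E n) \<noteq> {}" by (rule compact_space_imp_nest[OF _ cl ne dec])
  then obtain \<nu> where \<nu>: "\<And>n. \<nu> \<in> E n" by auto
  then have "\<nu> \<in> M" using zero by (auto simp: E_def)
  then have \<nu>P: "\<nu> \<in> Pp p" using MP by blast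
  have inv1: "(\<integral>x. Q g x \<partial>\<nu>) = (\<integral>x. g x \<partial>\<nu>)" if "g \<in> G" for g
  proof -
    define x where "x = \<bar>(\<integral>x. Q g x \<partial>\<nu>) - (\<integral>x. g x \<partial>\<nu>)\<bar>"
    have *: "x \<le> 2 / (real n + 1)" for n
      using \<nu>[of n] that unfolding E_def x_def I_def by (auto simp: abs_le_iff)
    have "x \<le> 0"
    proof (rule ccontr)
      assume "\<not> x \<le> 0"
      then obtain n :: nat where n: "2 < real n * x" using reals_Archimedean3[of x] by auto
      have "x * (real n + 1) \<le> 2" using *[of n] by (simp add: field_simps)
      then show False using n \<open>\<not> x \<le> 0\<close> by (simp add: algebra_simps)
    qed
    then show ?thesis by (simp add: x_def)
  qed
  have "P \<nu> = \<nu>"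
  proof (rule Prob_eqI[OF Pp_Prob[OF P_Pp[OF \<nu>P]] Pp_Prob[OF \<nu>P]])
    fix g :: "'a \<Rightarrow> real" assume g: "bounded_continuous g"
    obtain H where H: "0 < H" "\<And>x. \<bar>g x\<bar> \<le> H" using bounded_continuousD[OF g] by blast
    define g' where "g' x = g x / H" for x
    have "\<bar>g' x\<bar> \<le> 1" for x using H by (simp add: g'_def abs_divide)
    then have "g' \<in> G" using g H
      by (auto simp: G_def g'_def[abs_def] bounded_iff intro!: continuous_intros exI[of _ 1])
    from inv1[OF this] have "(\<integral>x. Q g x \<partial>\<nu>) / H = (\<integral>x. g x \<partial>\<nu>) / H"
      by (simp add: Q_def g'_def)
    then have "(\<integral>x. Q g x \<partial>\<nu>) = (\<integral>x. g x \<partial>\<nu>)" using H(1) by simp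
    then show "(\<integral>x. g x \<partial>P \<nu>) = (\<integral>x. g x \<partial>\<nu>)" by (simp add: integral_P[OF g \<nu>P] Q_def)
  qed
  moreover have "\<nu> \<in> core"
  proof -
    have "(P ^^ j) \<nu> = \<nu>" for j by (induction j) (auto simp: \<open>P \<nu> = \<nu>\<close>)
    note fixed = this
    have "\<nu> \<in> nbhd" using \<nu>P \<open>\<nu> \<in> M\<close> by (simp add: nbhd_def M_def fixed)
    then have "\<nu> \<in> (P ^^ i) ` nbhd" for i using fixed[of i] by (intro image_eqI[of _ _ \<nu>]) simp_all
    then show ?thesis unfolding core_def by blast
  qed
  ultimately show ?thesis by blast
qed

end

text \<open>Each ball of integer radius is compact, hence has finite nets of every mesh
  \<open>1 / (real m + 1)\<close>; their union is countable and dense.\<close>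

lemma proper_dense_sequence:
  assumes "proper_space TYPE('a::metric_space)"
  shows "\<exists>e :: nat \<Rightarrow> 'a. \<forall>x r. 0 < r \<longrightarrow> (\<exists>i. dist x (e i) < r)"
proof -
  fix a :: 'a
  have "\<exists>F. finite F \<and> cball a (real n) \<subseteq> (\<Union>x\<in>F. ball x (1 / (real m + 1)))" for n m :: nat
    using assms by (simp add: proper_space_def compact_eq_totally_bounded)
  then have "\<forall>n m :: nat. \<exists>F. finite F \<and> cball a (real n) \<subseteq> (\<Union>x\<in>F. ball x (1 / (real m + 1)))" by blast
  then obtain F where F: "\<And>n m :: nat. finite (F n m)"
    "\<And>n m :: nat. cball a (real n) \<subseteq> (\<Union>x\<in>F n m. ball x (1 / (real m + 1)))" by metis
  define S where "S = insert a (\<Union>n m. F n m)"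
  have "countable S" unfolding S_def using F(1) by (simp add: countable_finite)
  then have e: "range (from_nat_into S) = S" by (intro range_from_nat_into) (auto simp: S_def)
  have "\<exists>i. dist x (from_nat_into S i) < r" if r: "0 < r" for x r
  proof -
    obtain n :: nat where n: "dist a x \<le> real n" using real_arch_simple by blast
    obtain m :: nat where m: "1 / (real m + 1) < r"
      using reals_Archimedean[OF r] by (auto simp: inverse_eq_divide add.commute)
    have "x \<in> cball a (real n)" using n by simp
    then obtain y where y: "y \<in> F n m" "dist y x < 1 / (real m + 1)" using F(2)[of n m] by auto
    then have "y \<in> range (from_nat_into S)" unfolding e by (auto simp: S_def)
    then obtain i where "y = from_nat_into S i" by blast
    then show ?thesis using y(2) m by (auto simp: dist_commute intro!: exI[of _ i])
  qed
  then show ?thesis by blast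
qed

theorem mainTheorem10:
  fixes f :: "'a::metric_space \<Rightarrow> 'a"
    and p :: real
    and P :: "nat \<Rightarrow> 'a measure \<Rightarrow> 'a measure"
    and eps :: "nat \<Rightarrow> real"
    and K :: "'a measure set"
  assumes proper: "proper_space TYPE('a)"
    and p: "1 \<le> p"
    and f_cont: "continuous_on UNIV f"
    and push_self: "(\<lambda>\<mu>. distr \<mu> borel f) ` Pp p \<subseteq> Pp p"
    and push_cont: "continuous_map (wp_top p) (wp_top p) (\<lambda>\<mu>. distr \<mu> borel f)"
    and attr: "global_attractor p (\<lambda>\<mu>. distr \<mu> borel f) K"
    and unif: "\<exists>U V. openin (wp_top p) V \<and> K \<subseteq> V \<and> V \<subseteq> U \<and> U \<subseteq> Pp p \<and>
                 (\<forall>\<epsilon>>0. \<exists>\<delta>>0. \<forall>\<mu>\<in>U. \<forall>\<nu>\<in>U. wass p \<mu> \<nu> < \<delta> \<longrightarrow>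
                    wass p (distr \<mu> borel f) (distr \<nu> borel f) < \<epsilon>)"
    and MW: "\<And>n. MW_map p f (eps n) (P n)"
    and eps: "eps \<longlonglongrightarrow> 0"
  shows "\<exists>n0. \<forall>n\<ge>n0. \<exists>N. isolating_nbhd p (P n) N (max_inv p (P n) N) \<and>
            pos_invariant (P n) N \<and>
            (let Kn = max_inv p (P n) N in
               Kn \<noteq> {} \<and> compactin (weak_top p) Kn \<and>
               weak_attractor p (P n) Kn \<and>
               max_inv p (P n) (Pp p) = Kn \<and>
               (\<exists>\<nu>\<in>Kn. P n \<nu> = \<nu>))"
proof -
  obtain e :: "nat \<Rightarrow> 'a" where e: "\<forall>x r. 0 < r \<longrightarrow> (\<exists>i. dist x (e i) < r)"
    using proper_dense_sequence[OF proper] by blast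
  interpret wass_space e p by unfold_locales (use e p proper in blast)+
  fix a :: 'a
  interpret attractor_map e p f K a
    by unfold_locales (fact f_cont push_self attr unif)+
  obtain A B where AB: "\<forall>k \<mu> c. noisy k \<longrightarrow> \<mu> \<in> Prob \<longrightarrow> Lp_le p \<mu> (\<lambda>x. dist x a) c \<longrightarrow>
     Lp_le p (bind \<mu> k) (\<lambda>x. dist x a) (B + A * c)"
    using noisy_step by (elim exE conjE)
  obtain J D where J: "0 < J" and D: "0 \<le> D"
    and JD: "\<forall>k \<mu> c. noisy k \<longrightarrow> \<mu> \<in> Prob \<longrightarrow> Lp_le p \<mu> (\<lambda>x. dist x a) c \<longrightarrow>
     Lp_le p (bind_pow k J \<mu>) (\<lambda>x. dist x a) (D + 1/2 * c)"
    using noisy_contracts by (elim exE conjE)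
  \<comment> \<open>This \<open>n0\<close> brings the noise below the normalised size 1 of
    \<open>noisy\<close>, for which \<open>A\<close>, \<open>B\<close>, \<open>J\<close> and
    \<open>D\<close> were chosen independently of \<open>n\<close>.\<close>
  have "\<forall>\<^sub>F n in sequentially. eps n < 1" using eps by (rule order_tendstoD) simp
  then obtain n0 where n0: "\<And>n. n0 \<le> n \<Longrightarrow> eps n < 1" by (auto simp: eventually_sequentially)
  show ?thesis
  proof (intro exI[of _ n0] allI impI)
    fix n assume "n0 \<le> n"
    then have eps1: "eps n \<le> 1" using n0 by (simp add: less_imp_le)
    from MW[of n] obtain k where k: "k \<in> borel \<rightarrow>\<^sub>M prob_algebra borel" and kP: "\<forall>x. k x \<in> Pp p"
      and P_bind: "\<forall>\<mu>\<in>Pp p. P n \<mu> = bind \<mu> k" and kw: "\<forall>x. wass p (k x) (return borel (f x)) \<le> eps n"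
      unfolding MW_map_def by blast
    have P_Pp: "P n \<mu> \<in> Pp p" if "\<mu> \<in> Pp p" for \<mu> using MW[of n] that unfolding MW_map_def by blast
    have P_cont: "continuous_map (wp_top p) (wp_top p) (P n)" using MW[of n] unfolding MW_map_def by blast
    \<comment> \<open>The Dirac mass at \<open>f x\<close> has norm 0 about \<open>f x\<close>, so
      the distance bound on the kernel becomes a norm bound.\<close>
    have "Lp_le p (k x) (\<lambda>y. dist y (f x)) (0 + 1)" for x
      by (rule Lp_le_wass[OF p kP[rule_format] return_in_Pp[OF p] dist_Lip])
         (use order_trans[OF kw[rule_format] eps1] in \<open>auto simp: Lp_le_return[OF p]\<close>)
    then have nk: "noisy k" using k by (simp add: noisy_def)
    \<comment> \<open>\<open>P n\<close> agrees with \<open>bind\<close> only on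
      \<open>Pp p\<close>, so the identification of the iterates has to carry membership in
      \<open>Pp p\<close> along.\<close>
    have iter: "(P n ^^ j) \<mu> = bind_pow k j \<mu> \<and> (P n ^^ j) \<mu> \<in> Pp p" if "\<mu> \<in> Pp p" for \<mu> j
    proof (induction j)
      case (Suc j)
      then have "P n ((P n ^^ j) \<mu>) = bind ((P n ^^ j) \<mu>) k" "P n ((P n ^^ j) \<mu>) \<in> Pp p"
        using P_bind P_Pp by blast+
      then show ?case using Suc by simp
    qed (use that in simp)
    interpret noisy_map e p "P n" k a A B D J
    proof
      show "Lp_le p (P n \<mu>) (\<lambda>x. dist x a) (B + A * c)" if "\<mu> \<in> Pp p" "Lp_le p \<mu> (\<lambda>x. dist x a) c" for \<mu> c
        using AB[rule_format, OF nk Pp_Prob[OF that(1)] that(2)] P_bind that(1) by simp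
      show "Lp_le p ((P n ^^ J) \<mu>) (\<lambda>x. dist x a) (D + 1/2 * c)" if "\<mu> \<in> Pp p" "Lp_le p \<mu> (\<lambda>x. dist x a) c" for \<mu> c
        using JD[rule_format, OF nk Pp_Prob[OF that(1)] that(2)] iter[OF that(1), of J] by simp
    qed (use k P_bind P_Pp P_cont J D in auto)
    have inv: "max_inv p (P n) nbhd = core" "max_inv p (P n) (Pp p) = core"
      by (intro max_inv_core nbhd_Pp order_refl)+
    show "\<exists>N. isolating_nbhd p (P n) N (max_inv p (P n) N) \<and> pos_invariant (P n) N \<and>
            (let Kn = max_inv p (P n) N in
               Kn \<noteq> {} \<and> compactin (weak_top p) Kn \<and> weak_attractor p (P n) Kn \<and>
               max_inv p (P n) (Pp p) = Kn \<and> (\<exists>\<nu>\<in>Kn. P n \<nu> = \<nu>))"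
      unfolding Let_def
      by (rule exI[of _ nbhd], unfold inv)
         (use isolating_nbhd_core pos_invariant_nbhd compactin_core weak_attractor_core stationary_exists in blast)
  qed
qed

end
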